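(* The characteristic function of the anticyclic operad $\operatorname{Perm}$ is $$\mathbf{Ch}(\operatorname{Perm})=(p_1-1)\exp\Big(\sum_{k\ge1}\frac{p_k}{k}\Big)+1.$$
   Context: All vector spaces are over $\mathbb{Q}$. The symmetric group $\mathfrak{S}_n$ acts on $\mathcal{P}(n)$ by $(\sigma\cdot E)(x_1,\dots,x_n)=E(x_{\sigma(1)},\dots,x_{\sigma(n)})$. An anticyclic operad is a symmetric operad $\mathcal{P}$ (unit $1\in\mathcal{P}(1)$, partial compositions $\circ_i$) together with an action of $\mathfrak{S}_{n+1}$ on each $\mathcal{P}(n)$ extending the action of $\mathfrak{S}_n$ (the stabilizer of $n+1$), such that, writing $\tau_n$ for the action of the long cycle $(n+1,n,\dots,2,1)$ ($1\mapsto n+1$, $i\mapsto i-1$ for $i\ge 2$): $\tau_1(1)=-1$ and, for $f\in\mathcal{P}(m)$, $g\in\mathcal{P}(n)$, $\tau(f\circ_i g)=\tau_m(f)\circ_{i-1}g$ for $2\le i\le m$ and $\tau(f\circ_1 g)=-\tau_n(g)\circ_n\tau_m(f)$. A morphism of anticyclic operads is a morphism of operads commuting with the actions of $\mathfrak{S}_{n+1}$. A non-symmetric anticyclic operad is a non-symmetric operad with endomorphisms $\tau_n$ of $\mathcal{P}(n)$ satisfying $\tau_n^{n+1}=\mathrm{Id}$ and these same identities. If $\mathcal{P}$ is a non-symmetric anticyclic operad, the symmetric operad with components $\mathcal{P}(n)\otimes\mathbb{Q}\mathfrak{S}_n\cong\operatorname{Ind}_{\mathbb{Z}/(n+1)\mathbb{Z}}^{\mathfrak{S}_{n+1}}\mathcal{P}(n)$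 is naturally an anticyclic operad, with $\tau_n(E\otimes 1)=\tau_n(E)\otimes 1$. The characteristic function of an anticyclic operad $\mathcal{P}$ is $\mathbf{Ch}(\mathcal{P})=\sum_{n\ge1}\mathbf{Ch}_{n+1}(\mathcal{P}(n))$, where $\mathbf{Ch}_{n+1}(\mathcal{P}(n))$ is the symmetric function (Frobenius characteristic, homogeneous of degree $n+1$) of the $\mathfrak{S}_{n+1}$-module $\mathcal{P}(n)$, i.e. $\frac{1}{(n+1)!}\sum_{\sigma\in\mathfrak{S}_{n+1}}\operatorname{tr}(\sigma)\,p_{\text{cycle type of }\sigma}$. The $p_k$ are the power sum symmetric functions; identities hold in the completed ring of symmetric functions. The non-symmetric operad $\operatorname{Dias}$ is generated by binary operations $x\dashv y$, $x\vdash y$ with relations $x\dashv(y\vdash z)=x\dashv(y\dashv z)=(x\dashv y)\dashv z$, $x\vdash(y\dashv z)=(x\vdash y)\dashv z$, $x\vdash(y\vdash z)=(x\vdash y)\vdash z=(x\dashv y)\vdash z$. It is a non-symmetric anticyclic operad with the unique structure such that $\tau_1=-\mathrm{Id}$, $\tau_2(x_1\dashv x_2)=-x_1\vdash x_2$, $\tau_2(x_1\vdash x_2)=x_1\dashv x_2-x_1\vdash x_2$. We also write $\operatorname{Dias}$ for the associated (symmetric) anticyclic operad. $\operatorname{Perm}$ is the quotient of the symmetric operad $\operatorname{Dias}$ by the ideal generated by $x_1\dashv x_2-x_2\vdash x_1$; denoting by $x_1x_2$ the image of $x_1\dashv x_2$, it is generated by the binary product $xy$ with relations $(xy)z=x(yz)=x(zy)$.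 It carries the unique anticyclic operad structure for which the quotient map from $\operatorname{Dias}$ is a morphism of anticyclic operads. *)

theory Defs
  imports
    Complex_Main
    "HOL-Library.Poly_Mapping"
    "HOL-Library.Multiset"
    "HOL-Combinatorics.Permutations"
    "HOL-Combinatorics.Multiset_Permutations"
    "HOL-Combinatorics.Orbits"
begin

alias lookup = Poly_Mapping.lookup
alias keys = Poly_Mapping.keys

section \<open>Rational vector spaces\<close>

class rat_vector = ab_group_add +
  fixes scaleQ :: "rat \<Rightarrow> 'a \<Rightarrow> 'a" (infixr \<open>*\<^sub>Q\<close> 75)
  assumes scaleQ_add_right: "a *\<^sub>Q (x + y) = a *\<^sub>Q x + a *\<^sub>Q y"
    and scaleQ_add_left: "(a + b) *\<^sub>Q x = a *\<^sub>Q x + b *\<^sub>Q x"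
    and scaleQ_scaleQ: "a *\<^sub>Q (b *\<^sub>Q x) = (a * b) *\<^sub>Q x"
    and scaleQ_one: "1 *\<^sub>Q x = x"

global_interpretation ratv: vector_space "scaleQ :: rat \<Rightarrow> 'a \<Rightarrow> 'a::rat_vector"
  by unfold_locales (fact scaleQ_add_right scaleQ_add_left scaleQ_scaleQ scaleQ_one)+

instantiation rat :: rat_vector
begin
definition scaleQ_rat :: "rat \<Rightarrow> rat \<Rightarrow> rat" where "scaleQ_rat a x = a * x"
instance by standard (simp_all add: scaleQ_rat_def algebra_simps)
end

instantiation poly_mapping :: (type, rat_vector) rat_vector
begin
definition scaleQ_poly_mapping :: "rat \<Rightarrow> ('a \<Rightarrow>\<^sub>0 'b) \<Rightarrow> ('a \<Rightarrow>\<^sub>0 'b)"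
  where "scaleQ_poly_mapping a = Poly_Mapping.map (scaleQ a)"

lemma lookup_scaleQ: "lookup (a *\<^sub>Q f) k = a *\<^sub>Q lookup f k" for f :: "'a \<Rightarrow>\<^sub>0 'b"
  by (simp add: scaleQ_poly_mapping_def map.rep_eq when_def)

instance
  by standard (rule poly_mapping_eqI,
      simp add: lookup_scaleQ lookup_add scaleQ_add_right scaleQ_add_left scaleQ_scaleQ scaleQ_one)+
end

definition lin_on :: "'a::rat_vector set \<Rightarrow> ('a \<Rightarrow> 'b::rat_vector) \<Rightarrow> bool" where
  "lin_on V f \<longleftrightarrow> (\<forall>x\<in>V. \<forall>y\<in>V. f (x + y) = f x + f y) \<and> (\<forall>a. \<forall>x\<in>V. f (a *\<^sub>Q x) = a *\<^sub>Q f x)"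

text \<open>The trace of an endomorphism of a finite-dimensional subspace, computed in some basis.\<close>

definition trace_on :: "'a::rat_vector set \<Rightarrow> ('a \<Rightarrow> 'a) \<Rightarrow> rat" where
  "trace_on V f =
    (let B = (SOME B. ratv.independent B \<and> ratv.span B = V)
     in \<Sum>b\<in>B. ratv.representation B (f b) b)"


section \<open>Operads\<close>

text \<open>The direct sum of the components \<open>P(n)\<close> is realised inside a single vector space, the type
  \<^typ>\<open>'a\<close>; hence the partial compositions \<open>f \<circ>\<^sub>i g = Circ P i f g\<close> need not be told
  the arities of \<open>f\<close> and \<open>g\<close>. Arities start at \<open>1\<close>.\<close>

record 'a ns_op =
  Comp :: "nat \<Rightarrow> 'a set"
  Unit :: 'a
  Circ :: "nat \<Rightarrow> 'a \<Rightarrow> 'a \<Rightarrow> 'a"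

definition ns_operad :: "('a::rat_vector, 'z) ns_op_scheme \<Rightarrow> bool" where
  "ns_operad P \<longleftrightarrow>
     (\<forall>n. ratv.subspace (Comp P n)) \<and>
     Unit P \<in> Comp P 1 \<and>
     (\<forall>m n i. 1 \<le> i \<longrightarrow> i \<le> m \<longrightarrow> 1 \<le> n \<longrightarrow>
        (\<forall>f\<in>Comp P m. \<forall>g\<in>Comp P n. Circ P i f g \<in> Comp P (m + n - 1)) \<and>
        (\<forall>f\<in>Comp P m. lin_on (Comp P n) (Circ P i f)) \<and>
        (\<forall>g\<in>Comp P n. lin_on (Comp P m) (\<lambda>f. Circ P i f g))) \<and>
     (\<forall>n\<ge>1. \<forall>f\<in>Comp P n. Circ P 1 (Unit P) f = f \<and> (\<forall>i\<in>{1..n}. Circ P i f (Unit P) = f)) \<and>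
     (\<forall>l m n. 1 \<le> l \<longrightarrow> 1 \<le> m \<longrightarrow> 1 \<le> n \<longrightarrow>
        (\<forall>f\<in>Comp P l. \<forall>g\<in>Comp P m. \<forall>h\<in>Comp P n.
           (\<forall>i\<in>{1..l}. \<forall>j\<in>{1..m}.
              Circ P (i - 1 + j) (Circ P i f g) h = Circ P i f (Circ P j g h)) \<and>
           (\<forall>i\<in>{1..l}. \<forall>k\<in>{i<..l}.
              Circ P (k - 1 + m) (Circ P i f g) h = Circ P i (Circ P k f h) g)))"

text \<open>\<open>Act P n \<sigma>\<close> is the action of \<open>\<sigma>\<close> on \<open>P(n)\<close>. For a symmetric operad only the
  permutations \<open>\<sigma>\<close> of \<open>{1..n}\<close> matter, for an anticyclic operad those of \<open>{1..n+1}\<close>; the stabilizer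
  of \<open>n+1\<close> consists of the functions that permute \<open>{1..n}\<close>.\<close>

record 'a sym_op = "'a ns_op" +
  Act :: "nat \<Rightarrow> (nat \<Rightarrow> nat) \<Rightarrow> 'a \<Rightarrow> 'a"

definition group_action_on :: "nat \<Rightarrow> 'a::rat_vector set \<Rightarrow> ((nat \<Rightarrow> nat) \<Rightarrow> 'a \<Rightarrow> 'a) \<Rightarrow> bool" where
  "group_action_on N V \<rho> \<longleftrightarrow>
     (\<forall>\<sigma>. \<sigma> permutes {1..N} \<longrightarrow> lin_on V (\<rho> \<sigma>) \<and> \<rho> \<sigma> ` V \<subseteq> V) \<and>
     (\<forall>x\<in>V. \<rho> id x = x) \<and>
     (\<forall>\<sigma> \<sigma>'. \<sigma> permutes {1..N} \<longrightarrow> \<sigma>' permutes {1..N} \<longrightarrow>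
        (\<forall>x\<in>V. \<rho> (\<sigma> \<circ> \<sigma>') x = \<rho> \<sigma> (\<rho> \<sigma>' x)))"

text \<open>With the convention \<open>(\<sigma>\<cdot>E)(x\<^sub>1,\<dots>,x\<^sub>n) = E(x\<^bsub>\<sigma>(1)\<^esub>,\<dots>,x\<^bsub>\<sigma>(n)\<^esub>)\<close>, the \<open>i\<close>-th argument
  of \<open>f\<close> is the variable \<open>x\<^bsub>\<sigma>(i)\<^esub>\<close> of \<open>\<sigma>\<cdot>f\<close>. Substituting \<open>\<rho>\<cdot>g\<close> for this variable, where \<open>g\<close> has arity
  \<open>n\<close>, gives \<open>(\<sigma>\<cdot>f) \<circ>\<^bsub>\<sigma>(i)\<^esub> (\<rho>\<cdot>g) = \<pi>\<cdot>(f \<circ>\<^sub>i g)\<close> for the following block permutation \<open>\<pi>\<close>.\<close>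

definition block_perm :: "nat \<Rightarrow> nat \<Rightarrow> (nat \<Rightarrow> nat) \<Rightarrow> (nat \<Rightarrow> nat) \<Rightarrow> nat \<Rightarrow> nat" where
  "block_perm n i \<sigma> \<rho> p =
     (let shift = (\<lambda>a. if a > \<sigma> i then a + n - 1 else a) in
      if p < i then shift (\<sigma> p)
      else if p < i + n then \<sigma> i - 1 + \<rho> (p + 1 - i)
      else shift (\<sigma> (p + 1 - n)))"

definition symmetric_operad :: "('a::rat_vector, 'z) sym_op_scheme \<Rightarrow> bool" where
  "symmetric_operad P \<longleftrightarrow>
     ns_operad P \<and>
     (\<forall>n\<ge>1. group_action_on n (Comp P n) (Act P n)) \<and>
     (\<forall>m n i \<sigma> \<rho>. 1 \<le> i \<longrightarrow> i \<le> m \<longrightarrow> 1 \<le> n \<longrightarrow> \<sigma> permutes {1..m} \<longrightarrow> \<rho> permutes {1..n} \<longrightarrow>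
        (\<forall>f\<in>Comp P m. \<forall>g\<in>Comp P n.
           Circ P (\<sigma> i) (Act P m \<sigma> f) (Act P n \<rho> g) =
           Act P (m + n - 1) (block_perm n i \<sigma> \<rho>) (Circ P i f g)))"


subsection \<open>Anticyclic operads\<close>

definition tau_identities ::
  "('a::rat_vector, 'z) ns_op_scheme \<Rightarrow> (nat \<Rightarrow> 'a \<Rightarrow> 'a) \<Rightarrow> bool" where
  "tau_identities P \<tau> \<longleftrightarrow>
     \<tau> 1 (Unit P) = - Unit P \<and>
     (\<forall>m n. 1 \<le> m \<longrightarrow> 1 \<le> n \<longrightarrow> (\<forall>f\<in>Comp P m. \<forall>g\<in>Comp P n.
        (\<forall>i\<in>{2..m}. \<tau> (m + n - 1) (Circ P i f g) = Circ P (i - 1) (\<tau> m f) g) \<and>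
        \<tau> (m + n - 1) (Circ P 1 f g) = - Circ P n (\<tau> n g) (\<tau> m f)))"

definition ns_anticyclic :: "('a::rat_vector, 'z) ns_op_scheme \<Rightarrow> (nat \<Rightarrow> 'a \<Rightarrow> 'a) \<Rightarrow> bool" where
  "ns_anticyclic P \<tau> \<longleftrightarrow>
     ns_operad P \<and>
     (\<forall>n\<ge>1. lin_on (Comp P n) (\<tau> n) \<and> \<tau> n ` Comp P n \<subseteq> Comp P n \<and>
        (\<forall>x\<in>Comp P n. (\<tau> n ^^ (n + 1)) x = x)) \<and>
     tau_identities P \<tau>"

definition long_cycle :: "nat \<Rightarrow> nat \<Rightarrow> nat" where
  "long_cycle n i = (if i = 1 then n + 1 else if 2 \<le> i \<and> i \<le> n + 1 then i - 1 else i)"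

definition anticyclic_operad :: "('a::rat_vector, 'z) sym_op_scheme \<Rightarrow> bool" where
  "anticyclic_operad P \<longleftrightarrow>
     symmetric_operad P \<and>
     (\<forall>n\<ge>1. group_action_on (n + 1) (Comp P n) (Act P n)) \<and>
     tau_identities P (\<lambda>n. Act P n (long_cycle n))"

definition anticyclic_morphism ::
  "('a::rat_vector, 'y) sym_op_scheme \<Rightarrow> ('b::rat_vector, 'z) sym_op_scheme \<Rightarrow> ('a \<Rightarrow> 'b) \<Rightarrow> bool" where
  "anticyclic_morphism P Q \<phi> \<longleftrightarrow>
     (\<forall>n\<ge>1. lin_on (Comp P n) \<phi> \<and> \<phi> ` Comp P n \<subseteq> Comp Q n) \<and>
     \<phi> (Unit P) = Unit Q \<and>
     (\<forall>m n i. 1 \<le> i \<longrightarrow> i \<le> m \<longrightarrow> 1 \<le> n \<longrightarrow>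
        (\<forall>f\<in>Comp P m. \<forall>g\<in>Comp P n. \<phi> (Circ P i f g) = Circ Q i (\<phi> f) (\<phi> g))) \<and>
     (\<forall>n\<ge>1. \<forall>\<sigma>. \<sigma> permutes {1..n + 1} \<longrightarrow> (\<forall>f\<in>Comp P n. \<phi> (Act P n \<sigma> f) = Act Q n \<sigma> (\<phi> f)))"


subsection \<open>Operadic ideals\<close>

text \<open>The ideals generated by a set \<open>R\<close> of homogeneous elements; \<open>ns_ideal P R n\<close> and
  \<open>sym_ideal P R n\<close> are their components of arity \<open>n\<close>. The symmetric version is moreover closed under
  the action of the symmetric groups on \<open>n\<close> letters.\<close>

inductive ns_ideal :: "('a::rat_vector, 'z) ns_op_scheme \<Rightarrow> 'a set \<Rightarrow> nat \<Rightarrow> 'a \<Rightarrow> bool"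
  for P R where
  "x \<in> R \<Longrightarrow> x \<in> Comp P n \<Longrightarrow> ns_ideal P R n x"
| "ns_ideal P R n 0"
| "ns_ideal P R n x \<Longrightarrow> ns_ideal P R n y \<Longrightarrow> ns_ideal P R n (x + y)"
| "ns_ideal P R n x \<Longrightarrow> ns_ideal P R n (a *\<^sub>Q x)"
| "1 \<le> i \<Longrightarrow> i \<le> m \<Longrightarrow> 1 \<le> n \<Longrightarrow> ns_ideal P R m x \<Longrightarrow> y \<in> Comp P n \<Longrightarrow>
     ns_ideal P R (m + n - 1) (Circ P i x y)"
| "1 \<le> i \<Longrightarrow> i \<le> m \<Longrightarrow> 1 \<le> n \<Longrightarrow> x \<in> Comp P m \<Longrightarrow> ns_ideal P R n y \<Longrightarrow>
     ns_ideal P R (m + n - 1) (Circ P i x y)"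

inductive sym_ideal :: "('a::rat_vector, 'z) sym_op_scheme \<Rightarrow> 'a set \<Rightarrow> nat \<Rightarrow> 'a \<Rightarrow> bool"
  for P R where
  "x \<in> R \<Longrightarrow> x \<in> Comp P n \<Longrightarrow> sym_ideal P R n x"
| "sym_ideal P R n 0"
| "sym_ideal P R n x \<Longrightarrow> sym_ideal P R n y \<Longrightarrow> sym_ideal P R n (x + y)"
| "sym_ideal P R n x \<Longrightarrow> sym_ideal P R n (a *\<^sub>Q x)"
| "1 \<le> i \<Longrightarrow> i \<le> m \<Longrightarrow> 1 \<le> n \<Longrightarrow> sym_ideal P R m x \<Longrightarrow> y \<in> Comp P n \<Longrightarrow>
     sym_ideal P R (m + n - 1) (Circ P i x y)"
| "1 \<le> i \<Longrightarrow> i \<le> m \<Longrightarrow> 1 \<le> n \<Longrightarrow> x \<in> Comp P m \<Longrightarrow> sym_ideal P R n y \<Longrightarrow>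
     sym_ideal P R (m + n - 1) (Circ P i x y)"
| "1 \<le> n \<Longrightarrow> \<sigma> permutes {1..n} \<Longrightarrow> sym_ideal P R n x \<Longrightarrow> sym_ideal P R n (Act P n \<sigma> x)"

definition total_space :: "('a::rat_vector, 'z) ns_op_scheme \<Rightarrow> 'a set" where
  "total_space P = ratv.span (\<Union>n. Comp P n)"

definition ns_ideal_total :: "('a::rat_vector, 'z) ns_op_scheme \<Rightarrow> 'a set \<Rightarrow> 'a set" where
  "ns_ideal_total P R = ratv.span (\<Union>n. {x. ns_ideal P R n x})"

definition sym_ideal_total :: "('a::rat_vector, 'z) sym_op_scheme \<Rightarrow> 'a set \<Rightarrow> 'a set" where
  "sym_ideal_total P R = ratv.span (\<Union>n. {x. sym_ideal P R n x})"

lemma span_stable: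
  fixes h :: "'a::rat_vector \<Rightarrow> 'b::rat_vector"
  assumes "\<And>x y. h (x + y) = h x + h y" "\<And>a x. h (a *\<^sub>Q x) = a *\<^sub>Q h x"
    and "\<And>x. x \<in> S \<Longrightarrow> h x \<in> ratv.span T" and "x \<in> ratv.span S"
  shows "h x \<in> ratv.span T"
  using assms(4)
proof (induction rule: ratv.span_induct_alt)
  case base
  have "h (0 *\<^sub>Q 0) = 0 *\<^sub>Q h 0" by (rule assms(2))
  then show ?case by (simp add: ratv.span_zero)
next
  case (step c x y)
  then show ?case by (simp add: assms ratv.span_add ratv.span_scale)
qed

locale total_circ =
  fixes P :: "('a::rat_vector, 'z) ns_op_scheme"
  assumes circ_add_left: "Circ P i (x + x') y = Circ P i x y + Circ P i x' y"
    and circ_add_right: "Circ P i x (y + y') = Circ P i x y + Circ P i x y'"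
    and circ_scale_left: "Circ P i (a *\<^sub>Q x) y = a *\<^sub>Q Circ P i x y"
    and circ_scale_right: "Circ P i x (a *\<^sub>Q y) = a *\<^sub>Q Circ P i x y"
    and comp_zero: "Comp P 0 = {0}"
    and circ_closed: "1 \<le> i \<Longrightarrow> i \<le> m \<Longrightarrow> 1 \<le> n \<Longrightarrow> x \<in> Comp P m \<Longrightarrow> y \<in> Comp P n \<Longrightarrow>
      Circ P i x y \<in> Comp P (m + n - 1)"
    and circ_out: "x \<in> Comp P m \<Longrightarrow> \<not> (1 \<le> i \<and> i \<le> m) \<Longrightarrow> y \<in> total_space P \<Longrightarrow> Circ P i x y = 0"
begin

lemma circ_zero_right: "Circ P i x 0 = 0"
  using circ_scale_right[of i x 0 0] by simp

lemma circ_zero_left: "Circ P i 0 y = 0"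
  using circ_scale_left[of i 0 0 y] by simp

lemma total_closed:
  assumes "x \<in> total_space P" "y \<in> total_space P"
  shows "Circ P i x y \<in> total_space P"
proof -
  have hom: "Circ P i x y \<in> total_space P" if "x \<in> Comp P m" "y \<in> Comp P n" for x y m n
  proof (cases "1 \<le> i \<and> i \<le> m \<and> 1 \<le> n")
    case True
    then show ?thesis using circ_closed[of i m n x y] that
      by (auto simp: total_space_def intro!: ratv.span_base)
  next
    case False
    have y: "y \<in> total_space P" using that by (auto simp: total_space_def intro!: ratv.span_base)
    have "Circ P i x y = 0"
    proof (cases "1 \<le> i \<and> i \<le> m")
      case True
      with False have "n = 0" by simp
      with that comp_zero have "y = 0" by simp
      then show ?thesis by (simp add: circ_zero_right)
    qed (use circ_out that y in auto)
    then show ?thesis by (simp add: total_space_def ratv.span_zero)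
  qed
  have left: "Circ P i x y \<in> total_space P" if "y \<in> Comp P n" for y n
    unfolding total_space_def
    by (rule span_stable[where h = "\<lambda>x. Circ P i x y", OF circ_add_left circ_scale_left _
          assms(1)[unfolded total_space_def]]) (use hom that in \<open>auto simp: total_space_def\<close>)
  show ?thesis
    unfolding total_space_def
    by (rule span_stable[where h = "Circ P i x", OF circ_add_right circ_scale_right _
          assms(2)[unfolded total_space_def]]) (use left in \<open>auto simp: total_space_def\<close>)
qed

lemma ideal_stable:
  fixes I :: "nat \<Rightarrow> 'a \<Rightarrow> bool"
  assumes sub: "\<And>n x. I n x \<Longrightarrow> x \<in> Comp P n"
    and left: "\<And>i m n x y. 1 \<le> i \<Longrightarrow> i \<le> m \<Longrightarrow> 1 \<le> n \<Longrightarrow> I m x \<Longrightarrow> y \<in> Comp P n \<Longrightarrow>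
      I (m + n - 1) (Circ P i x y)"
    and right: "\<And>i m n x y. 1 \<le> i \<Longrightarrow> i \<le> m \<Longrightarrow> 1 \<le> n \<Longrightarrow> x \<in> Comp P m \<Longrightarrow> I n y \<Longrightarrow>
      I (m + n - 1) (Circ P i x y)"
  defines "J \<equiv> ratv.span (\<Union>n. {x. I n x})"
  shows "x \<in> J \<Longrightarrow> y \<in> total_space P \<Longrightarrow> Circ P i x y \<in> J"
    and "x \<in> total_space P \<Longrightarrow> y \<in> J \<Longrightarrow> Circ P i x y \<in> J"
proof -
  have hom: "Circ P i x y \<in> J"
    if "x \<in> Comp P m" "y \<in> Comp P n" "I m x \<or> I n y" for x y m n
  proof (cases "1 \<le> i \<and> i \<le> m \<and> 1 \<le> n")
    case True
    then have "I (m + n - 1) (Circ P i x y)" using left right that by blast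
    then show ?thesis by (auto simp: J_def intro!: ratv.span_base)
  next
    case False
    have y: "y \<in> total_space P" using that by (auto simp: total_space_def intro!: ratv.span_base)
    have "Circ P i x y = 0"
    proof (cases "1 \<le> i \<and> i \<le> m")
      case True
      with False have "n = 0" by simp
      with that comp_zero have "y = 0" by simp
      then show ?thesis by (simp add: circ_zero_right)
    qed (use circ_out that y in auto)
    then show ?thesis by (simp add: J_def ratv.span_zero)
  qed
  show "Circ P i x y \<in> J" if x: "x \<in> J" and y: "y \<in> total_space P"
  proof -
    have left: "Circ P i x y \<in> J" if "y \<in> Comp P n" for y n
      unfolding J_def
      by (rule span_stable[where h = "\<lambda>x. Circ P i x y", OF circ_add_left circ_scale_left _
            x[unfolded J_def]]) (use hom[OF sub that disjI1] in \<open>auto simp: J_def\<close>)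
    show ?thesis
      unfolding J_def
      by (rule span_stable[where h = "Circ P i x", OF circ_add_right circ_scale_right _
            y[unfolded total_space_def]]) (use left in \<open>auto simp: J_def\<close>)
  qed
  show "Circ P i x y \<in> J" if x: "x \<in> total_space P" and y: "y \<in> J"
  proof -
    have left: "Circ P i x y \<in> J" if "I n y" for y n
      unfolding J_def
      by (rule span_stable[where h = "\<lambda>x. Circ P i x y", OF circ_add_left circ_scale_left _
            x[unfolded total_space_def]]) (use hom[OF _ sub[OF that] disjI2] that in \<open>auto simp: J_def\<close>)
    show ?thesis
      unfolding J_def
      by (rule span_stable[where h = "Circ P i x", OF circ_add_right circ_scale_right _
            y[unfolded J_def]]) (use left in \<open>auto simp: J_def\<close>)
  qed
qed

end

lemma sum_keys_superset:
  assumes "finite A" "keys f \<subseteq> A" "\<And>k. h k 0 = 0"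
  shows "(\<Sum>k\<in>keys f. h k (lookup f k)) = (\<Sum>k\<in>A. h k (lookup f k))"
  by (rule sum.mono_neutral_left) (use assms in \<open>auto simp: in_keys_iff\<close>)

lemma sum_keys_add:
  fixes h :: "'k \<Rightarrow> 'a::rat_vector \<Rightarrow> 'b::rat_vector"
  assumes "\<And>k a b. h k (a + b) = h k a + h k b"
  shows "(\<Sum>k\<in>keys (f + g). h k (lookup (f + g) k)) =
    (\<Sum>k\<in>keys f. h k (lookup f k)) + (\<Sum>k\<in>keys g. h k (lookup g k))"
proof -
  have 0: "h k 0 = 0" for k using assms[of k 0 0] by simp
  let ?A = "keys f \<union> keys g"
  have "(\<Sum>k\<in>keys (f + g). h k (lookup (f + g) k)) = (\<Sum>k\<in>?A. h k (lookup (f + g) k))"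
    by (rule sum_keys_superset) (use Poly_Mapping.keys_add[of f g] 0 in auto)
  also have "\<dots> = (\<Sum>k\<in>?A. h k (lookup f k)) + (\<Sum>k\<in>?A. h k (lookup g k))"
    by (simp add: lookup_add assms sum.distrib)
  also have "\<dots> = (\<Sum>k\<in>keys f. h k (lookup f k)) + (\<Sum>k\<in>keys g. h k (lookup g k))"
    using sum_keys_superset[where f = f and A = ?A and h = h]
      sum_keys_superset[where f = g and A = ?A and h = h] 0 by simp
  finally show ?thesis .
qed

lemma sum_keys_scale:
  fixes h :: "'k \<Rightarrow> 'a::rat_vector \<Rightarrow> 'b::rat_vector"
  assumes "\<And>k a. h k (c *\<^sub>Q a) = c *\<^sub>Q h k a" "\<And>k. h k 0 = 0"
  shows "(\<Sum>k\<in>keys (c *\<^sub>Q f). h k (lookup (c *\<^sub>Q f) k)) = c *\<^sub>Q (\<Sum>k\<in>keys f. h k (lookup f k))"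
proof -
  have "(\<Sum>k\<in>keys (c *\<^sub>Q f). h k (lookup (c *\<^sub>Q f) k)) = (\<Sum>k\<in>keys f. h k (lookup (c *\<^sub>Q f) k))"
    by (rule sum_keys_superset) (auto simp: assms in_keys_iff lookup_scaleQ)
  then show ?thesis
    by (simp add: lookup_scaleQ assms ratv.scale_sum_right)
qed

lemma single_scaleQ: "Poly_Mapping.single k (c *\<^sub>Q a) = c *\<^sub>Q Poly_Mapping.single k a"
  for a :: "'a::rat_vector"
  by (rule poly_mapping_eqI) (auto simp: lookup_scaleQ lookup_single when_def)

lemma sum_singles: "(\<Sum>k\<in>keys f. Poly_Mapping.single k (lookup f k)) = f"
  by (rule poly_mapping_eqI)
    (auto simp: lookup_sum lookup_single when_def sum.delta in_keys_iff)

lemma ns_ideal_sub: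
  assumes "total_circ P" "\<And>n. ratv.subspace (Comp P n)" "ns_ideal P R n x"
  shows "x \<in> Comp P n"
  using assms(3)
  by (induction)
    (auto simp del: One_nat_def intro: ratv.subspace_0 ratv.subspace_add ratv.subspace_scale assms(2)
      total_circ.circ_closed[OF assms(1)])

lemma sym_ideal_sub:
  assumes "total_circ P" "\<And>n. ratv.subspace (Comp P n)" "sym_ideal P R n x"
    and "\<And>n \<sigma> x. \<sigma> permutes {1..n} \<Longrightarrow> x \<in> Comp P n \<Longrightarrow> Act P n \<sigma> x \<in> Comp P n"
  shows "x \<in> Comp P n"
  using assms(3)
  by (induction)
    (auto simp del: One_nat_def intro: ratv.subspace_0 ratv.subspace_add ratv.subspace_scale assms(2,4)
      total_circ.circ_closed[OF assms(1)])


subsection \<open>From non-symmetric to symmetric operads\<close>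

text \<open>An element \<open>E \<otimes> \<sigma>\<close> of \<open>P(n) \<otimes> \<rat>\<SS>\<^sub>n\<close> is written \<open>Poly_Mapping.single w E\<close>, where \<open>w\<close> is the word
  \<open>[\<sigma>(1),\<dots>,\<sigma>(n)]\<close>; it stands for the operation \<open>E(x\<^bsub>w\<^sub>1\<^esub>,\<dots>,x\<^bsub>w\<^sub>n\<^esub>)\<close>. Substituting \<open>F(x\<^bsub>v\<^sub>1\<^esub>,\<dots>,x\<^bsub>v\<^sub>k\<^esub>)\<close> for
  the variable \<open>x\<^sub>i\<close> amounts to composing \<open>E\<close> and \<open>F\<close> at the position of the letter \<open>i\<close> in \<open>w\<close>
  and to replacing this letter by a shifted copy of \<open>v\<close>.\<close>

definition position :: "nat \<Rightarrow> nat list \<Rightarrow> nat" where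
  "position i w = Suc (length (takeWhile (\<lambda>a. a \<noteq> i) w))"

definition subst_word :: "nat \<Rightarrow> nat list \<Rightarrow> nat list \<Rightarrow> nat list" where
  "subst_word i w v =
     concat (map (\<lambda>a. if a < i then [a] else if a = i then map (\<lambda>b. i - 1 + b) v
                      else [a + length v - 1]) w)"

definition symc_circ ::
  "('a::rat_vector, 'z) ns_op_scheme \<Rightarrow> nat \<Rightarrow> (nat list \<Rightarrow>\<^sub>0 'a) \<Rightarrow> (nat list \<Rightarrow>\<^sub>0 'a) \<Rightarrow> (nat list \<Rightarrow>\<^sub>0 'a)" where
  "symc_circ P i f g = (\<Sum>w\<in>keys f. \<Sum>v\<in>keys g.
     if i \<in> set w
     then Poly_Mapping.single (subst_word i w v) (Circ P (position i w) (lookup f w) (lookup g v))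
     else 0)"

definition symc_act :: "(nat \<Rightarrow> nat) \<Rightarrow> (nat list \<Rightarrow>\<^sub>0 'a::rat_vector) \<Rightarrow> (nat list \<Rightarrow>\<^sub>0 'a)" where
  "symc_act \<sigma> f = (\<Sum>w\<in>keys f. Poly_Mapping.single (map \<sigma> w) (lookup f w))"

definition symmetrization :: "('a::rat_vector, 'z) ns_op_scheme \<Rightarrow> (nat list \<Rightarrow>\<^sub>0 'a) sym_op" where
  "symmetrization P =
     \<lparr>Comp = (\<lambda>n. {f. keys f \<subseteq> permutations_of_set {1..n} \<and> (\<forall>w. lookup f w \<in> Comp P n)}),
      Unit = Poly_Mapping.single [1] (Unit P),
      Circ = symc_circ P,
      Act = (\<lambda>n. symc_act)\<rparr>"

text \<open>The action of \<open>\<pi> \<in> \<SS>\<^bsub>n+1\<^esub>\<close> on \<open>E \<otimes> \<sigma>\<close>: writing \<open>\<pi>\<sigma> = \<rho>\<tau>\<^sup>k\<close> with \<open>\<rho> \<in> \<SS>\<^sub>n\<close>, \<open>\<tau>\<close> the long cycle and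
  \<open>0 \<le> k \<le> n\<close>, it is \<open>\<tau>\<^sub>n\<^sup>k(E) \<otimes> \<rho>\<close>. Here \<open>u\<close> is the word of \<open>\<pi>\<sigma>\<close>, and the word of \<open>\<rho> = \<pi>\<sigma>\<tau>\<^bsup>-k\<^esup>\<close> is
  \<open>u\<close> rotated so that the letter \<open>n+1\<close> comes last. In particular the permutations of
  \<open>{1..n}\<close> act as in \<open>symmetrization P\<close>.\<close>

definition symc_act_ext ::
  "(nat \<Rightarrow> 'a \<Rightarrow> 'a) \<Rightarrow> nat \<Rightarrow> (nat \<Rightarrow> nat) \<Rightarrow> (nat list \<Rightarrow>\<^sub>0 'a::rat_vector) \<Rightarrow> (nat list \<Rightarrow>\<^sub>0 'a)" where
  "symc_act_ext \<tau> n \<pi> f = (\<Sum>w\<in>keys f.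
     let u = map \<pi> (w @ [n + 1]);
         k = position (n + 1) u mod (n + 1)
     in Poly_Mapping.single (butlast (rotate k u)) ((\<tau> n ^^ k) (lookup f w)))"

definition anticyclic_symmetrization ::
  "('a::rat_vector, 'z) ns_op_scheme \<Rightarrow> (nat \<Rightarrow> 'a \<Rightarrow> 'a) \<Rightarrow> (nat list \<Rightarrow>\<^sub>0 'a) sym_op" where
  "anticyclic_symmetrization P \<tau> = (symmetrization P)\<lparr>Act := symc_act_ext \<tau>\<rparr>"


section \<open>The operad Dias\<close>

text \<open>The free non-symmetric operad on two binary generators: its component of arity \<open>n\<close> is spanned by the planar
  binary trees with \<open>n\<close> leaves and inner vertices labelled by the generators \<open>\<stileturn>\<close> (\<open>LeftOp\<close>) and
  \<open>\<turnstile>\<close> (\<open>RightOp\<close>). Leaves are numbered \<open>1,\<dots>,n\<close> from left to right.\<close>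

datatype tree = Leaf | LeftOp tree tree | RightOp tree tree

fun leaves :: "tree \<Rightarrow> nat" where
  "leaves Leaf = 1"
| "leaves (LeftOp l r) = leaves l + leaves r"
| "leaves (RightOp l r) = leaves l + leaves r"

fun graft :: "nat \<Rightarrow> tree \<Rightarrow> tree \<Rightarrow> tree" where
  "graft i Leaf s = s"
| "graft i (LeftOp l r) s =
     (if i \<le> leaves l then LeftOp (graft i l s) r else LeftOp l (graft (i - leaves l) r s))"
| "graft i (RightOp l r) s =
     (if i \<le> leaves l then RightOp (graft i l s) r else RightOp l (graft (i - leaves l) r s))"

definition tree_circ :: "nat \<Rightarrow> (tree \<Rightarrow>\<^sub>0 rat) \<Rightarrow> (tree \<Rightarrow>\<^sub>0 rat) \<Rightarrow> (tree \<Rightarrow>\<^sub>0 rat)" where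
  "tree_circ i f g = (\<Sum>t\<in>keys f. \<Sum>s\<in>keys g.
     if 1 \<le> i \<and> i \<le> leaves t
     then Poly_Mapping.single (graft i t s) (lookup f t * lookup g s)
     else 0)"

definition Free :: "(tree \<Rightarrow>\<^sub>0 rat) ns_op" where
  "Free =
     \<lparr>Comp = (\<lambda>n. {f. keys f \<subseteq> {t. leaves t = n}}),
      Unit = Poly_Mapping.single Leaf 1,
      Circ = tree_circ\<rparr>"

abbreviation tr :: "tree \<Rightarrow> (tree \<Rightarrow>\<^sub>0 rat)" where "tr t \<equiv> Poly_Mapping.single t 1"

definition dias_relations :: "(tree \<Rightarrow>\<^sub>0 rat) set" where
  "dias_relations =
     {tr (LeftOp Leaf (RightOp Leaf Leaf)) - tr (LeftOp Leaf (LeftOp Leaf Leaf)),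
      tr (LeftOp Leaf (LeftOp Leaf Leaf)) - tr (LeftOp (LeftOp Leaf Leaf) Leaf),
      tr (RightOp Leaf (LeftOp Leaf Leaf)) - tr (LeftOp (RightOp Leaf Leaf) Leaf),
      tr (RightOp Leaf (RightOp Leaf Leaf)) - tr (RightOp (RightOp Leaf Leaf) Leaf),
      tr (RightOp (RightOp Leaf Leaf) Leaf) - tr (RightOp (LeftOp Leaf Leaf) Leaf)}"

lemma leaves_pos: "leaves t \<ge> 1"
  by (induction t) auto

lemma leaves_graft: "1 \<le> i \<Longrightarrow> i \<le> leaves t \<Longrightarrow> leaves (graft i t s) = leaves t + leaves s - 1"
proof (induction t arbitrary: i)
  case (LeftOp l r)
  then show ?case using leaves_pos[of l] leaves_pos[of r] leaves_pos[of s] by auto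
next
  case (RightOp l r)
  then show ?case using leaves_pos[of l] leaves_pos[of r] leaves_pos[of s] by auto
qed auto

lemma subspace_Free: "ratv.subspace (Comp Free n)"
proof -
  have *: "f \<in> Comp Free n \<longleftrightarrow> (\<forall>t. leaves t \<noteq> n \<longrightarrow> lookup f t = 0)" for f
    by (auto simp: Free_def in_keys_iff)
  show ?thesis
    by (rule ratv.subspaceI) (simp_all add: * lookup_add lookup_scaleQ)
qed

lemma keys_sum_subset:
  assumes "\<And>a. a \<in> A \<Longrightarrow> keys (F a) \<subseteq> S"
  shows "keys (\<Sum>a\<in>A. F a) \<subseteq> S"
  using keys_sum[of F A] assms by blast

lemma total_Free: "total_space Free = UNIV"
proof -
  have "f \<in> total_space Free" for f :: "tree \<Rightarrow>\<^sub>0 rat"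
  proof -
    have "Poly_Mapping.single t c \<in> total_space Free" for t c
      unfolding total_space_def by (rule ratv.span_base) (auto simp: Free_def)
    then have "(\<Sum>t\<in>keys f. Poly_Mapping.single t (lookup f t)) \<in> total_space Free"
      unfolding total_space_def by (intro ratv.span_sum)
    then show ?thesis by (simp add: sum_singles)
  qed
  then show ?thesis by auto
qed

interpretation Free: total_circ Free
proof
  fix i :: nat and x x' y y' :: "tree \<Rightarrow>\<^sub>0 rat" and a :: rat
  let ?h = "\<lambda>y t c. \<Sum>s\<in>keys y. if 1 \<le> i \<and> i \<le> leaves t
     then Poly_Mapping.single (graft i t s) (c * lookup y s) else 0"
  let ?k = "\<lambda>t c s d. if 1 \<le> i \<and> i \<le> leaves t
     then Poly_Mapping.single (graft i t s) (c * d :: rat) else 0"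
  have C: "Circ Free = tree_circ" by (simp add: Free_def)
  show "Circ Free i (x + x') y = Circ Free i x y + Circ Free i x' y"
    unfolding C tree_circ_def
    by (rule sum_keys_add[where h = "?h y"], unfold sum.distrib[symmetric])
      (rule sum.cong, simp_all add: single_add distrib_right)
  show "Circ Free i (a *\<^sub>Q x) y = a *\<^sub>Q Circ Free i x y"
    unfolding C tree_circ_def
  proof (rule sum_keys_scale[where h = "?h y"])
    show "?h y t (a *\<^sub>Q c) = a *\<^sub>Q ?h y t c" for t c
      unfolding ratv.scale_sum_right
      by (rule sum.cong) (simp_all add: single_scaleQ[symmetric] scaleQ_rat_def mult.assoc)
    show "?h y t 0 = 0" for t
      by (rule sum.neutral) simp
  qed
  show "Circ Free i x (y + y') = Circ Free i x y + Circ Free i x y'"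
    unfolding C tree_circ_def sum.distrib[symmetric]
    by (rule sum.cong[OF refl], rule sum_keys_add[where h = "?k t c" for t c])
      (simp add: single_add distrib_left)
  show "Circ Free i x (a *\<^sub>Q y) = a *\<^sub>Q Circ Free i x y"
    unfolding C tree_circ_def ratv.scale_sum_right[of a _ "keys x"]
    by (rule sum.cong[OF refl], rule sum_keys_scale[where h = "?k t c" for t c])
      (simp_all add: single_scaleQ[symmetric] scaleQ_rat_def mult.left_commute)
  have neq: "leaves t \<noteq> 0" for t
    using leaves_pos[of t] by linarith
  show "Comp Free 0 = {0}"
    by (simp add: Free_def neq)
next
  fix i m n :: nat and x y :: "tree \<Rightarrow>\<^sub>0 rat"
  assume *: "1 \<le> i" "i \<le> m" "1 \<le> n" "x \<in> Comp Free m" "y \<in> Comp Free n"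
  show "Circ Free i x y \<in> Comp Free (m + n - 1)"
    unfolding Free_def tree_circ_def ns_op.select_convs mem_Collect_eq
    by (intro keys_sum_subset) (use * in \<open>auto simp: Free_def leaves_graft\<close>)
next
  fix i m :: nat and x y :: "tree \<Rightarrow>\<^sub>0 rat"
  assume "x \<in> Comp Free m" "\<not> (1 \<le> i \<and> i \<le> m)"
  then show "Circ Free i x y = 0"
    unfolding Free_def tree_circ_def ns_op.select_convs mem_Collect_eq
    by (intro sum.neutral ballI) auto
qed

definition dias_ideal :: "(tree \<Rightarrow>\<^sub>0 rat) set" where
  "dias_ideal = ns_ideal_total Free dias_relations"

lemma dias_ideal_subspace: "ratv.subspace dias_ideal"
  by (simp add: dias_ideal_def ns_ideal_total_def ratv.subspace_span)

lemma dias_ideal_circ: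
  "x \<in> dias_ideal \<Longrightarrow> tree_circ i x y \<in> dias_ideal"
  "y \<in> dias_ideal \<Longrightarrow> tree_circ i x y \<in> dias_ideal"
proof -
  have C: "Circ Free = tree_circ" by (simp add: Free_def)
  note st = Free.ideal_stable[where I = "ns_ideal Free dias_relations",
      OF ns_ideal_sub[OF Free.total_circ_axioms subspace_Free] ns_ideal.intros(5,6),
      folded ns_ideal_total_def dias_ideal_def, unfolded total_Free C, simplified]
  show "x \<in> dias_ideal \<Longrightarrow> tree_circ i x y \<in> dias_ideal"
    "y \<in> dias_ideal \<Longrightarrow> tree_circ i x y \<in> dias_ideal"
    by (rule st; assumption)+
qed

definition dias_eq :: "(tree \<Rightarrow>\<^sub>0 rat) \<Rightarrow> (tree \<Rightarrow>\<^sub>0 rat) \<Rightarrow> bool" where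
  "dias_eq x y \<longleftrightarrow> x - y \<in> dias_ideal"

lemma dias_eq_equivp: "equivp dias_eq"
proof (rule equivpI)
  show "reflp dias_eq"
    by (auto simp: reflp_def dias_eq_def ratv.subspace_0[OF dias_ideal_subspace])
  show "symp dias_eq"
  proof (rule sympI)
    fix x y assume "dias_eq x y"
    then show "dias_eq y x"
      using ratv.subspace_neg[OF dias_ideal_subspace, of "x - y"] by (simp add: dias_eq_def)
  qed
  show "transp dias_eq"
  proof (rule transpI)
    fix x y z assume "dias_eq x y" "dias_eq y z"
    then show "dias_eq x z"
      using ratv.subspace_add[OF dias_ideal_subspace, of "x - y" "y - z"] by (simp add: dias_eq_def)
  qed
qed

quotient_type dias = "tree \<Rightarrow>\<^sub>0 rat" / dias_eq
  morphisms rep_dias to_dias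
  by (rule dias_eq_equivp)

instantiation dias :: rat_vector
begin

lift_definition zero_dias :: dias is 0 .

lift_definition plus_dias :: "dias \<Rightarrow> dias \<Rightarrow> dias" is "(+)"
  unfolding dias_eq_def add_diff_add by (rule ratv.subspace_add[OF dias_ideal_subspace])

lift_definition uminus_dias :: "dias \<Rightarrow> dias" is uminus
  unfolding dias_eq_def minus_diff_minus by (rule ratv.subspace_neg[OF dias_ideal_subspace])

lift_definition minus_dias :: "dias \<Rightarrow> dias \<Rightarrow> dias" is "(-)"
proof -
  fix x x' y y' :: "tree \<Rightarrow>\<^sub>0 rat"
  assume "dias_eq x x'" "dias_eq y y'"
  then have "(x - x') - (y - y') \<in> dias_ideal"
    unfolding dias_eq_def by (rule ratv.subspace_diff[OF dias_ideal_subspace])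
  then show "dias_eq (x - y) (x' - y')" by (simp add: dias_eq_def algebra_simps)
qed

lift_definition scaleQ_dias :: "rat \<Rightarrow> dias \<Rightarrow> dias" is scaleQ
proof -
  fix a and x y :: "tree \<Rightarrow>\<^sub>0 rat"
  assume "dias_eq x y"
  then have "a *\<^sub>Q (x - y) \<in> dias_ideal"
    unfolding dias_eq_def by (rule ratv.subspace_scale[OF dias_ideal_subspace])
  then show "dias_eq (a *\<^sub>Q x) (a *\<^sub>Q y)"
    by (simp only: dias_eq_def ratv.scale_right_diff_distrib)
qed

instance
proof
  note refl = ratv.subspace_0[OF dias_ideal_subspace]
  fix x y z :: dias and a b :: rat
  show "x + y + z = x + (y + z)" by transfer (simp add: dias_eq_def refl add.assoc)
  show "x + y = y + x" by transfer (simp add: dias_eq_def refl add.commute)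
  show "0 + x = x" by transfer (simp add: dias_eq_def refl)
  show "- x + x = 0" by transfer (simp add: dias_eq_def refl)
  show "x - y = x + - y" by transfer (simp add: dias_eq_def refl)
  show "a *\<^sub>Q (x + y) = a *\<^sub>Q x + a *\<^sub>Q y"
    by transfer (simp add: dias_eq_def refl scaleQ_add_right)
  show "(a + b) *\<^sub>Q x = a *\<^sub>Q x + b *\<^sub>Q x"
    by transfer (simp add: dias_eq_def refl scaleQ_add_left)
  show "a *\<^sub>Q b *\<^sub>Q x = (a * b) *\<^sub>Q x"
    by transfer (simp add: dias_eq_def refl scaleQ_scaleQ)
  show "1 *\<^sub>Q x = x" by transfer (simp add: dias_eq_def refl scaleQ_one)
qed

end

lift_definition dias_circ :: "nat \<Rightarrow> dias \<Rightarrow> dias \<Rightarrow> dias" is tree_circ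
proof -
  fix i and x x' y y' :: "tree \<Rightarrow>\<^sub>0 rat"
  assume "dias_eq x x'" "dias_eq y y'"
  then have *: "tree_circ i (x - x') y \<in> dias_ideal" "tree_circ i x' (y - y') \<in> dias_ideal"
    unfolding dias_eq_def by (simp_all only: dias_ideal_circ)
  have C: "Circ Free = tree_circ" by (simp add: Free_def)
  have 1: "tree_circ i x y = tree_circ i (x - x') y + tree_circ i x' y"
    using Free.circ_add_left[of i "x - x'" x' y] by (simp only: C diff_add_cancel)
  have 2: "tree_circ i x' y = tree_circ i x' (y - y') + tree_circ i x' y'"
    using Free.circ_add_right[of i x' "y - y'" y'] by (simp only: C diff_add_cancel)
  have "tree_circ i x y - tree_circ i x' y' = tree_circ i (x - x') y + tree_circ i x' (y - y')"
    unfolding 1 2 by simp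
  then show "dias_eq (tree_circ i x y) (tree_circ i x' y')"
    unfolding dias_eq_def using ratv.subspace_add[OF dias_ideal_subspace *] by simp
qed

definition Dias :: "dias ns_op" where
  "Dias =
     \<lparr>Comp = (\<lambda>n. to_dias ` Comp Free n),
      Unit = to_dias (Unit Free),
      Circ = dias_circ\<rparr>"

definition left_product :: dias where "left_product = to_dias (tr (LeftOp Leaf Leaf))"

definition right_product :: dias where "right_product = to_dias (tr (RightOp Leaf Leaf))"

text \<open>The anticyclic structure is unique on the components of \<open>Dias\<close>; the choice only concerns
  irrelevant values elsewhere.\<close>

definition dias_tau :: "nat \<Rightarrow> dias \<Rightarrow> dias" where
  "dias_tau = (SOME \<tau>.
     ns_anticyclic Dias \<tau> \<and>
     (\<forall>x\<in>Comp Dias 1. \<tau> 1 x = - x) \<and>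
     \<tau> 2 left_product = - right_product \<and>
     \<tau> 2 right_product = left_product - right_product)"

definition SymDias :: "(nat list \<Rightarrow>\<^sub>0 dias) sym_op" where
  "SymDias = symmetrization Dias"

definition AnticyclicDias :: "(nat list \<Rightarrow>\<^sub>0 dias) sym_op" where
  "AnticyclicDias = anticyclic_symmetrization Dias dias_tau"


section \<open>The operad Perm\<close>

text \<open>The element \<open>x\<^sub>1 \<stileturn> x\<^sub>2 - x\<^sub>2 \<turnstile> x\<^sub>1\<close>.\<close>

definition perm_relation :: "nat list \<Rightarrow>\<^sub>0 dias" where
  "perm_relation = Poly_Mapping.single [1, 2] left_product - Poly_Mapping.single [2, 1] right_product"

definition perm_ideal :: "(nat list \<Rightarrow>\<^sub>0 dias) set" where
  "perm_ideal = sym_ideal_total SymDias {perm_relation}"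

definition perm_eq :: "(nat list \<Rightarrow>\<^sub>0 dias) \<Rightarrow> (nat list \<Rightarrow>\<^sub>0 dias) \<Rightarrow> bool" where
  "perm_eq x y \<longleftrightarrow> x \<in> total_space SymDias \<and> y \<in> total_space SymDias \<and> x - y \<in> perm_ideal"

lemma dias_circ_bilinear:
  "dias_circ i (x + x') y = dias_circ i x y + dias_circ i x' y"
  "dias_circ i x (y + y') = dias_circ i x y + dias_circ i x y'"
  "dias_circ i (a *\<^sub>Q x) y = a *\<^sub>Q dias_circ i x y"
  "dias_circ i x (a *\<^sub>Q y) = a *\<^sub>Q dias_circ i x y"
proof -
  have C: "Circ Free = tree_circ" by (simp add: Free_def)
  note refl = ratv.subspace_0[OF dias_ideal_subspace]
  show "dias_circ i (x + x') y = dias_circ i x y + dias_circ i x' y"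
    by transfer (use Free.circ_add_left in \<open>simp add: C dias_eq_def refl\<close>)
  show "dias_circ i x (y + y') = dias_circ i x y + dias_circ i x y'"
    by transfer (use Free.circ_add_right in \<open>simp add: C dias_eq_def refl\<close>)
  show "dias_circ i (a *\<^sub>Q x) y = a *\<^sub>Q dias_circ i x y"
    by transfer (use Free.circ_scale_left in \<open>simp add: C dias_eq_def refl\<close>)
  show "dias_circ i x (a *\<^sub>Q y) = a *\<^sub>Q dias_circ i x y"
    by transfer (use Free.circ_scale_right in \<open>simp add: C dias_eq_def refl\<close>)
qed

lemma dias_circ_closed:
  assumes "1 \<le> i" "i \<le> m" "1 \<le> n" "x \<in> Comp Dias m" "y \<in> Comp Dias n"
  shows "dias_circ i x y \<in> Comp Dias (m + n - 1)"
proof -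
  have C: "Circ Free = tree_circ" by (simp add: Free_def)
  from assms obtain f g where "f \<in> Comp Free m" "g \<in> Comp Free n" "x = to_dias f" "y = to_dias g"
    by (auto simp: Dias_def)
  moreover have "dias_circ i (to_dias f) (to_dias g) = to_dias (tree_circ i f g)"
    by (rule dias_circ.abs_eq)
  ultimately show ?thesis
    using Free.circ_closed[OF assms(1-3), of f g] by (auto simp: Dias_def C)
qed

lemma subspace_Dias: "ratv.subspace (Comp Dias n)"
proof (rule ratv.subspaceI)
  show "0 \<in> Comp Dias n"
    using ratv.subspace_0[OF subspace_Free[of n]]
    by (auto simp: Dias_def zero_dias.abs_eq image_iff)
next
  fix x y assume "x \<in> Comp Dias n" "y \<in> Comp Dias n"
  then show "x + y \<in> Comp Dias n"
    using ratv.subspace_add[OF subspace_Free[of n]] by (auto simp: Dias_def plus_dias.abs_eq)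
next
  fix a x assume "x \<in> Comp Dias n"
  then show "a *\<^sub>Q x \<in> Comp Dias n"
    using ratv.subspace_scale[OF subspace_Free[of n]] by (auto simp: Dias_def scaleQ_dias.abs_eq)
qed

lemma Comp_Dias_0: "Comp Dias 0 = {0}"
  using Free.comp_zero by (simp add: Dias_def zero_dias.abs_eq)

lemma subst_word_permutation:
  assumes w: "w \<in> permutations_of_set {1..m}" and v: "v \<in> permutations_of_set {1..n}"
    and i: "1 \<le> i" "i \<le> m" and n: "1 \<le> n"
  shows "subst_word i w v \<in> permutations_of_set {1..m + n - 1}"
proof -
  have sw: "set w = {1..m}" "distinct w" and sv: "set v = {1..n}" "distinct v"
    using w v by (auto dest: permutations_of_setD)
  have lv: "length v = n" using distinct_card[OF sv(2)] sv(1) by simp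
  let ?b = "\<lambda>a. if a < i then [a] else if a = i then map (\<lambda>b. i - 1 + b) v else [a + n - 1]"
  have subst: "subst_word i w v = concat (map ?b w)"
    unfolding subst_word_def lv ..
  have set: "set (subst_word i w v) = {1..m + n - 1}"
  proof (rule set_eqI)
    fix k
    have "k \<in> set (subst_word i w v) \<longleftrightarrow> (\<exists>a\<in>{1..m}. k \<in> set (?b a))"
      by (simp only: subst set_concat set_map sw) blast
    also have "\<dots> \<longleftrightarrow> k \<in> {1..m + n - 1}"
    proof
      assume "\<exists>a\<in>{1..m}. k \<in> set (?b a)"
      then show "k \<in> {1..m + n - 1}" using i n sv by (auto split: if_splits)
    next
      assume k: "k \<in> {1..m + n - 1}"
      consider "k < i" | "i \<le> k" "k \<le> i + n - 1" | "i + n - 1 < k" by linarith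
      then show "\<exists>a\<in>{1..m}. k \<in> set (?b a)"
      proof cases
        case 1
        then show ?thesis using i k by (intro bexI[of _ k]) auto
      next
        case 2
        then have "k = i - 1 + (k + 1 - i)" "k + 1 - i \<in> set v" using sv i by auto
        then have "k \<in> (\<lambda>b. i - 1 + b) ` set v" by (rule image_eqI)
        then have "k \<in> set (?b i)" by simp
        then show ?thesis using i by (intro bexI[of _ i]) auto
      next
        case 3
        then show ?thesis using i k n by (intro bexI[of _ "k + 1 - n"]) auto
      qed
    qed
    finally show "k \<in> set (subst_word i w v) \<longleftrightarrow> k \<in> {1..m + n - 1}" .
  qed
  have "length (subst_word i w v) = (\<Sum>a\<leftarrow>w. length (?b a))"
    by (simp add: subst length_concat comp_def)
  also have "\<dots> = (\<Sum>a\<in>{1..m}. length (?b a))"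
    using sum_list_distinct_conv_sum_set[OF sw(2)] sw(1) by simp
  also have "\<dots> = (\<Sum>a\<in>{1..m} - {i}. length (?b a)) + n"
    using i lv by (subst sum.remove[of _ i]) auto
  also have "(\<Sum>a\<in>{1..m} - {i}. length (?b a)) = (\<Sum>a\<in>{1..m} - {i}. 1)"
    by (rule sum.cong) auto
  also have "\<dots> + n = m + n - 1" using i by simp
  finally have "distinct (subst_word i w v)"
    by (intro card_distinct) (simp add: set)
  with set show ?thesis by (rule permutations_of_setI)
qed

lemma position_le: "i \<in> set w \<Longrightarrow> position i w \<le> length w"
  unfolding position_def by (induction w) auto

lemma SymDias_simps:
  "Comp SymDias n = {f. keys f \<subseteq> permutations_of_set {1..n} \<and> (\<forall>w. lookup f w \<in> Comp Dias n)}"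
  "Circ SymDias = symc_circ Dias"
  by (simp_all add: SymDias_def symmetrization_def)

lemma subspace_SymDias: "ratv.subspace (Comp SymDias n)"
proof -
  have *: "f \<in> Comp SymDias n \<longleftrightarrow>
      (\<forall>w. lookup f w \<in> Comp Dias n \<and> (w \<notin> permutations_of_set {1..n} \<longrightarrow> lookup f w = 0))" for f
    by (auto simp: SymDias_simps in_keys_iff)
  show ?thesis
    by (rule ratv.subspaceI)
      (simp_all add: * lookup_add lookup_scaleQ ratv.subspace_0[OF subspace_Dias]
        ratv.subspace_add[OF subspace_Dias] ratv.subspace_scale[OF subspace_Dias])
qed

lemma single_in_SymDias:
  assumes "w \<in> permutations_of_set {1..n}" "x \<in> Comp Dias n"
  shows "Poly_Mapping.single w x \<in> Comp SymDias n"
  using assms ratv.subspace_0[OF subspace_Dias]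
  by (auto simp: SymDias_simps lookup_single when_def)

interpretation SymDias: total_circ SymDias
proof
  fix i :: nat and x x' y y' :: "nat list \<Rightarrow>\<^sub>0 dias" and a :: rat
  let ?h = "\<lambda>y w c. \<Sum>v\<in>keys y. if i \<in> set w
     then Poly_Mapping.single (subst_word i w v) (dias_circ (position i w) c (lookup y v)) else 0"
  let ?k = "\<lambda>w c v d. if i \<in> set w
     then Poly_Mapping.single (subst_word i w v) (dias_circ (position i w) c d) else 0"
  have C: "Circ Dias = dias_circ" by (simp add: Dias_def)
  have zero: "dias_circ j c 0 = 0" "dias_circ j 0 c = 0" for j c
    using dias_circ_bilinear(4)[of j c 0 0] dias_circ_bilinear(3)[of j 0 0 c] by simp_all
  show "Circ SymDias i (x + x') y = Circ SymDias i x y + Circ SymDias i x' y"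
    unfolding SymDias_simps symc_circ_def C
    by (rule sum_keys_add[where h = "?h y"], unfold sum.distrib[symmetric])
      (rule sum.cong, simp_all add: single_add dias_circ_bilinear)
  show "Circ SymDias i (a *\<^sub>Q x) y = a *\<^sub>Q Circ SymDias i x y"
    unfolding SymDias_simps symc_circ_def C
  proof (rule sum_keys_scale[where h = "?h y"])
    show "?h y w (a *\<^sub>Q c) = a *\<^sub>Q ?h y w c" for w c
      unfolding ratv.scale_sum_right
      by (rule sum.cong) (simp_all add: single_scaleQ dias_circ_bilinear)
    show "?h y w 0 = 0" for w
      by (rule sum.neutral) (simp add: zero)
  qed
  show "Circ SymDias i x (y + y') = Circ SymDias i x y + Circ SymDias i x y'"
    unfolding SymDias_simps symc_circ_def C sum.distrib[symmetric]
    by (rule sum.cong[OF refl], rule sum_keys_add[where h = "?k w c" for w c])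
      (simp add: single_add dias_circ_bilinear)
  show "Circ SymDias i x (a *\<^sub>Q y) = a *\<^sub>Q Circ SymDias i x y"
    unfolding SymDias_simps symc_circ_def C ratv.scale_sum_right[of a _ "keys x"]
    by (rule sum.cong[OF refl], rule sum_keys_scale[where h = "?k w c" for w c])
      (simp_all add: single_scaleQ dias_circ_bilinear zero)
  have "f = 0" if "\<forall>w. lookup f w = 0" for f :: "nat list \<Rightarrow>\<^sub>0 dias"
    by (rule poly_mapping_eqI) (simp add: that)
  then show "Comp SymDias 0 = {0}"
    by (auto simp: SymDias_simps Comp_Dias_0)
next
  fix i m n :: nat and x y :: "nat list \<Rightarrow>\<^sub>0 dias"
  assume i: "1 \<le> i" "i \<le> m" "1 \<le> n" and xy: "x \<in> Comp SymDias m" "y \<in> Comp SymDias n"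
  have C: "Circ Dias = dias_circ" by (simp add: Dias_def)
  show "Circ SymDias i x y \<in> Comp SymDias (m + n - 1)"
    unfolding SymDias_simps(2) symc_circ_def
  proof (intro ratv.subspace_sum[OF subspace_SymDias])
    fix w v assume wv: "w \<in> keys x" "v \<in> keys y"
    then have w: "w \<in> permutations_of_set {1..m}" and v: "v \<in> permutations_of_set {1..n}"
      using xy by (auto simp: SymDias_simps)
    have iw: "i \<in> set w" using permutations_of_setD(1)[OF w] i by simp
    have "length w = m" using length_finite_permutations_of_set[OF w] by simp
    then have pos: "1 \<le> position i w" "position i w \<le> m"
      using position_le[OF iw] by (simp_all add: position_def)
    have "Poly_Mapping.single (subst_word i w v) (dias_circ (position i w) (lookup x w) (lookup y v))
        \<in> Comp SymDias (m + n - 1)"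
      by (rule single_in_SymDias[OF subst_word_permutation[OF w v i] dias_circ_closed[OF pos i(3)]])
        (use xy in \<open>auto simp: SymDias_simps\<close>)
    then show "(if i \<in> set w then Poly_Mapping.single (subst_word i w v)
        (Circ Dias (position i w) (lookup x w) (lookup y v)) else 0) \<in> Comp SymDias (m + n - 1)"
      using iw by (simp add: C)
  qed
next
  fix i m :: nat and x y :: "nat list \<Rightarrow>\<^sub>0 dias"
  assume x: "x \<in> Comp SymDias m" and i: "\<not> (1 \<le> i \<and> i \<le> m)"
  have "i \<notin> set w" if "w \<in> keys x" for w
  proof -
    have "w \<in> permutations_of_set {1..m}" using x that by (auto simp: SymDias_simps)
    then show ?thesis using permutations_of_setD(1) i by fastforce
  qed
  then show "Circ SymDias i x y = 0"
    unfolding SymDias_simps(2) symc_circ_def by (intro sum.neutral ballI) auto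
qed

lemma symc_act_closed:
  assumes \<sigma>: "\<sigma> permutes {1..n}" and f: "f \<in> Comp SymDias n"
  shows "symc_act \<sigma> f \<in> Comp SymDias n"
  unfolding symc_act_def
proof (intro ratv.subspace_sum[OF subspace_SymDias] single_in_SymDias)
  fix w assume "w \<in> keys f"
  then have w: "w \<in> permutations_of_set {1..n}" using f by (auto simp: SymDias_simps)
  show "map \<sigma> w \<in> permutations_of_set {1..n}"
    using permutations_of_setD[OF w] permutes_image[OF \<sigma>] permutes_inj_on[OF \<sigma>]
    by (intro permutations_of_setI) (auto simp: distinct_map)
  show "lookup f w \<in> Comp Dias n" using f by (auto simp: SymDias_simps)
qed

lemma perm_ideal_subspace: "ratv.subspace perm_ideal"
  by (simp add: perm_ideal_def sym_ideal_total_def ratv.subspace_span)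

lemma total_SymDias_subspace: "ratv.subspace (total_space SymDias)"
  by (simp add: total_space_def ratv.subspace_span)

lemma perm_ideal_circ:
  "x \<in> perm_ideal \<Longrightarrow> y \<in> total_space SymDias \<Longrightarrow> symc_circ Dias i x y \<in> perm_ideal"
  "x \<in> total_space SymDias \<Longrightarrow> y \<in> perm_ideal \<Longrightarrow> symc_circ Dias i x y \<in> perm_ideal"
proof -
  have A: "Act SymDias n \<sigma> x \<in> Comp SymDias n" if "\<sigma> permutes {1..n}" "x \<in> Comp SymDias n" for n \<sigma> x
    using symc_act_closed[OF that] by (simp add: SymDias_def symmetrization_def)
  note st = SymDias.ideal_stable[where I = "sym_ideal SymDias {perm_relation}",
      OF sym_ideal_sub[OF SymDias.total_circ_axioms subspace_SymDias _ A] sym_ideal.intros(5,6),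
      folded sym_ideal_total_def perm_ideal_def, unfolded SymDias_simps(2), simplified]
  show "x \<in> perm_ideal \<Longrightarrow> y \<in> total_space SymDias \<Longrightarrow> symc_circ Dias i x y \<in> perm_ideal"
    "x \<in> total_space SymDias \<Longrightarrow> y \<in> perm_ideal \<Longrightarrow> symc_circ Dias i x y \<in> perm_ideal"
    by (rule st; assumption)+
qed

lemma perm_eq_part_equivp: "part_equivp perm_eq"
proof (rule part_equivpI)
  show "\<exists>x. perm_eq x x"
    by (rule exI[of _ 0])
      (simp add: perm_eq_def ratv.subspace_0[OF perm_ideal_subspace]
        ratv.subspace_0[OF total_SymDias_subspace])
  show "symp perm_eq"
  proof (rule sympI)
    fix x y assume "perm_eq x y"
    then show "perm_eq y x"
      using ratv.subspace_neg[OF perm_ideal_subspace, of "x - y"] by (simp add: perm_eq_def)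
  qed
  show "transp perm_eq"
  proof (rule transpI)
    fix x y z assume "perm_eq x y" "perm_eq y z"
    then show "perm_eq x z"
      using ratv.subspace_add[OF perm_ideal_subspace, of "x - y" "y - z"] by (simp add: perm_eq_def)
  qed
qed

quotient_type perm_space = "nat list \<Rightarrow>\<^sub>0 dias" / partial: perm_eq
  morphisms rep_perm to_perm
  by (rule perm_eq_part_equivp)

instantiation perm_space :: rat_vector
begin

lift_definition zero_perm_space :: perm_space is 0
  by (simp add: perm_eq_def ratv.subspace_0[OF perm_ideal_subspace]
        ratv.subspace_0[OF total_SymDias_subspace])

lift_definition plus_perm_space :: "perm_space \<Rightarrow> perm_space \<Rightarrow> perm_space" is "(+)"
  unfolding perm_eq_def add_diff_add
  by (intro conjI ratv.subspace_add[OF perm_ideal_subspace]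
      ratv.subspace_add[OF total_SymDias_subspace]) simp_all

lift_definition uminus_perm_space :: "perm_space \<Rightarrow> perm_space" is uminus
  unfolding perm_eq_def minus_diff_minus
  by (simp add: ratv.subspace_neg[OF perm_ideal_subspace] ratv.subspace_neg[OF total_SymDias_subspace]
      del: minus_diff_eq)

lift_definition minus_perm_space :: "perm_space \<Rightarrow> perm_space \<Rightarrow> perm_space" is "(-)"
proof -
  fix x x' y y' :: "nat list \<Rightarrow>\<^sub>0 dias"
  assume *: "perm_eq x x'" "perm_eq y y'"
  then have "(x - x') - (y - y') \<in> perm_ideal"
    unfolding perm_eq_def by (blast intro: ratv.subspace_diff[OF perm_ideal_subspace])
  then have "(x - y) - (x' - y') \<in> perm_ideal" by (simp add: algebra_simps)
  then show "perm_eq (x - y) (x' - y')"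
    using * by (simp add: perm_eq_def ratv.subspace_diff[OF total_SymDias_subspace])
qed

lift_definition scaleQ_perm_space :: "rat \<Rightarrow> perm_space \<Rightarrow> perm_space" is scaleQ
  by (simp add: perm_eq_def ratv.scale_right_diff_distrib[symmetric]
      ratv.subspace_scale[OF perm_ideal_subspace] ratv.subspace_scale[OF total_SymDias_subspace])

lemma perm_eq_refl: "perm_eq x x \<longleftrightarrow> x \<in> total_space SymDias"
  by (simp add: perm_eq_def ratv.subspace_0[OF perm_ideal_subspace])

instance
proof
  note closed = ratv.subspace_0[OF total_SymDias_subspace] ratv.subspace_add[OF total_SymDias_subspace]
    ratv.subspace_diff[OF total_SymDias_subspace] ratv.subspace_neg[OF total_SymDias_subspace]
    ratv.subspace_scale[OF total_SymDias_subspace]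
  fix x y z :: perm_space and a b :: rat
  show "x + y + z = x + (y + z)" by transfer (simp add: perm_eq_refl closed add.assoc)
  show "x + y = y + x" by transfer (simp add: perm_eq_refl closed add.commute)
  show "0 + x = x" by transfer (simp add: perm_eq_refl closed)
  show "- x + x = 0" by transfer (simp add: perm_eq_refl closed)
  show "x - y = x + - y" by transfer (simp add: perm_eq_refl closed)
  show "a *\<^sub>Q (x + y) = a *\<^sub>Q x + a *\<^sub>Q y"
    by transfer (simp add: perm_eq_refl closed scaleQ_add_right)
  show "(a + b) *\<^sub>Q x = a *\<^sub>Q x + b *\<^sub>Q x"
    by transfer (simp add: perm_eq_refl closed scaleQ_add_left)
  show "a *\<^sub>Q b *\<^sub>Q x = (a * b) *\<^sub>Q x"
    by transfer (simp add: perm_eq_refl closed scaleQ_scaleQ)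
  show "1 *\<^sub>Q x = x" by transfer (simp add: perm_eq_refl closed scaleQ_one)
qed

end

lift_definition perm_circ :: "nat \<Rightarrow> perm_space \<Rightarrow> perm_space \<Rightarrow> perm_space" is "symc_circ Dias"
proof -
  fix i and x x' y y' :: "nat list \<Rightarrow>\<^sub>0 dias"
  assume *: "perm_eq x x'" "perm_eq y y'"
  let ?c = "symc_circ Dias"
  have 0: "?c i (x - x') y \<in> perm_ideal" "?c i x' (y - y') \<in> perm_ideal"
    using * by (simp_all add: perm_eq_def perm_ideal_circ)
  have 1: "?c i x y = ?c i (x - x') y + ?c i x' y"
    using SymDias.circ_add_left[of i "x - x'" x' y] by (simp only: SymDias_simps diff_add_cancel)
  have 2: "?c i x' y = ?c i x' (y - y') + ?c i x' y'"
    using SymDias.circ_add_right[of i x' "y - y'" y'] by (simp only: SymDias_simps diff_add_cancel)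
  have "?c i x y - ?c i x' y' = ?c i (x - x') y + ?c i x' (y - y')"
    unfolding 1 2 by simp
  then have "?c i x y - ?c i x' y' \<in> perm_ideal"
    using ratv.subspace_add[OF perm_ideal_subspace 0] by simp
  moreover have "?c i x y \<in> total_space SymDias" "?c i x' y' \<in> total_space SymDias"
    using * SymDias.total_closed by (auto simp: perm_eq_def SymDias_simps(2))
  ultimately show "perm_eq (?c i x y) (?c i x' y')" by (simp add: perm_eq_def)
qed

definition PermWith :: "(nat \<Rightarrow> (nat \<Rightarrow> nat) \<Rightarrow> perm_space \<Rightarrow> perm_space) \<Rightarrow> perm_space sym_op" where
  "PermWith \<rho> =
     \<lparr>Comp = (\<lambda>n. to_perm ` Comp SymDias n),
      Unit = to_perm (Unit SymDias),
      Circ = perm_circ,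
      Act = \<rho>\<rparr>"

text \<open>Again the structure is unique on the components. As the action of \<open>\<SS>\<^bsub>n+1\<^esub>\<close> on \<open>AnticyclicDias\<close>
  extends the action of \<open>\<SS>\<^sub>n\<close> on \<open>SymDias\<close>, that on \<open>Perm\<close> extends the action of \<open>\<SS>\<^sub>n\<close> on the
  quotient.\<close>

definition Perm :: "perm_space sym_op" where
  "Perm = PermWith (SOME \<rho>.
     anticyclic_operad (PermWith \<rho>) \<and> anticyclic_morphism AnticyclicDias (PermWith \<rho>) to_perm)"


section \<open>Symmetric functions\<close>

text \<open>Power series over \<open>\<rat>\<close> in the variables \<open>x\<^sub>0, x\<^sub>1, \<dots>\<close>. A monomial is the multiset of its variables, and
  arbitrary families of coefficients are allowed; thus the completed ring of symmetric functions is the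
  subring of the series that are invariant under permutations of the variables.\<close>

typedef pseries = "UNIV :: (nat multiset \<Rightarrow> rat) set"
  morphisms coeff PSeries
  by simp

setup_lifting type_definition_pseries

lemma pseries_eqI: "(\<And>m. coeff f m = coeff g m) \<Longrightarrow> f = g"
  by (simp add: coeff_inject[symmetric] fun_eq_iff)

lemma finite_submultisets: "finite {a. a \<subseteq># m}"
proof (induction m)
  case (add x m)
  have "{a. a \<subseteq># add_mset x m} \<subseteq> {a. a \<subseteq># m} \<union> add_mset x ` {a. a \<subseteq># m}"
  proof
    fix a assume a: "a \<in> {a. a \<subseteq># add_mset x m}"
    show "a \<in> {a. a \<subseteq># m} \<union> add_mset x ` {a. a \<subseteq># m}"
    proof (cases "x \<in># a")
      case True
      then obtain b where "a = add_mset x b" by (metis multi_member_split)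
      with a show ?thesis by auto
    next
      case False
      with a have "count a y \<le> count m y" for y
        by (cases "y = x") (auto simp: subseteq_mset_def not_in_iff split: if_splits dest: spec[of _ y])
      then have "a \<subseteq># m" by (simp add: subseteq_mset_def)
      then show ?thesis by simp
    qed
  qed
  then show ?case by (rule finite_subset) (use add.IH in simp)
qed simp

instantiation pseries :: "{comm_ring_1, rat_vector}"
begin

lift_definition zero_pseries :: pseries is "\<lambda>_. 0" .
lift_definition one_pseries :: pseries is "\<lambda>m. if m = {#} then 1 else 0" .
lift_definition plus_pseries :: "pseries \<Rightarrow> pseries \<Rightarrow> pseries" is "\<lambda>f g m. f m + g m" .
lift_definition uminus_pseries :: "pseries \<Rightarrow> pseries" is "\<lambda>f m. - f m" .
lift_definition minus_pseries :: "pseries \<Rightarrow> pseries \<Rightarrow> pseries" is "\<lambda>f g m. f m - g m" .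
lift_definition times_pseries :: "pseries \<Rightarrow> pseries \<Rightarrow> pseries"
  is "\<lambda>f g m. \<Sum>a | a \<subseteq># m. f a * g (m - a)" .
lift_definition scaleQ_pseries :: "rat \<Rightarrow> pseries \<Rightarrow> pseries" is "\<lambda>c f m. c * f m" .

instance
proof
  fix f g h :: pseries and a b :: rat
  note fin = finite_submultisets
  have dd: "m - (m - a) = a" if "a \<subseteq># m" for a m :: "nat multiset"
    using that by (simp add: multiset_eq_iff subseteq_mset_def)
  show "f * g = g * f"
  proof (rule pseries_eqI)
    fix m :: "nat multiset"
    have "(\<Sum>a | a \<subseteq># m. coeff f a * coeff g (m - a)) = (\<Sum>a | a \<subseteq># m. coeff f (m - a) * coeff g a)"
      by (rule sum.reindex_bij_witness[of _ "\<lambda>a. m - a" "\<lambda>a. m - a"])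
        (auto simp: dd)
    then show "coeff (f * g) m = coeff (g * f) m"
      by (simp add: times_pseries.rep_eq mult.commute)
  qed
  show "f * g * h = f * (g * h)"
  proof (rule pseries_eqI)
    fix m :: "nat multiset"
    let ?A = "SIGMA b : {b. b \<subseteq># m}. {a. a \<subseteq># b}"
    let ?B = "SIGMA a : {a. a \<subseteq># m}. {c. c \<subseteq># m - a}"
    have "coeff (f * g * h) m = (\<Sum>(b, a)\<in>?A. coeff f a * coeff g (b - a) * coeff h (m - b))"
      by (simp add: times_pseries.rep_eq sum_distrib_right sum.Sigma fin)
    also have "\<dots> = (\<Sum>(a, c)\<in>?B. coeff f a * (coeff g c * coeff h (m - a - c)))"
    proof (rule sum.reindex_bij_witness[of _ "\<lambda>(a, c). (a + c, a)" "\<lambda>(b, a). (a, b - a)"])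
      fix p assume "p \<in> ?A"
      then obtain a b where p: "p = (b, a)" "b \<subseteq># m" "a \<subseteq># b" by auto
      then show "(case case p of (b, a) \<Rightarrow> (a, b - a) of (a, c) \<Rightarrow> (a + c, a)) = p" by simp
      show "(case p of (b, a) \<Rightarrow> (a, b - a)) \<in> ?B"
        using p by (auto intro: subset_mset.order_trans) (auto simp: subseteq_mset_def intro: diff_le_mono)
      show "(case case p of (b, a) \<Rightarrow> (a, b - a) of (a, c) \<Rightarrow> coeff f a * (coeff g c * coeff h (m - a - c)))
          = (case p of (b, a) \<Rightarrow> coeff f a * coeff g (b - a) * coeff h (m - b))"
        using p by (simp add: mult.assoc)
    next
      fix q assume "q \<in> ?B"
      then obtain a c where q: "q = (a, c)" "a \<subseteq># m" "c \<subseteq># m - a" by auto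
      then show "(case case q of (a, c) \<Rightarrow> (a + c, a) of (b, a) \<Rightarrow> (a, b - a)) = q" by simp
      show "(case q of (a, c) \<Rightarrow> (a + c, a)) \<in> ?A"
        using q by (auto simp: subset_mset.le_diff_conv2 add.commute)
    qed
    also have "\<dots> = coeff (f * (g * h)) m"
      by (simp add: times_pseries.rep_eq sum_distrib_left sum.Sigma fin)
    finally show "coeff (f * g * h) m = coeff (f * (g * h)) m" .
  qed
  show "1 * f = f"
  proof (rule pseries_eqI)
    fix m :: "nat multiset"
    have "(\<Sum>a | a \<subseteq># m. (if a = {#} then 1 else 0) * coeff f (m - a)) =
        (\<Sum>a | a \<subseteq># m. if a = {#} then coeff f m else 0)"
      by (rule sum.cong) auto
    then show "coeff (1 * f) m = coeff f m"
      by (simp add: times_pseries.rep_eq one_pseries.rep_eq fin)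
  qed
  show "(f + g) * h = f * h + g * h"
    by transfer (simp add: distrib_right sum.distrib)
  show "(0::pseries) \<noteq> 1"
    by transfer (auto simp: fun_eq_iff)
  show "f + g + h = f + (g + h)" by transfer (simp add: add.assoc)
  show "f + g = g + f" by transfer (simp add: add.commute)
  show "0 + f = f" by transfer simp
  show "- f + f = 0" by transfer simp
  show "f - g = f + - g" by transfer simp
  show "a *\<^sub>Q (f + g) = a *\<^sub>Q f + a *\<^sub>Q g" by transfer (simp add: distrib_left)
  show "(a + b) *\<^sub>Q f = a *\<^sub>Q f + b *\<^sub>Q f" by transfer (simp add: distrib_right)
  show "a *\<^sub>Q b *\<^sub>Q f = (a * b) *\<^sub>Q f" by transfer (simp add: mult.assoc)
  show "1 *\<^sub>Q f = f" by transfer simp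
qed

end

text \<open>\<open>\<Sum>\<^sub>i x\<^sub>i\<^sup>k\<close>, for \<open>k \<ge> 1\<close>.\<close>

lift_definition power_sum :: "nat \<Rightarrow> pseries"
  is "\<lambda>k m. if \<exists>i. m = replicate_mset k i then 1 else 0" .

text \<open>Infinite sums in which every monomial occurs in only finitely many terms.\<close>

lift_definition series_sum :: "nat set \<Rightarrow> (nat \<Rightarrow> pseries) \<Rightarrow> pseries"
  is "\<lambda>A F m. \<Sum>k | k \<in> A \<and> F k m \<noteq> 0. F k m" .

text \<open>Meaningful for series without constant term.\<close>

definition series_exp :: "pseries \<Rightarrow> pseries" where
  "series_exp f = series_sum UNIV (\<lambda>n. (1 / fact n) *\<^sub>Q f ^ n)"

definition cycle_power_sum :: "nat \<Rightarrow> (nat \<Rightarrow> nat) \<Rightarrow> pseries" where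
  "cycle_power_sum N \<sigma> = (\<Prod>C \<in> orbit \<sigma> ` {1..N}. power_sum (card C))"

definition frobenius_char :: "nat \<Rightarrow> ((nat \<Rightarrow> nat) \<Rightarrow> rat) \<Rightarrow> pseries" where
  "frobenius_char N \<chi> = (1 / fact N) *\<^sub>Q (\<Sum>\<sigma> | \<sigma> permutes {1..N}. \<chi> \<sigma> *\<^sub>Q cycle_power_sum N \<sigma>)"

definition Ch :: "('a::rat_vector, 'z) sym_op_scheme \<Rightarrow> pseries" where
  "Ch P = series_sum {1..} (\<lambda>n.
     frobenius_char (n + 1) (\<lambda>\<sigma>. trace_on (Comp P n) (Act P n \<sigma>)))"

end

theory Submission
  imports Defs
begin

text \<open>\<open>Perm(n)\<close> is the standard representation of \<open>\<SS>\<^bsub>n+1\<^esub>\<close>, the vectors of sum zero in \<open>\<rat>\<^bsup>n+1\<^esup>\<close>.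
  Let \<open>v\<^sub>1, \<dots>, v\<^bsub>n+1\<^esub>\<close> be the standard basis of \<open>\<rat>\<^bsup>n+1\<^esup>\<close>, and let \<open>e\<^sub>i = v\<^sub>i - v\<^bsub>n+1\<^esub>\<close> stand for the product
  of \<open>x\<^sub>1, \<dots>, x\<^sub>n\<close> in \<open>Perm(n)\<close> that begins with \<open>x\<^sub>i\<close> (the order of the other factors does not matter).
  Then \<open>f \<circ>\<^sub>k g\<close> is obtained from the sequence \<open>f\<close> by replacing the entry \<open>f\<^sub>k\<close> by the block
  \<open>f\<^sub>k g\<^sub>1, \<dots>, f\<^sub>k g\<^sub>n\<close> and multiplying the other entries by \<open>g\<^sub>1 + \<dots> + g\<^sub>n = - g\<^bsub>n+1\<^esub>\<close>. This
  formula treats the last entry of \<open>f\<close> like the others, so the permutations of all \<open>n + 1\<close> entries satisfy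
  the axioms of an anticyclic operad. In particular the long cycle rotates the entries, which is the
  prescribed action on \<open>Perm(2)\<close>: \<open>e\<^sub>1 \<mapsto> - e\<^sub>2\<close> and \<open>e\<^sub>2 \<mapsto> e\<^sub>1 - e\<^sub>2\<close>.

  The same vectors describe \<open>Dias\<close> as a non-symmetric operad: a monomial in \<open>\<stileturn>\<close> and \<open>\<turnstile>\<close> is determined by
  its arity and the position of its middle argument, the one to which all operations point
  (\<open>tree_class_normal\<close>). There the only symmetry is the rotation \<open>dias_tau\<close>, which is determined by its
  values in arities \<open>1\<close> and \<open>2\<close> because \<open>\<circ>\<^sub>2\<close> generates the higher arities
  (\<open>dias_coord_tau\<close>). An element of the symmetrization is a combination of words with
  a marked position; the relation of \<open>Perm\<close> exchanges neighbouring letters while the mark follows its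
  letter, so only the marked letter survives (\<open>word_coord_kernel\<close>). These coordinates
  turn the given action on words into the permutation of the entries (\<open>symc_act_ext_word\<close>), hence the
  quotient structure exists and is the one described above (\<open>Perm_anticyclic_quotient\<close>).

  The character of \<open>Perm(n)\<close> at \<open>\<sigma>\<close> is therefore the number of fixed points of \<open>\<sigma>\<close> minus \<open>1\<close>.
  Summing the power sums attached to cycle types over \<open>\<SS>\<^sub>N\<close> gives \<open>N! h\<^sub>N\<close>, where \<open>h\<^sub>N\<close> is the complete
  homogeneous function, and weighting them with the number of fixed points gives \<open>N! p\<^sub>1 h\<^bsub>N-1\<^esub>\<close>.
  So \<open>Perm(n)\<close> contributes \<open>p\<^sub>1 h\<^sub>n - h\<^bsub>n+1\<^esub>\<close>. This expression vanishes for \<open>n = 0\<close>, and the sum over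
  all \<open>n\<close> is \<open>(p\<^sub>1 - 1) \<Sum>\<^sub>N h\<^sub>N + 1\<close>, where \<open>\<Sum>\<^sub>N h\<^sub>N\<close> is the exponential of \<open>\<Sum>\<^sub>k p\<^sub>k / k\<close>
  (\<open>series_exp_power_sums\<close>).\<close>

section \<open>The exponential of the power sums\<close>

text \<open>The sum of all complete homogeneous symmetric functions.\<close>

lift_definition monomial_sum :: pseries is "\<lambda>_. 1" .

text \<open>The derivation \<open>\<Sum>\<^sub>i x\<^sub>i \<partial>/\<partial>x\<^sub>i\<close>. Since a series is determined by its constant term and its logarithmic
  derivative, it reduces the computation of an exponential to an identity of coefficients.\<close>

lift_definition euler :: "pseries \<Rightarrow> pseries" is "\<lambda>f m. of_nat (size m) * f m" .

lemma scaleQ_times_pseries: "(c *\<^sub>Q f) * g = c *\<^sub>Q (f * g)" for f g :: pseries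
  by transfer (simp add: sum_distrib_left mult.assoc)

lemma euler_times: "euler (f * g) = euler f * g + f * euler g"
proof (rule pseries_eqI)
  fix m :: "nat multiset"
  have "of_nat (size m) * (\<Sum>a | a \<subseteq># m. coeff f a * coeff g (m - a)) =
    (\<Sum>a | a \<subseteq># m. of_nat (size a) * coeff f a * coeff g (m - a)
       + coeff f a * (of_nat (size (m - a)) * coeff g (m - a)))"
    unfolding sum_distrib_left
  proof (rule sum.cong[OF refl])
    fix a assume "a \<in> {a. a \<subseteq># m}"
    then have "size m = size a + size (m - a)"
      using size_mset_mono[of a m] by (simp add: size_Diff_submset)
    then show "of_nat (size m) * (coeff f a * coeff g (m - a)) =
        of_nat (size a) * coeff f a * coeff g (m - a)
          + coeff f a * (of_nat (size (m - a)) * coeff g (m - a))"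
      by (simp add: algebra_simps)
  qed
  then show "coeff (euler (f * g)) m = coeff (euler f * g + f * euler g) m"
    by (simp add: euler.rep_eq times_pseries.rep_eq plus_pseries.rep_eq sum.distrib)
qed

lemma euler_one: "euler 1 = 0"
  by transfer auto

lemma euler_power: "euler (f ^ Suc n) = of_nat (Suc n) *\<^sub>Q (f ^ n * euler f)"
proof (induction n)
  case (Suc n)
  have "euler (f ^ Suc (Suc n)) = f ^ Suc n * euler f + f * euler (f ^ Suc n)"
    by (subst power_Suc, subst euler_times) (simp add: mult.commute)
  also have "f * euler (f ^ Suc n) = of_nat (Suc n) *\<^sub>Q (f ^ Suc n * euler f)"
    unfolding Suc by (metis scaleQ_times_pseries mult.commute power_Suc mult.assoc)
  also have "f ^ Suc n * euler f + of_nat (Suc n) *\<^sub>Q (f ^ Suc n * euler f)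
      = of_nat (Suc (Suc n)) *\<^sub>Q (f ^ Suc n * euler f)"
    by (simp only: of_nat_Suc scaleQ_add_left scaleQ_one)
  finally show ?case .
qed (simp add: euler_one euler_times scaleQ_one)

text \<open>A series without constant term starts in degree \<open>1\<close>. This makes the sum that defines the
  exponential finite in each degree.\<close>

lemma coeff_power_eq_0:
  assumes "coeff f {#} = 0" "size m < n"
  shows "coeff (f ^ n) m = 0"
  using assms(2)
proof (induction n arbitrary: m)
  case (Suc n)
  have "coeff f a * coeff (f ^ n) (m - a) = 0" if "a \<subseteq># m" for a
  proof (cases "a = {#}")
    case False
    then have "size a > 0" by (simp add: nonempty_has_size)
    then have "size (m - a) < n"
      using Suc.prems size_mset_mono[OF that] by (simp add: size_Diff_submset[OF that])
    then show ?thesis using Suc.IH by simp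
  qed (use assms in simp)
  then show ?case unfolding power_Suc times_pseries.rep_eq by (intro sum.neutral) auto
qed simp

lemma coeff_series_exp:
  assumes "coeff f {#} = 0" "size m \<le> K"
  shows "coeff (series_exp f) m = (\<Sum>n\<le>K. coeff (f ^ n) m / fact n)"
proof -
  have "coeff (series_exp f) m =
      (\<Sum>n | coeff (f ^ n) m / fact n \<noteq> 0. coeff (f ^ n) m / fact n)"
    by (simp add: series_exp_def series_sum.rep_eq scaleQ_pseries.rep_eq)
  also have "\<dots> = (\<Sum>n\<le>K. coeff (f ^ n) m / fact n)"
  proof (rule sum.mono_neutral_left)
    show "{n. coeff (f ^ n) m / fact n \<noteq> 0} \<subseteq> {..K}"
      using coeff_power_eq_0[OF assms(1)] assms(2) by (force simp: not_less[symmetric])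
  qed auto
  finally show ?thesis .
qed

lemma euler_series_exp:
  assumes f: "coeff f {#} = 0"
  shows "euler (series_exp f) = series_exp f * euler f"
proof (rule pseries_eqI)
  fix m :: "nat multiset"
  let ?K = "size m"
  have "coeff (euler (series_exp f)) m = (\<Sum>n\<le>Suc ?K. coeff (euler (f ^ n)) m / fact n)"
    unfolding euler.rep_eq coeff_series_exp[OF f le_SucI[OF order_refl]] sum_distrib_left
    by (rule sum.cong) auto
  also have "\<dots> = (\<Sum>n\<le>?K. coeff (euler (f ^ Suc n)) m / fact (Suc n))"
    unfolding sum.atMost_Suc_shift by (simp add: euler_one zero_pseries.rep_eq)
  also have "\<dots> = (\<Sum>n\<le>?K. coeff (f ^ n * euler f) m / fact n)"
    unfolding euler_power by (intro sum.cong refl) (simp add: scaleQ_pseries.rep_eq field_simps del: of_nat_Suc)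
  also have "\<dots> = (\<Sum>a | a \<subseteq># m. (\<Sum>n\<le>?K. coeff (f ^ n) a / fact n) * coeff (euler f) (m - a))"
    by (simp add: times_pseries.rep_eq sum_divide_distrib sum_distrib_right sum.swap[of _ "{..?K}"])
  also have "\<dots> = coeff (series_exp f * euler f) m"
    unfolding times_pseries.rep_eq
    by (rule sum.cong) (auto simp: coeff_series_exp[OF f, of _ ?K] size_mset_mono)
  finally show "coeff (euler (series_exp f)) m = coeff (series_exp f * euler f) m" .
qed

text \<open>In degree \<open>N > 0\<close> the equation reads \<open>N f\<^sub>N = \<Sum>\<^bsub>a<N\<^esub> f\<^sub>a g\<^bsub>N-a\<^esub>\<close>, which is a recursion because \<open>g\<close> has no
  constant term.\<close>

lemma euler_equation_unique:
  assumes g: "coeff g {#} = 0" and f: "euler f = f * g" "euler f' = f' * g"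
    and init: "coeff f {#} = coeff f' {#}"
  shows "f = f'"
proof (rule pseries_eqI)
  fix m
  show "coeff f m = coeff f' m"
  proof (induction m rule: measure_induct_rule[where f = size])
    case (less m)
    show ?case
    proof (cases "m = {#}")
      case False
      have eq: "of_nat (size m) * coeff h m = (\<Sum>a | a \<subseteq># m. coeff h a * coeff g (m - a))"
        if "euler h = h * g" for h
        using arg_cong[OF that, of "\<lambda>h. coeff h m"]
        by (simp add: euler.rep_eq times_pseries.rep_eq)
      have "(\<Sum>a | a \<subseteq># m. coeff f a * coeff g (m - a)) = (\<Sum>a | a \<subseteq># m. coeff f' a * coeff g (m - a))"
      proof (rule sum.cong[OF refl])
        fix a assume a: "a \<in> {a. a \<subseteq># m}"
        show "coeff f a * coeff g (m - a) = coeff f' a * coeff g (m - a)"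
        proof (cases "a = m")
          case False
          then have "size a < size m" using a by (simp add: mset_subset_size subset_mset.less_le)
          then show ?thesis using less by simp
        qed (use g in simp)
      qed
      then show ?thesis using eq[OF f(1)] eq[OF f(2)] False
        by (metis mult_cancel_left of_nat_eq_0_iff size_eq_0_iff_empty)
    qed (use init in simp)
  qed
qed

text \<open>The monomials \<open>x\<^sub>i\<^sup>k\<close> with \<open>k \<ge> 1\<close>, which are the ones that occur in power sums.\<close>

definition pure_power :: "nat multiset \<Rightarrow> bool" where
  "pure_power m \<longleftrightarrow> m \<noteq> {#} \<and> (\<exists>i. m = replicate_mset (size m) i)"

lemma coeff_log_series:
  "coeff (series_sum {1..} (\<lambda>k. (1 / of_nat k) *\<^sub>Q power_sum k)) m =
     (if pure_power m then 1 / of_nat (size m) else 0)"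
proof -
  have "{k. k \<in> {1..} \<and> coeff ((1 / of_nat k) *\<^sub>Q power_sum k) m \<noteq> 0} =
      (if pure_power m then {size m} else {})"
    by (auto simp: pure_power_def scaleQ_pseries.rep_eq power_sum.rep_eq nonempty_has_size Suc_le_eq)
  then show ?thesis
    by (auto simp: pure_power_def series_sum.rep_eq scaleQ_pseries.rep_eq power_sum.rep_eq)
qed

text \<open>The divisors of a monomial that are powers of \<open>x\<^sub>i\<close> are counted by the exponent of \<open>x\<^sub>i\<close>. This says
  that the series of all monomials satisfies the differential equation of the exponential.\<close>

lemma card_constant_submultisets:
  "card {a. a \<subseteq># m \<and> pure_power a} = size m"
proof -
  let ?S = "SIGMA i:set_mset m. {1..count m i}"
  have "bij_betw (\<lambda>(i, k). replicate_mset k i) ?S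
      {a. a \<subseteq># m \<and> pure_power a}"
    unfolding bij_betw_def
  proof
    show "inj_on (\<lambda>(i, k). replicate_mset k i) ?S"
      by (auto simp: inj_on_def replicate_mset_eq_iff)
    show "(\<lambda>(i, k). replicate_mset k i) ` ?S =
        {a. a \<subseteq># m \<and> pure_power a}"
    proof (intro equalityI subsetI)
      fix a assume "a \<in> {a. a \<subseteq># m \<and> pure_power a}"
      then obtain i where a: "a \<subseteq># m" "a \<noteq> {#}" "a = replicate_mset (size a) i" by (auto simp: pure_power_def)
      have "size a \<ge> 1" using a(2) by (simp add: nonempty_has_size Suc_le_eq)
      moreover have "size a \<le> count m i"
        using a(1,3) by (metis count_le_replicate_mset_subset_eq)
      ultimately have "(i, size a) \<in> ?S"
        by (metis SigmaI atLeastAtMost_iff count_eq_zero_iff le_zero_eq not_one_le_zero order_trans)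
      then show "a \<in> (\<lambda>(i, k). replicate_mset k i) ` ?S"
        by (rule rev_image_eqI) (use a(3) in simp)
    qed (auto simp: pure_power_def count_le_replicate_mset_subset_eq[symmetric])
  qed
  then have "card {a. a \<subseteq># m \<and> pure_power a} = card ?S"
    by (metis bij_betw_same_card)
  also have "\<dots> = size m"
    by (simp add: size_multiset_overloaded_eq)
  finally show ?thesis .
qed

lemma series_exp_power_sums:
  "series_exp (series_sum {1..} (\<lambda>k. (1 / of_nat k) *\<^sub>Q power_sum k)) = monomial_sum"
  (is "series_exp ?L = _")
proof (rule euler_equation_unique[where g = "euler ?L"])
  have L: "coeff ?L {#} = 0" by (simp only: coeff_log_series) (simp add: pure_power_def)
  then show "euler (series_exp ?L) = series_exp ?L * euler ?L"
    by (rule euler_series_exp)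
  show "coeff (euler ?L) {#} = 0" by (simp add: euler.rep_eq)
  show "coeff (series_exp ?L) {#} = coeff monomial_sum {#}"
    using coeff_series_exp[OF L, of "{#}" 0] by (simp add: monomial_sum.rep_eq one_pseries.rep_eq)
  show "euler monomial_sum = monomial_sum * euler ?L"
  proof (rule pseries_eqI)
    fix m :: "nat multiset"
    have EL: "coeff (euler ?L) a = (if pure_power a then 1 else 0)" for a
      by (simp only: euler.rep_eq coeff_log_series) (simp add: pure_power_def)
    have "coeff (euler ?L * monomial_sum) m =
        (\<Sum>a | a \<subseteq># m. if pure_power a then 1 else 0)"
      unfolding times_pseries.rep_eq monomial_sum.rep_eq EL by simp
    also have "\<dots> = of_nat (card {a. a \<subseteq># m \<and> pure_power a})"
      by (simp add: sum.If_cases[OF finite_submultisets] Int_def)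
    also have "\<dots> = coeff (euler monomial_sum) m"
      unfolding card_constant_submultisets by (simp add: euler.rep_eq monomial_sum.rep_eq)
    finally show "coeff (euler monomial_sum) m = coeff (monomial_sum * euler ?L) m"
      by (simp add: mult.commute)
  qed
qed

section \<open>Cycle index sums of symmetric groups\<close>

lift_definition complete_homogeneous :: "nat \<Rightarrow> pseries" is "\<lambda>N m. if size m = N then 1 else 0" .

text \<open>This is \<open>cycle_power_sum\<close> for an arbitrary set of points; the removal of a fixed point
  leads to sets that are not of the form \<open>{1..N}\<close>.\<close>

definition cycle_product :: "'b set \<Rightarrow> ('b \<Rightarrow> 'b) \<Rightarrow> pseries" where
  "cycle_product X \<sigma> = (\<Prod>C \<in> orbit \<sigma> ` X. power_sum (card C))"

text \<open>Colourings of the points that are constant on each block and in which the colours have the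
  prescribed multiplicities. Functions are normalised outside the blocks so that they can be counted.\<close>

definition block_colourings :: "'b set set \<Rightarrow> nat multiset \<Rightarrow> ('b \<Rightarrow> nat) set" where
  "block_colourings S m = {\<phi> \<in> extensional (\<Union>S). (\<forall>C\<in>S. \<forall>x\<in>C. \<forall>y\<in>C. \<phi> x = \<phi> y) \<and>
     image_mset \<phi> (mset_set (\<Union>S)) = m}"

lemma block_colouringsI:
  assumes "\<phi> \<in> extensional (\<Union>S)" "\<And>C x y. C \<in> S \<Longrightarrow> x \<in> C \<Longrightarrow> y \<in> C \<Longrightarrow> \<phi> x = \<phi> y"
    "image_mset \<phi> (mset_set (\<Union>S)) = m"
  shows "\<phi> \<in> block_colourings S m"
  unfolding block_colourings_def using assms by blast

lemma block_colouringsD: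
  assumes "\<phi> \<in> block_colourings S m"
  shows "\<phi> \<in> extensional (\<Union>S)" "C \<in> S \<Longrightarrow> x \<in> C \<Longrightarrow> y \<in> C \<Longrightarrow> \<phi> x = \<phi> y"
    "image_mset \<phi> (mset_set (\<Union>S)) = m"
  using assms unfolding block_colourings_def by blast+

lemma finite_block_colourings: "finite (\<Union>S) \<Longrightarrow> finite (block_colourings S m)"
proof (rule finite_subset)
  assume fin: "finite (\<Union>S)"
  show "block_colourings S m \<subseteq> (\<Union>S) \<rightarrow>\<^sub>E set_mset m"
  proof
    fix \<phi> assume \<phi>: "\<phi> \<in> block_colourings S m"
    then have "m = image_mset \<phi> (mset_set (\<Union>S))" by (simp add: block_colouringsD(3))
    then have "set_mset m = \<phi> ` \<Union>S" by (simp only: set_image_mset finite_set_mset_mset_set[OF fin])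
    then show "\<phi> \<in> (\<Union>S) \<rightarrow>\<^sub>E set_mset m"
      using block_colouringsD(1)[OF \<phi>] by (simp add: PiE_iff)
  qed
  show "finite ((\<Union>S) \<rightarrow>\<^sub>E set_mset m)"
    using fin by (rule finite_PiE) simp
qed

text \<open>A colouring consists of the colour of the block \<open>C\<close>, which uses up \<open>card C\<close> copies of this colour, and
  a colouring of the other blocks.\<close>

lemma block_colourings_insert:
  assumes fin: "finite (\<Union>S)" "finite C" and C: "C \<noteq> {}" "C \<inter> \<Union>S = {}"
  shows "bij_betw (\<lambda>(i, \<phi>) x. if x \<in> C then i else \<phi> x)
     (SIGMA i : {i. replicate_mset (card C) i \<subseteq># m}. block_colourings S (m - replicate_mset (card C) i))
     (block_colourings (insert C S) m)"
proof -
  obtain c where c: "c \<in> C" using C by blast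
  have un: "mset_set (\<Union>(insert C S)) = mset_set C + mset_set (\<Union>S)"
    using fin C by (simp add: mset_set_Union)
  show ?thesis
  proof (rule bij_betw_byWitness[where f' = "\<lambda>\<phi>. (\<phi> c, restrict \<phi> (\<Union>S))"])
    show "\<forall>a\<in>SIGMA i:{i. replicate_mset (card C) i \<subseteq># m}. block_colourings S (m - replicate_mset (card C) i).
       (\<lambda>\<phi>. (\<phi> c, restrict \<phi> (\<Union>S))) ((\<lambda>(i, \<phi>) x. if x \<in> C then i else \<phi> x) a) = a"
    proof clarify
      fix i \<phi> assume "\<phi> \<in> block_colourings S (m - replicate_mset (card C) i)"
      then have "\<phi> \<in> extensional (\<Union>S)" by (rule block_colouringsD)
      moreover have "x \<notin> C" if "x \<in> \<Union>S" for x using that C by blast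
      ultimately have "restrict (\<lambda>x. if x \<in> C then i else \<phi> x) (\<Union>S) = \<phi>"
        by (intro extensionalityI[of _ "\<Union>S"]) simp_all
      then show "(if c \<in> C then i else \<phi> c) = i \<and> restrict (\<lambda>x. if x \<in> C then i else \<phi> x) (\<Union>S) = \<phi>"
        using c by simp
    qed
    show "\<forall>a'\<in>block_colourings (insert C S) m.
       (\<lambda>(i, \<phi>) x. if x \<in> C then i else \<phi> x) (a' c, restrict a' (\<Union>S)) = a'"
    proof
      fix \<phi> assume \<phi>: "\<phi> \<in> block_colourings (insert C S) m"
      have "\<phi> x = \<phi> c" if "x \<in> C" for x
        using block_colouringsD(2)[OF \<phi> insertI1 that c] .
      moreover have "\<phi> x = undefined" if "x \<notin> C" "x \<notin> \<Union>S" for x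
        using block_colouringsD(1)[OF \<phi>] that by (intro extensional_arb[of _ "\<Union>(insert C S)"]) auto
      ultimately have "(if x \<in> C then \<phi> c else restrict \<phi> (\<Union>S) x) = \<phi> x" for x
        by simp
      then show "(\<lambda>(i, \<phi>) x. if x \<in> C then i else \<phi> x) (\<phi> c, restrict \<phi> (\<Union>S)) = \<phi>"
        by (simp add: fun_eq_iff)
    qed
    show "(\<lambda>(i, \<phi>) x. if x \<in> C then i else \<phi> x) `
       (SIGMA i:{i. replicate_mset (card C) i \<subseteq># m}. block_colourings S (m - replicate_mset (card C) i))
       \<subseteq> block_colourings (insert C S) m"
    proof clarify
      fix i \<phi>
      assume i: "replicate_mset (card C) i \<subseteq># m"
        and \<phi>: "\<phi> \<in> block_colourings S (m - replicate_mset (card C) i)"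
      let ?\<psi> = "\<lambda>x. if x \<in> C then i else \<phi> x"
      have "image_mset ?\<psi> (mset_set C) = image_mset (\<lambda>_. i) (mset_set C)"
        by (rule image_mset_cong) (use fin in simp)
      moreover have "image_mset ?\<psi> (mset_set (\<Union>S)) = image_mset \<phi> (mset_set (\<Union>S))"
        by (rule image_mset_cong) (use fin C in auto)
      ultimately have "image_mset ?\<psi> (mset_set (\<Union>(insert C S))) = m"
        using i fin unfolding un by (simp add: image_mset_const_eq block_colouringsD(3)[OF \<phi>])
      moreover have "?\<psi> x = ?\<psi> y" if D: "D \<in> insert C S" "x \<in> D" "y \<in> D" for D x y
        proof (cases "D = C")
          case False
          then have "D \<in> S" "x \<notin> C" "y \<notin> C" using D C by auto
          then show ?thesis using block_colouringsD(2)[OF \<phi>, of D x y] D by simp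
        qed (use D in simp)
      moreover have "?\<psi> \<in> extensional (\<Union>(insert C S))"
        using block_colouringsD(1)[OF \<phi>] by (auto simp: extensional_def)
      ultimately show "?\<psi> \<in> block_colourings (insert C S) m"
        by (intro block_colouringsI)
    qed
    show "(\<lambda>\<phi>. (\<phi> c, restrict \<phi> (\<Union>S))) ` block_colourings (insert C S) m
      \<subseteq> (SIGMA i:{i. replicate_mset (card C) i \<subseteq># m}. block_colourings S (m - replicate_mset (card C) i))"
    proof clarify
      fix \<phi> assume \<phi>: "\<phi> \<in> block_colourings (insert C S) m"
      have "image_mset \<phi> (mset_set C) = image_mset (\<lambda>_. \<phi> c) (mset_set C)"
        by (rule image_mset_cong) (use block_colouringsD(2)[OF \<phi> insertI1 _ c] fin in simp)
      then have m: "m = replicate_mset (card C) (\<phi> c) + image_mset \<phi> (mset_set (\<Union>S))"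
        using block_colouringsD(3)[OF \<phi>] fin unfolding un by (simp add: image_mset_const_eq)
      have "image_mset (restrict \<phi> (\<Union>S)) (mset_set (\<Union>S)) = image_mset \<phi> (mset_set (\<Union>S))"
        by (rule image_mset_cong) (use fin in simp)
      also have "\<dots> = m - replicate_mset (card C) (\<phi> c)" by (simp add: m)
      finally have image: "image_mset (restrict \<phi> (\<Union>S)) (mset_set (\<Union>S)) = m - replicate_mset (card C) (\<phi> c)" .
      have "restrict \<phi> (\<Union>S) x = restrict \<phi> (\<Union>S) y" if "D \<in> S" "x \<in> D" "y \<in> D" for D x y
      proof -
        have "x \<in> \<Union>S" "y \<in> \<Union>S" using that by auto
        then show ?thesis using block_colouringsD(2)[OF \<phi> insertI2, of D x y] that by simp
      qed
      then have "restrict \<phi> (\<Union>S) \<in> block_colourings S (m - replicate_mset (card C) (\<phi> c))"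
        by (rule block_colouringsI[OF restrict_extensional _ image])
      then show "\<phi> c \<in> {i. replicate_mset (card C) i \<subseteq># m} \<and>
          restrict \<phi> (\<Union>S) \<in> block_colourings S (m - replicate_mset (card C) (\<phi> c))"
        by (simp add: m)
    qed
  qed
qed

text \<open>Expanding the product means choosing one variable for each block.\<close>

lemma coeff_prod_power_sum:
  assumes "finite S" "\<And>C. C \<in> S \<Longrightarrow> finite C \<and> C \<noteq> {}" "pairwise disjnt S"
  shows "coeff (\<Prod>C\<in>S. power_sum (card C)) m = of_nat (card (block_colourings S m))"
  using assms
proof (induction S arbitrary: m rule: finite_induct)
  case empty
  have "block_colourings {} m = (if m = {#} then {\<lambda>_ :: 'a. undefined} else {})"
    unfolding block_colourings_def by (auto simp: extensional_def)
  then have "card (block_colourings {} m :: ('a \<Rightarrow> nat) set) = (if m = {#} then 1 else 0)" by (cases "m = {#}") auto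
  then show ?case by (simp add: one_pseries.rep_eq)
next
  case (insert C S)
  have C: "finite C" "C \<noteq> {}" "finite (\<Union>S)" "C \<inter> \<Union>S = {}"
    using insert.prems insert.hyps by (auto simp: pairwise_insert disjnt_def)
  have IH: "coeff (\<Prod>C\<in>S. power_sum (card C)) m = of_nat (card (block_colourings S m))" for m
    using insert by (intro insert.IH) (auto simp: pairwise_insert)
  have card: "card C > 0" using C by (simp add: card_gt_0_iff)
  let ?R = "replicate_mset (card C)" and ?I = "{i. replicate_mset (card C) i \<subseteq># m}"
  have "finite ?I"
  proof (rule finite_subset)
    show "?I \<subseteq> set_mset m"
      using card by (auto dest!: mset_subset_eqD[of _ m] simp: in_replicate_mset)
  qed simp
  have inj: "inj_on ?R ?I" using card by (auto simp: inj_on_def replicate_mset_eq_iff)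
  have "coeff (\<Prod>C\<in>insert C S. power_sum (card C)) m =
      (\<Sum>a | a \<subseteq># m. coeff (power_sum (card C)) a * of_nat (card (block_colourings S (m - a))))"
    using insert.hyps by (simp add: times_pseries.rep_eq IH)
  also have "\<dots> = (\<Sum>a \<in> ?R ` ?I. of_nat (card (block_colourings S (m - a))))"
    by (rule sum.mono_neutral_cong_right[OF finite_submultisets]) (auto simp: power_sum.rep_eq)
  also have "\<dots> = (\<Sum>i \<in> ?I. of_nat (card (block_colourings S (m - ?R i))))"
    using inj by (simp add: sum.reindex)
  also have "\<dots> = of_nat (card (SIGMA i : ?I. block_colourings S (m - ?R i)))"
    using \<open>finite ?I\<close> C by (simp add: card_SigmaI finite_block_colourings)
  also have "\<dots> = of_nat (card (block_colourings (insert C S) m))"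
    using bij_betw_same_card[OF block_colourings_insert[OF C(3,1,2,4)]] by simp
  finally show ?case .
qed

lemma orbits_partition:
  assumes "finite X" "\<sigma> permutes X"
  shows "\<Union>(orbit \<sigma> ` X) = X" "pairwise disjnt (orbit \<sigma> ` X)"
    "C \<in> orbit \<sigma> ` X \<Longrightarrow> finite C \<and> C \<noteq> {}"
proof -
  have perm: "permutation \<sigma>" using assms permutation_permutes by blast
  have self: "x \<in> orbit \<sigma> x" for x by (rule permutation_self_in_orbit[OF perm])
  have sub: "orbit \<sigma> x \<subseteq> X" if "x \<in> X" for x
    using permutes_orbit_subset[OF assms(2) that] .
  show "\<Union>(orbit \<sigma> ` X) = X" using self sub by blast
  show "C \<in> orbit \<sigma> ` X \<Longrightarrow> finite C \<and> C \<noteq> {}"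
    using self sub assms(1) finite_subset by blast
  show "pairwise disjnt (orbit \<sigma> ` X)"
  proof (rule pairwiseI)
    fix C D assume "C \<in> orbit \<sigma> ` X" "D \<in> orbit \<sigma> ` X" "C \<noteq> D"
    then obtain x y where *: "C = orbit \<sigma> x" "D = orbit \<sigma> y" by auto
    have "orbit \<sigma> z = orbit \<sigma> x" if "z \<in> orbit \<sigma> x" for x z
      using orbit_cyclic_eq3[OF cyclic_on_orbit[OF assms(2,1)] that] .
    then show "disjnt C D" using * \<open>C \<noteq> D\<close> by (metis disjnt_iff)
  qed
qed

definition invariant_colourings :: "'b set \<Rightarrow> ('b \<Rightarrow> 'b) \<Rightarrow> nat multiset \<Rightarrow> ('b \<Rightarrow> nat) set" where
  "invariant_colourings X \<sigma> m = {\<phi> \<in> extensional X. (\<forall>x\<in>X. \<phi> (\<sigma> x) = \<phi> x) \<and> image_mset \<phi> (mset_set X) = m}"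

lemma coeff_cycle_product:
  assumes X: "finite X" "\<sigma> permutes X"
  shows "coeff (cycle_product X \<sigma>) m = of_nat (card (invariant_colourings X \<sigma> m))"
proof -
  have "(\<forall>C\<in>orbit \<sigma> ` X. \<forall>x\<in>C. \<forall>y\<in>C. \<phi> x = \<phi> y) \<longleftrightarrow> (\<forall>x\<in>X. \<phi> (\<sigma> x) = \<phi> x)" for \<phi> :: "'a \<Rightarrow> nat"
  proof
    assume *: "\<forall>C\<in>orbit \<sigma> ` X. \<forall>x\<in>C. \<forall>y\<in>C. \<phi> x = \<phi> y"
    show "\<forall>x\<in>X. \<phi> (\<sigma> x) = \<phi> x"
    proof
      fix x assume "x \<in> X"
      moreover have "x \<in> orbit \<sigma> x" "\<sigma> x \<in> orbit \<sigma> x"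
        using X permutation_permutes permutation_self_in_orbit orbit.base by metis+
      ultimately show "\<phi> (\<sigma> x) = \<phi> x" using * by blast
    qed
  next
    assume *: "\<forall>x\<in>X. \<phi> (\<sigma> x) = \<phi> x"
    have "\<phi> y = \<phi> x \<and> y \<in> X" if "y \<in> orbit \<sigma> x" "x \<in> X" for x y
      using that by induction (use * X permutes_in_image in fastforce)+
    then show "\<forall>C\<in>orbit \<sigma> ` X. \<forall>x\<in>C. \<forall>y\<in>C. \<phi> x = \<phi> y" by fastforce
  qed
  then have "block_colourings (orbit \<sigma> ` X) m = invariant_colourings X \<sigma> m"
    unfolding block_colourings_def invariant_colourings_def orbits_partition(1)[OF X] by auto
  then show ?thesis
    unfolding cycle_product_def
    using coeff_prod_power_sum[OF _ orbits_partition(3,2)[OF X]] X by simp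
qed

text \<open>Burnside's count. All colourings \<open>\<phi>\<close> with the given multiplicities are permutations of a fixed
  one \<open>\<phi>0\<close>, so the stabilizer of \<open>\<phi>\<close> has as many elements as the set of all \<open>\<sigma>\<close> with
  \<open>\<phi>0 \<circ> \<sigma> = \<phi>\<close>; these sets partition the symmetric group.\<close>

lemma sum_card_invariant_colourings:
  assumes X: "finite X"
  shows "(\<Sum>\<sigma> | \<sigma> permutes X. card (invariant_colourings X \<sigma> m)) = (if size m = card X then fact (card X) else 0)"
proof (cases "size m = card X")
  case False
  then have "invariant_colourings X \<sigma> m = {}" for \<sigma>
    by (auto simp: invariant_colourings_def)
  then show ?thesis using False by simp
next
  case True
  let ?S = "{\<sigma>. \<sigma> permutes X}"
  let ?\<Phi> = "{\<phi> \<in> extensional X. image_mset \<phi> (mset_set X) = m}"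
  have fin: "finite ?S" using X by (rule finite_permutations)
  have "finite ?\<Phi>"
  proof (rule finite_subset)
    show "?\<Phi> \<subseteq> X \<rightarrow>\<^sub>E set_mset m" using X by (auto simp: PiE_iff extensional_def)
    show "finite (X \<rightarrow>\<^sub>E set_mset m)" using X by (rule finite_PiE) simp
  qed
  \<comment> \<open>Some colouring exists because the multiplicities add up to the number of points.\<close>
  obtain \<phi>0 where \<phi>0: "\<phi>0 \<in> ?\<Phi>"
  proof -
    obtain ms where ms: "mset ms = m" using ex_mset by blast
    then have len: "length ms = card X" using True by auto
    obtain f where f: "bij_betw f X {..<card X}"
      using X ex_bij_betw_finite_nat[OF X] by (auto simp: atLeast0LessThan)
    have "image_mset (\<lambda>x. ms ! f x) (mset_set X) = image_mset ((!) ms) (image_mset f (mset_set X))"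
      by (simp add: multiset.map_comp comp_def)
    also have "image_mset f (mset_set X) = mset_set {..<length ms}"
      using f by (simp add: image_mset_mset_set bij_betw_def len)
    also have "image_mset ((!) ms) (mset_set {..<length ms}) = m"
      using ms by (metis map_nth mset_map mset_upt atLeast0LessThan)
    finally have "image_mset (restrict (\<lambda>x. ms ! f x) X) (mset_set X) = m"
      by (metis (no_types, lifting) X finite_set_mset_mset_set image_mset_cong restrict_apply')
    then show ?thesis using that by auto
  qed
  have stab: "card {\<sigma> \<in> ?S. \<forall>x\<in>X. \<phi> (\<sigma> x) = \<phi> x} = card {\<sigma> \<in> ?S. \<forall>x\<in>X. \<phi>0 (\<sigma> x) = \<phi> x}"
    if \<phi>: "\<phi> \<in> ?\<Phi>" for \<phi>
  proof -
    obtain p where p: "p permutes X" "\<forall>x\<in>X. \<phi> x = \<phi>0 (p x)"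
      by (rule image_mset_eq_implies_permutes[OF X, of \<phi> \<phi>0]) (use \<phi> \<phi>0 in simp_all)
    have "bij_betw (\<lambda>\<sigma>. p \<circ> \<sigma>) {\<sigma> \<in> ?S. \<forall>x\<in>X. \<phi> (\<sigma> x) = \<phi> x} {\<sigma> \<in> ?S. \<forall>x\<in>X. \<phi>0 (\<sigma> x) = \<phi> x}"
    proof (rule bij_betw_byWitness[where f' = "\<lambda>\<sigma>. inv p \<circ> \<sigma>"])
      show "(\<lambda>\<sigma>. p \<circ> \<sigma>) ` {\<sigma> \<in> ?S. \<forall>x\<in>X. \<phi> (\<sigma> x) = \<phi> x} \<subseteq> {\<sigma> \<in> ?S. \<forall>x\<in>X. \<phi>0 (\<sigma> x) = \<phi> x}"
        using p by (auto intro: permutes_compose simp: permutes_in_image)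
      show "(\<lambda>\<sigma>. inv p \<circ> \<sigma>) ` {\<sigma> \<in> ?S. \<forall>x\<in>X. \<phi>0 (\<sigma> x) = \<phi> x} \<subseteq> {\<sigma> \<in> ?S. \<forall>x\<in>X. \<phi> (\<sigma> x) = \<phi> x}"
        using p by (auto intro: permutes_compose permutes_inv
            simp: permutes_in_image permutes_in_image[OF permutes_inv] permutes_inverses)
    qed (use p in \<open>auto simp: o_assoc permutes_inv_o\<close>)
    then show ?thesis by (rule bij_betw_same_card)
  qed
  have "(\<Sum>\<sigma>\<in>?S. card (invariant_colourings X \<sigma> m)) = (\<Sum>\<sigma>\<in>?S. \<Sum>\<phi>\<in>?\<Phi>. if \<forall>x\<in>X. \<phi> (\<sigma> x) = \<phi> x then 1 else 0)"
    by (rule sum.cong[OF refl]) (simp add: invariant_colourings_def sum.If_cases[OF \<open>finite ?\<Phi>\<close>] Int_def conj_ac)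
  also have "\<dots> = (\<Sum>\<phi>\<in>?\<Phi>. card {\<sigma> \<in> ?S. \<forall>x\<in>X. \<phi> (\<sigma> x) = \<phi> x})"
    by (subst sum.swap) (simp add: sum.If_cases[OF fin] Int_def)
  also have "\<dots> = (\<Sum>\<phi>\<in>?\<Phi>. card {\<sigma> \<in> ?S. \<forall>x\<in>X. \<phi>0 (\<sigma> x) = \<phi> x})"
    by (rule sum.cong[OF refl stab])
  also have "\<dots> = card (\<Union>\<phi>\<in>?\<Phi>. {\<sigma> \<in> ?S. \<forall>x\<in>X. \<phi>0 (\<sigma> x) = \<phi> x})"
  proof (rule card_UN_disjoint[symmetric])
    show "\<forall>\<phi>\<in>?\<Phi>. \<forall>\<psi>\<in>?\<Phi>. \<phi> \<noteq> \<psi> \<longrightarrow>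
       {\<sigma> \<in> ?S. \<forall>x\<in>X. \<phi>0 (\<sigma> x) = \<phi> x} \<inter> {\<sigma> \<in> ?S. \<forall>x\<in>X. \<phi>0 (\<sigma> x) = \<psi> x} = {}"
    proof (intro ballI impI)
      fix \<phi> \<psi> assume "\<phi> \<in> ?\<Phi>" "\<psi> \<in> ?\<Phi>" "\<phi> \<noteq> \<psi>"
      then obtain x where "x \<in> X" "\<phi> x \<noteq> \<psi> x" using extensionalityI by blast
      then show "{\<sigma> \<in> ?S. \<forall>x\<in>X. \<phi>0 (\<sigma> x) = \<phi> x} \<inter> {\<sigma> \<in> ?S. \<forall>x\<in>X. \<phi>0 (\<sigma> x) = \<psi> x} = {}"
        by force
    qed
  qed (use \<open>finite ?\<Phi>\<close> fin in auto)
  also have "(\<Union>\<phi>\<in>?\<Phi>. {\<sigma> \<in> ?S. \<forall>x\<in>X. \<phi>0 (\<sigma> x) = \<phi> x}) = ?S"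
  proof (intro equalityI subsetI)
    fix \<sigma> assume \<sigma>: "\<sigma> \<in> ?S"
    let ?\<phi> = "restrict (\<lambda>x. \<phi>0 (\<sigma> x)) X"
    have "image_mset \<phi>0 (mset_set X) = image_mset ?\<phi> (mset_set X)"
      by (rule permutes_implies_image_mset_eq[of \<sigma>]) (use \<sigma> in auto)
    then have "?\<phi> \<in> ?\<Phi>" using \<phi>0 by auto
    then show "\<sigma> \<in> (\<Union>\<phi>\<in>?\<Phi>. {\<sigma> \<in> ?S. \<forall>x\<in>X. \<phi>0 (\<sigma> x) = \<phi> x})" by (rule UN_I) (use \<sigma> in simp)
  qed auto
  also have "card ?S = fact (card X)" by (rule card_permutations[OF refl X])
  finally show ?thesis using True by simp
qed

lemma coeff_sum_pseries: "coeff (\<Sum>x\<in>A. F x) m = (\<Sum>x\<in>A. coeff (F x) m)"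
  by (induction A rule: infinite_finite_induct) (auto simp: zero_pseries.rep_eq plus_pseries.rep_eq)

lemma sum_cycle_product:
  assumes "finite X"
  shows "(\<Sum>\<sigma> | \<sigma> permutes X. cycle_product X \<sigma>) = fact (card X) *\<^sub>Q complete_homogeneous (card X)"
proof (rule pseries_eqI)
  fix m
  have "coeff (\<Sum>\<sigma> | \<sigma> permutes X. cycle_product X \<sigma>) m =
      of_nat (\<Sum>\<sigma> | \<sigma> permutes X. card (invariant_colourings X \<sigma> m))"
    using assms by (simp add: coeff_sum_pseries coeff_cycle_product)
  then show "coeff (\<Sum>\<sigma> | \<sigma> permutes X. cycle_product X \<sigma>) m =
      coeff (fact (card X) *\<^sub>Q complete_homogeneous (card X)) m"
    using assms by (simp add: sum_card_invariant_colourings complete_homogeneous.rep_eq scaleQ_pseries.rep_eq)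
qed

lemma cycle_product_fixed_point:
  assumes "finite X" "i \<in> X" "\<sigma> permutes X - {i}"
  shows "cycle_product X \<sigma> = power_sum 1 * cycle_product (X - {i}) \<sigma>"
proof -
  have "\<sigma> i = i" using assms(3) by (simp add: permutes_not_in)
  then have i: "orbit \<sigma> i = {i}" by (simp add: orbit_eq_singleton_iff)
  have "i \<notin> orbit \<sigma> x" if "x \<in> X - {i}" for x
    using permutes_orbit_subset[OF assms(3) that] by auto
  then have "{i} \<notin> orbit \<sigma> ` (X - {i})" by auto
  moreover have "orbit \<sigma> ` X = insert {i} (orbit \<sigma> ` (X - {i}))"
    using assms(2) i by (metis image_insert insert_Diff)
  ultimately show ?thesis using assms(1) by (simp add: cycle_product_def)
qed

lemma times_scaleQ_pseries: "f * (c *\<^sub>Q g) = c *\<^sub>Q (f * g)" for f g :: pseries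
  by (metis scaleQ_times_pseries mult.commute)

text \<open>Counting pairs of a permutation and one of its fixed points \<open>i\<close>: the permutation is one of the other
  points, and the cycle \<open>(i)\<close> contributes the factor \<open>p\<^sub>1\<close>.\<close>

lemma sum_fixed_points_cycle_product:
  assumes X: "finite X" "X \<noteq> {}"
  shows "(\<Sum>\<sigma> | \<sigma> permutes X. of_nat (card {i\<in>X. \<sigma> i = i}) *\<^sub>Q cycle_product X \<sigma>) =
    fact (card X) *\<^sub>Q (power_sum 1 * complete_homogeneous (card X - 1))"
proof -
  let ?S = "{\<sigma>. \<sigma> permutes X}"
  have fin: "finite ?S" using X(1) by (rule finite_permutations)
  have pos: "card X > 0" using X by (simp add: card_gt_0_iff)
  have nat_scale: "of_nat (card A) *\<^sub>Q f = (\<Sum>i\<in>A. f)" for A :: "'a set" and f :: pseries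
    by (induction A rule: infinite_finite_induct)
      (auto simp: scaleQ_add_left scaleQ_one simp del: sum_constant)
  have "(\<Sum>\<sigma>\<in>?S. of_nat (card {i\<in>X. \<sigma> i = i}) *\<^sub>Q cycle_product X \<sigma>) =
      (\<Sum>\<sigma>\<in>?S. \<Sum>i\<in>X. if \<sigma> i = i then cycle_product X \<sigma> else 0)"
    using X(1) by (simp add: nat_scale sum.inter_filter del: sum_constant)
  also have "\<dots> = (\<Sum>i\<in>X. \<Sum>\<sigma> | \<sigma> permutes X - {i}. cycle_product X \<sigma>)"
  proof (subst sum.swap, rule sum.cong[OF refl])
    fix i assume i: "i \<in> X"
    have "{\<sigma> \<in> ?S. \<sigma> i = i} = {\<sigma>. \<sigma> permutes X - {i}}"
      using i by (auto intro: permutes_superset permutes_subset simp: permutes_not_in)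
    then show "(\<Sum>\<sigma>\<in>?S. if \<sigma> i = i then cycle_product X \<sigma> else 0) =
        (\<Sum>\<sigma> | \<sigma> permutes X - {i}. cycle_product X \<sigma>)"
      using fin by (simp add: sum.inter_filter[symmetric])
  qed
  also have "\<dots> = (\<Sum>i\<in>X. power_sum 1 * (\<Sum>\<sigma> | \<sigma> permutes X - {i}. cycle_product (X - {i}) \<sigma>))"
    using X(1) by (intro sum.cong) (auto simp: sum_distrib_left cycle_product_fixed_point)
  also have "\<dots> = (\<Sum>i\<in>X. power_sum 1 * (fact (card X - 1) *\<^sub>Q complete_homogeneous (card X - 1)))"
    using X(1) by (intro sum.cong) (auto simp: sum_cycle_product)
  also have "\<dots> = of_nat (card X) *\<^sub>Q (power_sum 1 * (fact (card X - 1) *\<^sub>Q complete_homogeneous (card X - 1)))"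
    by (rule nat_scale[symmetric])
  also have "\<dots> = fact (card X) *\<^sub>Q (power_sum 1 * complete_homogeneous (card X - 1))"
    using pos by (simp add: times_scaleQ_pseries scaleQ_scaleQ fact_reduce[of "card X"])
  finally show ?thesis .
qed

lemma frobenius_char_standard:
  assumes "N \<ge> 1" and \<chi>: "\<And>\<sigma>. \<sigma> permutes {1..N} \<Longrightarrow> \<chi> \<sigma> = of_nat (card {i\<in>{1..N}. \<sigma> i = i}) - 1"
  shows "frobenius_char N \<chi> = power_sum 1 * complete_homogeneous (N - 1) - complete_homogeneous N"
proof -
  have "(\<Sum>\<sigma> | \<sigma> permutes {1..N}. \<chi> \<sigma> *\<^sub>Q cycle_power_sum N \<sigma>) =
      (\<Sum>\<sigma> | \<sigma> permutes {1..N}. of_nat (card {i\<in>{1..N}. \<sigma> i = i}) *\<^sub>Q cycle_product {1..N} \<sigma>)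
      - (\<Sum>\<sigma> | \<sigma> permutes {1..N}. cycle_product {1..N} \<sigma>)"
    unfolding sum_subtractf[symmetric]
    by (rule sum.cong)
      (auto simp: \<chi> cycle_power_sum_def cycle_product_def ratv.scale_left_diff_distrib scaleQ_one)
  also have "\<dots> = fact N *\<^sub>Q (power_sum 1 * complete_homogeneous (N - 1) - complete_homogeneous N)"
    using assms(1) sum_fixed_points_cycle_product[of "{1..N}"] sum_cycle_product[of "{1..N}"]
    by (simp only: ratv.scale_right_diff_distrib finite_atLeastAtMost card_atLeastAtMost) simp
  finally show ?thesis by (simp add: frobenius_char_def scaleQ_scaleQ scaleQ_one)
qed

text \<open>The monomial \<open>m\<close> has coefficient \<open>1\<close> in \<open>h\<^bsub>n+1\<^esub>\<close>, and in \<open>p\<^sub>1 h\<^sub>n\<close> its coefficient is the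
  number of its distinct variables. In degree \<open>1\<close>, which does not occur in the characteristic function, the two
  agree.\<close>

lemma Ch_standard:
  assumes "\<And>n \<sigma>. n \<ge> 1 \<Longrightarrow> \<sigma> permutes {1..n + 1} \<Longrightarrow>
      trace_on (Comp P n) (Act P n \<sigma>) = of_nat (card {i\<in>{1..n + 1}. \<sigma> i = i}) - 1"
  shows "Ch P = (power_sum 1 - 1) * monomial_sum + 1"
proof (rule pseries_eqI)
  fix m :: "nat multiset"
  let ?F = "\<lambda>n. power_sum 1 * complete_homogeneous n - complete_homogeneous (n + 1)"
  have sub: "{a. a \<subseteq># m \<and> (\<exists>i. a = {#i#})} = (\<lambda>i. {#i#}) ` set_mset m"
    by (auto simp: single_subset_iff)
  have p1: "coeff (power_sum 1 * f) m = (\<Sum>i\<in>set_mset m. coeff f (m - {#i#}))" for f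
  proof -
    have "coeff (power_sum 1 * f) m = (\<Sum>a\<in>(\<lambda>i. {#i#}) ` set_mset m. coeff f (m - a))"
      unfolding times_pseries.rep_eq sub[symmetric]
      by (rule sum.mono_neutral_cong_right[OF finite_submultisets]) (auto simp: power_sum.rep_eq)
    then show ?thesis by (simp add: sum.reindex inj_on_def)
  qed
  have F: "coeff (?F n) m = (if size m = n + 1 then of_nat (card (set_mset m)) - 1 else 0)" for n
  proof -
    have "(\<Sum>i\<in>set_mset m. coeff (complete_homogeneous n) (m - {#i#})) =
        (\<Sum>i\<in>set_mset m. if size m = n + 1 then 1 else 0)"
    proof (rule sum.cong[OF refl])
      fix i assume "i \<in> set_mset m"
      then have "size m > 0" "size (m - {#i#}) = size m - 1"
        by (auto simp: size_Diff_singleton nonempty_has_size[symmetric])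
      then show "coeff (complete_homogeneous n) (m - {#i#}) = (if size m = n + 1 then 1 else 0)"
        by (auto simp: complete_homogeneous.rep_eq)
    qed
    then show ?thesis
      by (simp only: minus_pseries.rep_eq p1 complete_homogeneous.rep_eq[of "n + 1"]) auto
  qed
  have "coeff (Ch P) m = (\<Sum>k | k \<in> {1..} \<and> coeff (?F k) m \<noteq> 0. coeff (?F k) m)"
  proof -
    have "frobenius_char (k + 1) (\<lambda>\<sigma>. trace_on (Comp P k) (Act P k \<sigma>)) = ?F k" if "k \<ge> 1" for k
      using frobenius_char_standard[of "k + 1", OF _ assms[OF that]] by simp
    then show ?thesis unfolding Ch_def series_sum.rep_eq by (intro sum.cong) auto
  qed
  also have "\<dots> = (\<Sum>k\<in>{size m - 1}. if m = {#} then 0 else of_nat (card (set_mset m)) - 1)"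
  proof (rule sum.mono_neutral_cong_left)
    have "m = {#} \<or> size m = 1 \<and> card (set_mset m) = 1 \<or> size m \<ge> 2"
      by (metis One_nat_def Suc_1 Suc_leI card_1_singleton_iff le_eq_less_or_eq nonempty_has_size set_mset_single size_1_singleton_mset)
    then show "\<forall>i\<in>{size m - 1} - {k \<in> {1..}. coeff (?F k) m \<noteq> 0}.
        (if m = {#} then 0 else rat_of_nat (card (set_mset m)) - 1) = 0"
      unfolding F by auto
  next
    show "{k \<in> {1..}. coeff (?F k) m \<noteq> 0} \<subseteq> {size m - 1}" unfolding F by auto
  next
    fix k assume "k \<in> {k \<in> {1..}. coeff (?F k) m \<noteq> 0}"
    then show "coeff (?F k) m = (if m = {#} then 0 else rat_of_nat (card (set_mset m)) - 1)"
      unfolding F by (auto split: if_splits)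
  qed simp
  also have "\<dots> = coeff ((power_sum 1 - 1) * monomial_sum + 1) m"
    by (simp only: left_diff_distrib mult_1_left plus_pseries.rep_eq minus_pseries.rep_eq p1
        monomial_sum.rep_eq one_pseries.rep_eq) auto
  finally show "coeff (Ch P) m = coeff ((power_sum 1 - 1) * monomial_sum + 1) m" .
qed

section \<open>The operad of vectors of sum zero\<close>

text \<open>Vectors in \<open>\<rat>\<^bsup>n+1\<^esup>\<close> of sum zero, extended by zero to all of \<open>\<nat>\<close>. The first \<open>n\<close> entries are the
  coordinates with respect to the basis \<open>v\<^sub>i - v\<^bsub>n+1\<^esub>\<close>, which is \<open>basis_vec n i\<close>.\<close>

definition vecs :: "nat \<Rightarrow> (nat \<Rightarrow> rat) set" where
  "vecs n = {v. (\<forall>i. i \<notin> {1..n + 1} \<longrightarrow> v i = 0) \<and> (\<Sum>i\<in>{1..n + 1}. v i) = 0}"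

definition basis_vec :: "nat \<Rightarrow> nat \<Rightarrow> nat \<Rightarrow> rat" where
  "basis_vec n i j = (if j = i then 1 else 0) - (if j = n + 1 then 1 else 0)"

text \<open>The composition at place \<open>k\<close>, where \<open>n\<close> is the arity of \<open>g\<close>. The factor \<open>- g (n + 1)\<close> is the sum of the
  first \<open>n\<close> entries of \<open>g\<close>; written in this way the formula commutes with rotations.\<close>

definition vcirc :: "nat \<Rightarrow> nat \<Rightarrow> (nat \<Rightarrow> rat) \<Rightarrow> (nat \<Rightarrow> rat) \<Rightarrow> nat \<Rightarrow> rat" where
  "vcirc n k f g p =
     (if p < k then - g (n + 1) * f p
      else if p < k + n then f k * g (p + 1 - k)
      else - g (n + 1) * f (p + 1 - n))"

definition vact :: "(nat \<Rightarrow> nat) \<Rightarrow> (nat \<Rightarrow> rat) \<Rightarrow> nat \<Rightarrow> rat" where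
  "vact \<sigma> v = v \<circ> inv \<sigma>"

lemma vecs_0: "v \<in> vecs n \<Longrightarrow> i \<notin> {1..n + 1} \<Longrightarrow> v i = 0"
  by (simp add: vecs_def)

lemma vecs_last: "v \<in> vecs n \<Longrightarrow> v (n + 1) = - (\<Sum>i\<in>{1..n}. v i)"
  by (simp add: vecs_def algebra_simps)

lemma vecs_eqI:
  assumes "v \<in> vecs n" "w \<in> vecs n" "\<And>i. i \<in> {1..n} \<Longrightarrow> v i = w i"
  shows "v = w"
proof
  fix i
  consider "i \<in> {1..n}" | "i = n + 1" | "i \<notin> {1..n + 1}" by fastforce
  then show "v i = w i"
  proof cases
    case 2
    have "(\<Sum>i\<in>{1..n}. v i) = (\<Sum>i\<in>{1..n}. w i)" using assms(3) by (rule sum.cong[OF refl])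
    then show ?thesis using 2 vecs_last assms(1,2) by metis
  qed (use assms vecs_0 in metis)+
qed

lemma basis_vec_vecs: "i \<in> {1..n} \<Longrightarrow> basis_vec n i \<in> vecs n"
  by (auto simp: vecs_def basis_vec_def sum_subtractf)

lemma vecs_zero: "(\<lambda>_. 0) \<in> vecs n"
  by (simp add: vecs_def)

lemma vecs_add: "v \<in> vecs n \<Longrightarrow> w \<in> vecs n \<Longrightarrow> (\<lambda>i. v i + w i) \<in> vecs n"
  by (simp add: vecs_def sum.distrib add_eq_0_iff algebra_simps)

lemma vecs_scale: "v \<in> vecs n \<Longrightarrow> (\<lambda>i. a * v i) \<in> vecs n"
  unfolding vecs_def by (simp add: sum_distrib_left[symmetric] distrib_left[symmetric] del: sum.cl_ivl_Suc)

lemma vact_apply: "bij \<sigma> \<Longrightarrow> vact \<sigma> v (\<sigma> i) = v i"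
  by (simp add: vact_def bij_is_inj)

text \<open>Verifying an action on \<open>\<sigma> i\<close> avoids computing the inverse permutation.\<close>

lemma vact_eqI: "bij \<sigma> \<Longrightarrow> (\<And>i. w (\<sigma> i) = v i) \<Longrightarrow> vact \<sigma> v = w"
  unfolding vact_def comp_def by (rule ext) (metis bij_inv_eq_iff)

lemma vact_vecs:
  assumes \<sigma>: "\<sigma> permutes {1..n + 1}" and v: "v \<in> vecs n"
  shows "vact \<sigma> v \<in> vecs n"
proof -
  have inv: "inv \<sigma> permutes {1..n + 1}" using \<sigma> by (rule permutes_inv)
  have "(\<Sum>i\<in>{1..n + 1}. v (inv \<sigma> i)) = (\<Sum>i\<in>{1..n + 1}. v i)"
    using sum.permute[OF inv, of v] by (simp add: comp_def)
  moreover have "v (inv \<sigma> i) = 0" if "i \<notin> {1..n + 1}" for i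
    using vecs_0[OF v that] permutes_not_in[OF inv that] by simp
  ultimately show ?thesis
    using v unfolding vecs_def vact_def mem_Collect_eq comp_apply by (simp del: sum.cl_ivl_Suc)
qed

lemma vact_id: "vact id v = v"
  by (simp add: vact_def)

lemma vact_comp: "bij \<sigma> \<Longrightarrow> bij \<rho> \<Longrightarrow> vact (\<sigma> \<circ> \<rho>) v = vact \<sigma> (vact \<rho> v)"
  by (simp add: vact_def o_inv_distrib comp_assoc)

lemma long_cycle_permutes: "long_cycle n permutes {1..n + 1}"
proof (rule bij_imp_permutes)
  show "bij_betw (long_cycle n) {1..n + 1} {1..n + 1}"
    by (rule bij_betw_byWitness[where f' = "\<lambda>i. if i = n + 1 then 1 else i + 1"])
      (auto simp: long_cycle_def)
qed (auto simp: long_cycle_def)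

lemma vact_long_cycle:
  "vact (long_cycle n) v i = (if i \<in> {1..n} then v (i + 1) else if i = n + 1 then v 1 else v i)"
proof -
  have "vact (long_cycle n) v = (\<lambda>i. if i \<in> {1..n} then v (i + 1) else if i = n + 1 then v 1 else v i)"
    by (rule vact_eqI[OF permutes_bij[OF long_cycle_permutes]]) (auto simp: long_cycle_def)
  then show ?thesis by simp
qed

lemma vcirc_vecs:
  assumes "1 \<le> k" "k \<le> m" "1 \<le> n" and f: "f \<in> vecs m" and g: "g \<in> vecs n"
  shows "vcirc n k f g \<in> vecs (m + n - 1)"
proof -
  let ?h = "vcirc n k f g"
  have out: "?h i = 0" if "i \<notin> {1..m + n - 1 + 1}" for i
  proof -
    have "i < k \<Longrightarrow> i = 0" "\<not> i < k \<Longrightarrow> \<not> i < k + n \<and> i + 1 - n \<notin> {1..m + 1}"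
      using that assms(1-3) by auto
    moreover have "f 0 = 0" by (rule vecs_0[OF f]) simp
    ultimately show ?thesis using vecs_0[OF f] by (auto simp: vcirc_def)
  qed
  have split: "{1..m + n - 1 + 1} = {1..<k} \<union> ({k..<k + n} \<union> {k + n..<m + n + 1})"
    using assms(1-3) by auto
  have "(\<Sum>i\<in>{1..m + n - 1 + 1}. ?h i) =
      (\<Sum>i\<in>{1..<k}. ?h i) + ((\<Sum>i\<in>{k..<k + n}. ?h i) + (\<Sum>i\<in>{k + n..<m + n + 1}. ?h i))"
    unfolding split by (subst sum.union_disjoint; (subst sum.union_disjoint)?; auto)
  also have "(\<Sum>i\<in>{1..<k}. ?h i) = - g (n + 1) * (\<Sum>i\<in>{1..<k}. f i)"
    by (simp add: vcirc_def sum_distrib_left)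
  also have "(\<Sum>i\<in>{k..<k + n}. ?h i) = f k * (\<Sum>i\<in>{1..n}. g i)"
    unfolding sum_distrib_left
    by (rule sum.reindex_bij_witness[of _ "\<lambda>i. i + k - 1" "\<lambda>i. i + 1 - k"])
      (use assms(1) in \<open>auto simp: vcirc_def\<close>)
  also have "(\<Sum>i\<in>{1..n}. g i) = - g (n + 1)" using vecs_last[OF g] by simp
  also have "(\<Sum>i\<in>{k + n..<m + n + 1}. ?h i) = - g (n + 1) * (\<Sum>i\<in>{k + 1..m + 1}. f i)"
    unfolding sum_distrib_left
    by (rule sum.reindex_bij_witness[of _ "\<lambda>i. i + n - 1" "\<lambda>i. i + 1 - n"])
      (use assms(1,3) in \<open>auto simp: vcirc_def\<close>)
  also have "- g (n + 1) * (\<Sum>i\<in>{1..<k}. f i) + (f k * - g (n + 1) + - g (n + 1) * (\<Sum>i\<in>{k + 1..m + 1}. f i))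
      = - g (n + 1) * ((\<Sum>i\<in>{1..<k}. f i) + (f k + (\<Sum>i\<in>{k + 1..m + 1}. f i)))"
    by (simp add: algebra_simps del: sum.cl_ivl_Suc)
  also have "(\<Sum>i\<in>{1..<k}. f i) + (f k + (\<Sum>i\<in>{k + 1..m + 1}. f i)) = (\<Sum>i\<in>{1..m + 1}. f i)"
  proof -
    have "{1..m + 1} = {1..<k} \<union> insert k {k + 1..m + 1}" using assms(1,2) by auto
    then have "(\<Sum>i\<in>{1..m + 1}. f i) = (\<Sum>i\<in>{1..<k}. f i) + (\<Sum>i\<in>insert k {k + 1..m + 1}. f i)"
      by (simp only:) (rule sum.union_disjoint, auto)
    then show ?thesis by (simp del: sum.cl_ivl_Suc)
  qed
  also have "\<dots> = 0" using f by (simp add: vecs_def)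
  finally show ?thesis using out unfolding vecs_def by simp
qed

lemma vcirc_add_left: "vcirc n k (\<lambda>i. f i + f' i) g p = vcirc n k f g p + vcirc n k f' g p"
  and vcirc_add_right: "vcirc n k f (\<lambda>i. g i + g' i) p = vcirc n k f g p + vcirc n k f g' p"
  and vcirc_scale_left: "vcirc n k (\<lambda>i. a * f i) g p = a * vcirc n k f g p"
  and vcirc_scale_right: "vcirc n k f (\<lambda>i. a * g i) p = a * vcirc n k f g p"
  by (simp_all add: vcirc_def algebra_simps)

lemma vcirc_sum:
  "vcirc n k (\<lambda>i. \<Sum>w\<in>A. F w i) (\<lambda>i. \<Sum>v\<in>B. G v i) p = (\<Sum>w\<in>A. \<Sum>v\<in>B. vcirc n k (F w) (G v) p)"
  by (simp add: vcirc_def sum_product sum_negf sum.swap[of _ B A] mult.commute)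

lemma vcirc_unit_left:
  assumes "f \<in> vecs n"
  shows "vcirc n 1 (basis_vec 1 1) f = f"
proof
  fix p
  have "f 0 = 0" "p > n + 1 \<Longrightarrow> f p = 0" using vecs_0[OF assms] by auto
  then show "vcirc n 1 (basis_vec 1 1) f p = f p"
    by (cases "p = n + 1") (auto simp: vcirc_def basis_vec_def)
qed

lemma vcirc_unit_right: "vcirc 1 k f (basis_vec 1 1) = f"
  by (rule ext) (auto simp: vcirc_def basis_vec_def less_Suc_eq)

lemma vcirc_seq_assoc:
  assumes "1 \<le> i" "1 \<le> j" "j \<le> m" "1 \<le> n"
  shows "vcirc n (i - 1 + j) (vcirc m i f g) h = vcirc (m + n - 1) i f (vcirc n j g h)"
proof
  fix p
  have e: "i - 1 + j + n = i + (j + n - 1)" using assms by simp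
  consider "p < i" | "i \<le> p" "p < i - 1 + j" | "i - 1 + j \<le> p" "p < i - 1 + j + n"
    | "i - 1 + j + n \<le> p" "p < i + (m + n - 1)" | "i + (m + n - 1) \<le> p" by linarith
  then show "vcirc n (i - 1 + j) (vcirc m i f g) h p = vcirc (m + n - 1) i f (vcirc n j g h) p"
  proof cases
    case 1
    then have "p < i - 1 + j" using assms by auto
    then show ?thesis using 1 assms by (simp add: vcirc_def)
  next
    case 2
    then have "p < i + (m + n - 1)" "p < i + m" "p + 1 - i < j" using assms by auto
    then show ?thesis using 2 assms by (simp add: vcirc_def)
  next
    case 3
    then have "p < i + (m + n - 1)" "\<not> p + 1 - i < j" "p + 1 - i < j + n" "\<not> i - 1 + j < i" "i - 1 + j < i + m"
      "\<not> p < i" "i - 1 + j + 1 - i = j" "p + 1 - (i - 1 + j) = p + 1 - i + 1 - j"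
      using assms by auto
    then show ?thesis using 3 assms unfolding vcirc_def by (simp only: if_True if_False) simp
  next
    case 4
    then have "\<not> p + 1 - i < j" "\<not> p + 1 - i < j + n" "\<not> p < i"
      "\<not> p + 1 - n < i" "p + 1 - n < i + m" "p + 1 - i + 1 - n = p + 1 - n + 1 - i" "\<not> p < i - 1 + j"
      using assms by auto
    then show ?thesis using 4 assms unfolding vcirc_def by simp
  next
    case 5
    then have "\<not> p < i" "\<not> p + 1 - n < i" "\<not> p + 1 - n < i + m" "\<not> m + n - 1 + 1 < j"
      "\<not> m + n - 1 + 1 < j + n" "p + 1 - (m + n - 1) = p + 1 - n + 1 - m" "m + n - 1 + 1 + 1 - n = m + 1"
      "\<not> p < i - 1 + j" "\<not> p < i - 1 + j + n"
      using assms by auto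
    then show ?thesis using 5 assms unfolding vcirc_def by (simp only: if_True if_False) simp
  qed
qed

lemma vcirc_par_assoc:
  assumes "1 \<le> i" "i < k" "1 \<le> m" "1 \<le> n"
  shows "vcirc n (k - 1 + m) (vcirc m i f g) h = vcirc m i (vcirc n k f h) g"
proof
  fix p
  have k: "\<not> k - 1 + m < i" "\<not> k - 1 + m < i + m" "k - 1 + m + 1 - m = k" using assms by auto
  consider "p < i" | "i \<le> p" "p < i + m" | "i + m \<le> p" "p < k - 1 + m" | "k - 1 + m \<le> p" "p < k - 1 + m + n"
    | "k - 1 + m + n \<le> p" by linarith
  then show "vcirc n (k - 1 + m) (vcirc m i f g) h p = vcirc m i (vcirc n k f h) g p"
  proof cases
    case 1
    then have "p < k - 1 + m" "p < k" using assms by auto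
    then show ?thesis using 1 by (simp add: vcirc_def)
  next
    case 2
    then have "p < k - 1 + m" using assms by auto
    then show ?thesis using 2 assms by (simp add: vcirc_def)
  next
    case 3
    then have "p + 1 - m < k" "\<not> p < i" using assms by auto
    then show ?thesis using 3 by (simp add: vcirc_def)
  next
    case 4
    then have "\<not> p < i" "\<not> p < i + m" "\<not> p + 1 - m < k" "p + 1 - m < k + n"
      "p + 1 - (k - 1 + m) = p + 1 - m + 1 - k" using assms by auto
    then show ?thesis using 4 k unfolding vcirc_def by simp
  next
    case 5
    then have "\<not> p < i" "\<not> p < i + m" "\<not> p + 1 - m < k" "\<not> p + 1 - m < k + n"
      "\<not> p < k - 1 + m" "\<not> p + 1 - n < i" "\<not> p + 1 - n < i + m"
      "p + 1 - n + 1 - m = p + 1 - m + 1 - n" "\<not> p < k - 1 + m + n" using assms by auto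
    then show ?thesis using k by (simp only: vcirc_def if_False) simp
  qed
qed

text \<open>Rotation moves the block inserted for \<open>f\<^sub>k\<close> one step to the left.\<close>

lemma vcirc_rotate:
  assumes k: "2 \<le> k" "k \<le> m" and n: "1 \<le> n"
  shows "vact (long_cycle (m + n - 1)) (vcirc n k f g) = vcirc n (k - 1) (vact (long_cycle m) f) g"
proof (rule vact_eqI[OF permutes_bij[OF long_cycle_permutes]])
  fix p
  consider "p = 0" | "p = 1" | "2 \<le> p" "p < k" | "k \<le> p" "p < k + n" | "k + n \<le> p" "p \<le> m + n" | "m + n < p"
    by linarith
  then show "vcirc n (k - 1) (vact (long_cycle m) f) g (long_cycle (m + n - 1) p) = vcirc n k f g p"
  proof cases
    case 2
    then have "long_cycle (m + n - 1) p = m + n" "\<not> m + n < k - 1" "\<not> m + n < k - 1 + n"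
      "m + n + 1 - n = m + 1" "p < k" "m + 1 \<notin> {1..m}"
      using k n by (auto simp: long_cycle_def)
    then show ?thesis using 2 by (simp only: vcirc_def vact_long_cycle if_True if_False simp_thms)
  next
    case 4
    then have "long_cycle (m + n - 1) p = p - 1" "\<not> p - 1 < k - 1" "p - 1 < k - 1 + n"
      "p - 1 + 1 - (k - 1) = p + 1 - k" "k - 1 \<in> {1..m}" "k - 1 + 1 = k"
      using k n by (auto simp: long_cycle_def)
    then show ?thesis using 4 by (simp only: vcirc_def vact_long_cycle if_True if_False) simp
  next
    case 5
    then have "long_cycle (m + n - 1) p = p - 1" "\<not> p - 1 < k - 1" "\<not> p - 1 < k - 1 + n"
      "p - 1 + 1 - n = p - n" "p - n \<in> {1..m}" "\<not> p < k" "\<not> p < k + n" "p - n + 1 = p + 1 - n"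
      using k n by (auto simp: long_cycle_def)
    then show ?thesis by (simp only: vcirc_def vact_long_cycle if_True if_False)
  next
    case 6
    then have "long_cycle (m + n - 1) p = p" "\<not> p < k - 1" "\<not> p < k - 1 + n"
      "p + 1 - n \<notin> {1..m}" "p + 1 - n \<noteq> m + 1" "\<not> p < k" "\<not> p < k + n"
      using k n by (auto simp: long_cycle_def)
    then show ?thesis by (simp only: vcirc_def vact_long_cycle if_True if_False)
  qed (use k n in \<open>auto simp: vcirc_def vact_long_cycle long_cycle_def\<close>)
qed

text \<open>Both sides combine the entries of \<open>f\<close> and \<open>g\<close> into one cyclic sequence. On the left \<open>g\<close> is inserted
  into \<open>f\<close> with the factor \<open>f\<^sub>1\<close>, and the rest of \<open>f\<close> is scaled by \<open>- g\<^bsub>n+1\<^esub>\<close>. On the right \<open>f\<close> is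
  inserted into \<open>g\<close> with the factor \<open>g\<^bsub>n+1\<^esub>\<close>, and the rest of \<open>g\<close> is scaled by \<open>- f\<^sub>1\<close>; hence the sign.\<close>

lemma vcirc_rotate_first:
  assumes m: "1 \<le> m" and n: "1 \<le> n" and f: "f \<in> vecs m" and g: "g \<in> vecs n"
  shows "vact (long_cycle (m + n - 1)) (vcirc n 1 f g) =
    (\<lambda>p. - vcirc m n (vact (long_cycle n) g) (vact (long_cycle m) f) p)"
proof (rule vact_eqI[OF permutes_bij[OF long_cycle_permutes]])
  fix p
  have fg: "f 0 = 0" "g 0 = 0" using vecs_0 f g by auto
  consider "p = 0" | "p = 1" | "2 \<le> p" "p \<le> n" | "n < p" "p \<le> m + n" | "m + n < p"
    by linarith
  then show "- vcirc m n (vact (long_cycle n) g) (vact (long_cycle m) f) (long_cycle (m + n - 1) p) = vcirc n 1 f g p"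
  proof cases
    case 1
    then show ?thesis using n fg by (simp add: vcirc_def vact_long_cycle long_cycle_def)
  next
    case 2
    then show ?thesis using m n by (simp add: vcirc_def vact_long_cycle long_cycle_def)
  next
    case 3
    then show ?thesis using m n by (auto simp: vcirc_def vact_long_cycle long_cycle_def)
  next
    case 4
    then have "long_cycle (m + n - 1) p = p - 1" "\<not> p - 1 < n" "p - 1 < n + m" "p - 1 + 1 - n = p - n"
      "p - n \<in> {1..m}" "n \<in> {1..n}" "\<not> p < 1" "\<not> p < 1 + n" "p - n + 1 = p + 1 - n"
      using m n by (auto simp: long_cycle_def)
    then show ?thesis by (simp only: vcirc_def vact_long_cycle if_True if_False simp_thms)
  next
    case 5
    then have "f (p + 1 - n) = 0" "vact (long_cycle n) g (p + 1 - m) = 0"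
      using 5 by (auto intro!: vecs_0[OF f] vecs_0[OF vact_vecs[OF long_cycle_permutes g]])
    moreover have "long_cycle (m + n - 1) p = p" "\<not> p < 1" "\<not> p < 1 + n" "\<not> p < n" "\<not> p < n + m"
      using 5 m n by (auto simp: long_cycle_def)
    ultimately show ?thesis by (simp only: vcirc_def if_False)
  qed
qed

text \<open>Positions inside the inserted block go to the block that begins at \<open>\<sigma> k\<close>, the others go injectively
  to its complement.\<close>

lemma block_perm_permutes:
  assumes k: "1 \<le> k" "k \<le> m" and n: "1 \<le> n" and \<sigma>: "\<sigma> permutes {1..m}" and \<rho>: "\<rho> permutes {1..n}"
  shows "block_perm n k \<sigma> \<rho> permutes {1..m + n - 1}"
proof (rule bij_imp_permutes)
  let ?b = "block_perm n k \<sigma> \<rho>"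
  have \<sigma>in: "\<sigma> i \<in> {1..m} \<longleftrightarrow> i \<in> {1..m}" for i using permutes_in_image[OF \<sigma>] .
  have \<rho>in: "\<rho> i \<in> {1..n} \<longleftrightarrow> i \<in> {1..n}" for i using permutes_in_image[OF \<rho>] .
  have \<sigma>eq: "\<sigma> i = \<sigma> j \<longleftrightarrow> i = j" for i j using permutes_inj[OF \<sigma>] by (auto dest: injD)
  have \<rho>eq: "\<rho> i = \<rho> j \<longleftrightarrow> i = j" for i j using permutes_inj[OF \<rho>] by (auto dest: injD)
  define s where "s a = (if a > \<sigma> k then a + n - 1 else a)" for a
  have \<sigma>k: "1 \<le> \<sigma> k" "\<sigma> k \<le> m" using \<sigma>in[of k] k by auto
  have s: "s a = s b \<longleftrightarrow> a = b" "s a \<notin> {\<sigma> k..<\<sigma> k + n}" "1 \<le> a \<Longrightarrow> 1 \<le> s a" "a \<le> m \<Longrightarrow> s a \<le> m + n - 1"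
    if "a \<noteq> \<sigma> k" "b \<noteq> \<sigma> k" for a b
    using that n \<sigma>k by (auto simp: s_def split: if_splits)
  have b: "?b p = (if p < k then s (\<sigma> p) else if p < k + n then \<sigma> k - 1 + \<rho> (p + 1 - k) else s (\<sigma> (p + 1 - n)))" for p
    by (simp add: block_perm_def s_def Let_def)
  have mid: "?b p \<in> {\<sigma> k..<\<sigma> k + n}" if "k \<le> p" "p < k + n" for p
    using \<rho>in[of "p + 1 - k"] that \<sigma>k by (auto simp: b)
  have "?b ` {1..m + n - 1} \<subseteq> {1..m + n - 1}"
  proof clarify
    fix p assume p: "p \<in> {1..m + n - 1}"
    show "?b p \<in> {1..m + n - 1}"
    proof (cases "k \<le> p \<and> p < k + n")
      case True
      then show ?thesis using mid[of p] \<sigma>k n by auto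
    next
      case False
      define q where "q = (if p < k then p else p + 1 - n)"
      have "q \<in> {1..m}" "q \<noteq> k" using False p k n by (auto simp: q_def split: if_splits)
      moreover have "?b p = s (\<sigma> q)" using False by (auto simp: b q_def)
      ultimately show ?thesis using s[of "\<sigma> q" "\<sigma> q"] \<sigma>in[of q] \<sigma>eq by auto
    qed
  qed
  moreover have "inj_on ?b {1..m + n - 1}"
  proof (rule inj_onI)
    fix p p' assume "?b p = ?b p'"
    define q where "q p = (if p < k then p else p + 1 - n)" for p
    have out: "?b p = s (\<sigma> (q p)) \<and> \<sigma> (q p) \<noteq> \<sigma> k" if "\<not> (k \<le> p \<and> p < k + n)" for p
      using that n by (auto simp: b q_def \<sigma>eq)
    consider "k \<le> p \<and> p < k + n" "k \<le> p' \<and> p' < k + n"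
      | "\<not> (k \<le> p \<and> p < k + n)" "k \<le> p' \<and> p' < k + n"
      | "k \<le> p \<and> p < k + n" "\<not> (k \<le> p' \<and> p' < k + n)"
      | "\<not> (k \<le> p \<and> p < k + n)" "\<not> (k \<le> p' \<and> p' < k + n)" by blast
    then show "p = p'"
    proof cases
      case 1
      then have "\<rho> (p + 1 - k) = \<rho> (p' + 1 - k)" using \<open>?b p = ?b p'\<close> by (simp add: b)
      then have "p + 1 - k = p' + 1 - k" by (simp only: \<rho>eq)
      then show ?thesis using 1 by linarith
    next
      case 2
      then show ?thesis using out[of p] mid[of p'] s(2)[of "\<sigma> (q p)" "\<sigma> (q p)"] \<open>?b p = ?b p'\<close> by simp
    next
      case 3
      then show ?thesis using out[of p'] mid[of p] s(2)[of "\<sigma> (q p')" "\<sigma> (q p')"] \<open>?b p = ?b p'\<close> by simp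
    next
      case 4
      have "\<sigma> (q p) = \<sigma> (q p')"
        using out[OF 4(1)] out[OF 4(2)] s(1)[of "\<sigma> (q p)" "\<sigma> (q p')"] \<open>?b p = ?b p'\<close> by metis
      then have "q p = q p'" by (simp only: \<sigma>eq)
      moreover have "p < k \<or> p \<ge> k + n" "p' < k \<or> p' \<ge> k + n" using 4 by auto
      ultimately show ?thesis using n unfolding q_def by (elim disjE; simp split: if_splits; linarith)
    qed
  qed
  ultimately show "bij_betw ?b {1..m + n - 1} {1..m + n - 1}"
    by (simp add: bij_betw_def endo_inj_surj)
  fix p assume p: "p \<notin> {1..m + n - 1}"
  show "?b p = p"
  proof (cases "p = 0")
    case True
    then show ?thesis using k \<sigma>k permutes_not_in[OF \<sigma>, of 0] by (simp add: b s_def)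
  next
    case False
    then have "\<not> p < k" "\<not> p < k + n" "p + 1 - n \<notin> {1..m}" "p + 1 - n > \<sigma> k"
      using p k n \<sigma>k by auto
    then show ?thesis using permutes_not_in[OF \<sigma>, of "p + 1 - n"] p n False by (simp add: b s_def)
  qed
qed

lemma vcirc_equivariant:
  assumes k: "1 \<le> k" "k \<le> m" and n: "1 \<le> n" and \<sigma>: "\<sigma> permutes {1..m}" and \<rho>: "\<rho> permutes {1..n}"
  shows "vcirc n (\<sigma> k) (vact \<sigma> f) (vact \<rho> g) = vact (block_perm n k \<sigma> \<rho>) (vcirc n k f g)"
proof (rule vact_eqI[OF permutes_bij[OF block_perm_permutes[OF assms]], symmetric])
  fix p
  let ?h = "vcirc n (\<sigma> k) (vact \<sigma> f) (vact \<rho> g)"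
  have \<sigma>b: "bij \<sigma>" and \<rho>b: "bij \<rho>" using \<sigma> \<rho> permutes_bij by auto
  have \<sigma>eq: "\<sigma> i = \<sigma> j \<longleftrightarrow> i = j" for i j using permutes_inj[OF \<sigma>] by (auto dest: injD)
  have last: "vact \<rho> g (n + 1) = g (n + 1)"
    using vact_apply[OF \<rho>b, of g "n + 1"] permutes_not_in[OF \<rho>, of "n + 1"] by simp
  have \<sigma>k: "1 \<le> \<sigma> k" using permutes_in_image[OF \<sigma>, of k] k by auto
  have out: "?h (if \<sigma> q > \<sigma> k then \<sigma> q + n - 1 else \<sigma> q) = - g (n + 1) * f q" if "q \<noteq> k" for q
  proof (cases "\<sigma> q > \<sigma> k")
    case True
    then have "\<not> \<sigma> q + n - 1 < \<sigma> k" "\<not> \<sigma> q + n - 1 < \<sigma> k + n" "\<sigma> q + n - 1 + 1 - n = \<sigma> q"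
      using n by auto
    then show ?thesis using True by (simp only: vcirc_def last vact_apply[OF \<sigma>b] if_True if_False)
  next
    case False
    then have "\<sigma> q < \<sigma> k" using \<sigma>eq[of q k] that by linarith
    then show ?thesis using False by (simp only: vcirc_def last vact_apply[OF \<sigma>b] if_True if_False)
  qed
  show "?h (block_perm n k \<sigma> \<rho> p) = vcirc n k f g p"
  proof (cases "k \<le> p \<and> p < k + n")
    case True
    then have "\<rho> (p + 1 - k) \<in> {1..n}" using permutes_in_image[OF \<rho>, of "p + 1 - k"] by auto
    then have "\<not> \<sigma> k - 1 + \<rho> (p + 1 - k) < \<sigma> k" "\<sigma> k - 1 + \<rho> (p + 1 - k) < \<sigma> k + n"
      "\<sigma> k - 1 + \<rho> (p + 1 - k) + 1 - \<sigma> k = \<rho> (p + 1 - k)" using \<sigma>k by auto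
    moreover have "block_perm n k \<sigma> \<rho> p = \<sigma> k - 1 + \<rho> (p + 1 - k)" using True by (simp add: block_perm_def)
    moreover have "\<not> p < k" "p < k + n" using True by auto
    ultimately show ?thesis
      by (simp only: vcirc_def vact_apply[OF \<sigma>b] vact_apply[OF \<rho>b] if_True if_False)
  next
    case False
    define q where "q = (if p < k then p else p + 1 - n)"
    have "q \<noteq> k" using False n by (auto simp: q_def)
    moreover have "block_perm n k \<sigma> \<rho> p = (if \<sigma> q > \<sigma> k then \<sigma> q + n - 1 else \<sigma> q)"
      using False by (auto simp: block_perm_def q_def)
    moreover have "vcirc n k f g p = - g (n + 1) * f q" using False by (auto simp: vcirc_def q_def)
    ultimately show ?thesis using out by simp
  qed
qed

lemma vact_long_cycle_power:
  assumes "j \<in> {1..n + 1}"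
  shows "(vact (long_cycle n) ^^ k) v j = v ((j - 1 + k) mod (n + 1) + 1)"
  using assms
proof (induction k arbitrary: j)
  case (Suc k)
  define j' where "j' = j mod (n + 1) + 1"
  have j': "j' \<in> {1..n + 1}" using mod_less_divisor[of "n + 1" j] unfolding j'_def by auto
  have "vact (long_cycle n) w j = w j'" for w
  proof (cases "j = n + 1")
    case False
    then have "j \<in> {1..n}" "j' = j + 1" using Suc.prems by (auto simp: j'_def)
    then show ?thesis by (simp add: vact_long_cycle)
  qed (simp add: vact_long_cycle j'_def)
  then have "(vact (long_cycle n) ^^ Suc k) v j = v ((j' - 1 + k) mod (n + 1) + 1)"
    using Suc.IH[OF j'] by simp
  also have "(j' - 1 + k) mod (n + 1) = (j - 1 + Suc k) mod (n + 1)"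
    using Suc.prems by (simp add: j'_def mod_add_left_eq)
  finally show ?case .
next
  case 0
  then have "(j - 1 + 0) mod (n + 1) + 1 = j" by (subst mod_less) auto
  then show ?case by simp
qed

subsection \<open>Operads with coordinates in these vectors\<close>

text \<open>A non-symmetric operad with coordinates in the vectors of sum zero. As the coordinates are injective
  on each component, every identity between compositions follows from the corresponding identity for \<open>vcirc\<close>.
  \<open>Dias\<close> and \<open>Perm\<close> are both of this kind.\<close>

locale vector_model =
  fixes P :: "('a::rat_vector, 'z) ns_op_scheme"
    and c :: "nat \<Rightarrow> 'a \<Rightarrow> nat \<Rightarrow> rat" and e :: "nat \<Rightarrow> nat \<Rightarrow> 'a"
  assumes subspace: "ratv.subspace (Comp P n)"
    and coord_add: "x \<in> Comp P n \<Longrightarrow> y \<in> Comp P n \<Longrightarrow> c n (x + y) i = c n x i + c n y i"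
    and coord_scale: "x \<in> Comp P n \<Longrightarrow> c n (a *\<^sub>Q x) i = a * c n x i"
    and coord_vecs: "x \<in> Comp P n \<Longrightarrow> c n x \<in> vecs n"
    and coord_inj: "x \<in> Comp P n \<Longrightarrow> c n x = (\<lambda>_. 0) \<Longrightarrow> x = 0"
    and basis_Comp: "i \<in> {1..n} \<Longrightarrow> e n i \<in> Comp P n"
    and coord_basis: "i \<in> {1..n} \<Longrightarrow> c n (e n i) = basis_vec n i"
    and unit_Comp: "Unit P \<in> Comp P 1"
    and coord_unit: "c 1 (Unit P) = basis_vec 1 1"
    and circ_Comp: "1 \<le> k \<Longrightarrow> k \<le> m \<Longrightarrow> 1 \<le> n \<Longrightarrow> f \<in> Comp P m \<Longrightarrow> g \<in> Comp P n \<Longrightarrow>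
      Circ P k f g \<in> Comp P (m + n - 1)"
    and coord_circ: "1 \<le> k \<Longrightarrow> k \<le> m \<Longrightarrow> 1 \<le> n \<Longrightarrow> f \<in> Comp P m \<Longrightarrow> g \<in> Comp P n \<Longrightarrow>
      c (m + n - 1) (Circ P k f g) = vcirc n k (c m f) (c n g)"
begin

lemma add_Comp: "x \<in> Comp P n \<Longrightarrow> y \<in> Comp P n \<Longrightarrow> x + y \<in> Comp P n"
  and scale_Comp: "x \<in> Comp P n \<Longrightarrow> a *\<^sub>Q x \<in> Comp P n"
  and neg_Comp: "x \<in> Comp P n \<Longrightarrow> - x \<in> Comp P n"
  using subspace ratv.subspace_add ratv.subspace_scale ratv.subspace_neg by blast+

lemma coord_zero: "c n 0 i = 0"
  using coord_scale[of 0 n 0 i] ratv.subspace_0[OF subspace] by simp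

lemma coord_neg: "x \<in> Comp P n \<Longrightarrow> c n (- x) i = - c n x i"
  using coord_scale[of x n "-1" i] by (simp add: ratv.scale_minus_left scaleQ_one)

lemma coord_eqI:
  assumes "x \<in> Comp P n" "y \<in> Comp P n" "\<And>i. c n x i = c n y i"
  shows "x = y"
proof -
  have "c n (x + - y) = (\<lambda>_. 0)"
    using coord_add[OF assms(1) neg_Comp[OF assms(2)]] coord_neg[OF assms(2)] assms(3) by (intro ext) simp
  then have "x + - y = 0" using assms by (intro coord_inj add_Comp neg_Comp)
  then show ?thesis by simp
qed

lemma coord_sum:
  assumes "\<And>i. i \<in> A \<Longrightarrow> x i \<in> Comp P n"
  shows "c n (\<Sum>i\<in>A. x i) j = (\<Sum>i\<in>A. c n (x i) j)"
  using assms
proof (induction A rule: infinite_finite_induct)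
  case (insert a A)
  then show ?case by (simp add: coord_add ratv.subspace_sum[OF subspace])
qed (simp_all add: coord_zero)

definition of_vec :: "nat \<Rightarrow> (nat \<Rightarrow> rat) \<Rightarrow> 'a" where
  "of_vec n v = (\<Sum>i\<in>{1..n}. v i *\<^sub>Q e n i)"

lemma of_vec_Comp: "of_vec n v \<in> Comp P n"
  unfolding of_vec_def by (intro ratv.subspace_sum[OF subspace] scale_Comp basis_Comp)

lemma coord_of_vec:
  assumes "v \<in> vecs n"
  shows "c n (of_vec n v) = v"
proof (rule vecs_eqI[OF coord_vecs[OF of_vec_Comp] assms])
  fix j assume j: "j \<in> {1..n}"
  have "c n (of_vec n v) j = (\<Sum>i\<in>{1..n}. v i * basis_vec n i j)"
    unfolding of_vec_def by (subst coord_sum) (auto simp: scale_Comp basis_Comp coord_scale coord_basis)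
  also have "\<dots> = (\<Sum>i\<in>{1..n}. if j = i then v i else 0)"
    using j by (intro sum.cong) (auto simp: basis_vec_def)
  also have "\<dots> = v j" using j by simp
  finally show "c n (of_vec n v) j = v j" .
qed

lemma expand: "x \<in> Comp P n \<Longrightarrow> x = (\<Sum>i\<in>{1..n}. c n x i *\<^sub>Q e n i)"
  using coord_eqI[OF _ of_vec_Comp] coord_of_vec[OF coord_vecs] by (metis of_vec_def)

lemma is_ns_operad: "ns_operad P"
  unfolding ns_operad_def
proof (intro conjI allI impI ballI)
  fix n :: nat show "ratv.subspace (Comp P n)" by (rule subspace)
next
  show "Unit P \<in> Comp P 1" by (rule unit_Comp)
next
  fix m n k :: nat and f g
  assume *: "1 \<le> k" "k \<le> m" "1 \<le> n" "f \<in> Comp P m" "g \<in> Comp P n"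
  then show "Circ P k f g \<in> Comp P (m + n - 1)" by (rule circ_Comp)
next
  fix m n k :: nat and f
  assume k: "1 \<le> k" "k \<le> m" "1 \<le> n" and f: "f \<in> Comp P m"
  show "lin_on (Comp P n) (Circ P k f)"
    unfolding lin_on_def
    by (intro conjI ballI allI; rule coord_eqI[where n = "m + n - 1"])
      (simp_all add: circ_Comp[OF k f] add_Comp scale_Comp coord_add coord_scale coord_circ[OF k f]
        ext[OF coord_add] ext[OF coord_scale] vcirc_add_right vcirc_scale_right del: One_nat_def)
next
  fix m n k :: nat and g
  assume k: "1 \<le> k" "k \<le> m" "1 \<le> n" and g: "g \<in> Comp P n"
  show "lin_on (Comp P m) (\<lambda>f. Circ P k f g)"
    unfolding lin_on_def
    by (intro conjI ballI allI; rule coord_eqI[where n = "m + n - 1"])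
      (simp_all add: circ_Comp[OF k _ g] add_Comp scale_Comp coord_add coord_scale coord_circ[OF k _ g]
        ext[OF coord_add] ext[OF coord_scale] vcirc_add_left vcirc_scale_left del: One_nat_def)
next
  fix n :: nat and f assume n: "1 \<le> n" and f: "f \<in> Comp P n"
  have "c n (Circ P 1 (Unit P) f) = c n f"
    using coord_circ[OF order_refl order_refl n unit_Comp f] vcirc_unit_left[OF coord_vecs[OF f]]
    by (simp only: coord_unit add_diff_cancel_left')
  then show "Circ P 1 (Unit P) f = f"
    using circ_Comp[OF order_refl order_refl n unit_Comp f] f
    by (intro coord_eqI[of _ n]) (simp_all only: add_diff_cancel_left')
next
  fix n i :: nat and f assume n: "1 \<le> n" and f: "f \<in> Comp P n" and i: "i \<in> {1..n}"
  then have i: "1 \<le> i" "i \<le> n" by auto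
  have "c n (Circ P i f (Unit P)) = c n f"
    using coord_circ[OF i order_refl f unit_Comp] by (simp only: coord_unit vcirc_unit_right add_diff_cancel_right')
  then show "Circ P i f (Unit P) = f"
    using circ_Comp[OF i order_refl f unit_Comp] f
    by (intro coord_eqI[of _ n]) (simp_all only: add_diff_cancel_right')
next
  fix l m n i j :: nat and f g h
  assume l: "1 \<le> l" and m: "1 \<le> m" and n: "1 \<le> n"
    and f: "f \<in> Comp P l" and g: "g \<in> Comp P m" and h: "h \<in> Comp P n"
    and "i \<in> {1..l}" "j \<in> {1..m}"
  then have i: "1 \<le> i" "i \<le> l" and j: "1 \<le> j" "j \<le> m" by auto
  have ij: "1 \<le> i - 1 + j" "i - 1 + j \<le> l + m - 1" using i j by auto
  have mn: "1 \<le> m + n - 1" using m n by simp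
  have N: "l + m - 1 + n - 1 = l + (m + n - 1) - 1" using m n l by simp
  note fg = circ_Comp[OF i m f g] and gh = circ_Comp[OF j n g h]
  note lhs = circ_Comp[OF ij n fg h] and rhs = circ_Comp[OF i mn f gh]
  show "Circ P (i - 1 + j) (Circ P i f g) h = Circ P i f (Circ P j g h)"
  proof (rule coord_eqI[OF lhs rhs[folded N]])
    fix p
    have "c (l + m - 1 + n - 1) (Circ P i f (Circ P j g h)) = vcirc (m + n - 1) i (c l f) (vcirc n j (c m g) (c n h))"
      unfolding N coord_circ[OF i mn f gh] coord_circ[OF j n g h] ..
    then show "c (l + m - 1 + n - 1) (Circ P (i - 1 + j) (Circ P i f g) h) p =
        c (l + m - 1 + n - 1) (Circ P i f (Circ P j g h)) p"
      unfolding coord_circ[OF ij n fg h] coord_circ[OF i m f g] using vcirc_seq_assoc[OF i(1) j n] by simp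
  qed
next
  fix l m n i k :: nat and f g h
  assume l: "1 \<le> l" and m: "1 \<le> m" and n: "1 \<le> n"
    and f: "f \<in> Comp P l" and g: "g \<in> Comp P m" and h: "h \<in> Comp P n"
    and "i \<in> {1..l}" "k \<in> {i<..l}"
  then have i: "1 \<le> i" "i \<le> l" and k: "1 \<le> k" "k \<le> l" and ik: "i < k" by auto
  have km: "1 \<le> k - 1 + m" "k - 1 + m \<le> l + m - 1" using k m by auto
  have i': "i \<le> l + n - 1" using i n by simp
  have N: "l + m - 1 + n - 1 = l + n - 1 + m - 1" using m n l by simp
  note fg = circ_Comp[OF i m f g] and fh = circ_Comp[OF k n f h]
  note lhs = circ_Comp[OF km n fg h] and rhs = circ_Comp[OF i(1) i' m fh g]
  show "Circ P (k - 1 + m) (Circ P i f g) h = Circ P i (Circ P k f h) g"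
  proof (rule coord_eqI[OF lhs rhs[folded N]])
    fix p
    have "c (l + m - 1 + n - 1) (Circ P i (Circ P k f h) g) = vcirc m i (vcirc n k (c l f) (c n h)) (c m g)"
      unfolding N coord_circ[OF i(1) i' m fh g] coord_circ[OF k n f h] ..
    then show "c (l + m - 1 + n - 1) (Circ P (k - 1 + m) (Circ P i f g) h) p =
        c (l + m - 1 + n - 1) (Circ P i (Circ P k f h) g) p"
      unfolding coord_circ[OF km n fg h] coord_circ[OF i m f g] using vcirc_par_assoc[OF i(1) ik m n] by simp
  qed
qed

lemma tau_identities_rotation:
  assumes \<tau>: "\<And>n x. 1 \<le> n \<Longrightarrow> x \<in> Comp P n \<Longrightarrow> \<tau> n x \<in> Comp P n"
    and coord_\<tau>: "\<And>n x. 1 \<le> n \<Longrightarrow> x \<in> Comp P n \<Longrightarrow> c n (\<tau> n x) = vact (long_cycle n) (c n x)"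
  shows "tau_identities P \<tau>"
  unfolding tau_identities_def
proof (intro conjI allI impI ballI)
  show "\<tau> 1 (Unit P) = - Unit P"
  proof (rule coord_eqI[OF \<tau>[OF order_refl unit_Comp] neg_Comp[OF unit_Comp]])
    fix i
    show "c 1 (\<tau> 1 (Unit P)) i = c 1 (- Unit P) i"
      by (simp only: coord_neg[OF unit_Comp] coord_\<tau>[OF order_refl unit_Comp] coord_unit)
        (auto simp: vact_long_cycle basis_vec_def)
  qed
next
  fix m n k :: nat and f g
  assume m: "1 \<le> m" and n: "1 \<le> n" and f: "f \<in> Comp P m" and g: "g \<in> Comp P n" and "k \<in> {2..m}"
  then have k: "1 \<le> k" "k \<le> m" "2 \<le> k" and k': "1 \<le> k - 1" "k - 1 \<le> m" by auto
  have mn: "1 \<le> m + n - 1" using m n by simp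
  note fg = circ_Comp[OF k(1,2) n f g]
  show "\<tau> (m + n - 1) (Circ P k f g) = Circ P (k - 1) (\<tau> m f) g"
    by (rule coord_eqI[OF \<tau>[OF mn fg] circ_Comp[OF k' n \<tau>[OF m f] g]])
      (simp only: coord_\<tau>[OF mn fg] coord_circ[OF k(1,2) n f g] coord_circ[OF k' n \<tau>[OF m f] g]
        coord_\<tau>[OF m f] vcirc_rotate[OF k(3,2) n])
next
  fix m n :: nat and f g
  assume m: "1 \<le> m" and n: "1 \<le> n" and f: "f \<in> Comp P m" and g: "g \<in> Comp P n"
  have mn: "1 \<le> m + n - 1" using m n by simp
  note fg = circ_Comp[OF order_refl m n f g]
  note gf = circ_Comp[OF n order_refl m \<tau>[OF n g] \<tau>[OF m f]]
  show "\<tau> (m + n - 1) (Circ P 1 f g) = - Circ P n (\<tau> n g) (\<tau> m f)"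
    by (rule coord_eqI[OF \<tau>[OF mn fg] neg_Comp[OF gf[unfolded add.commute[of n m]]]])
      (simp only: coord_neg[OF gf[unfolded add.commute[of n m]]] coord_\<tau>[OF mn fg]
        coord_circ[OF order_refl m n f g] coord_\<tau>[OF m f] coord_\<tau>[OF n g]
        coord_circ[OF n order_refl m \<tau>[OF n g] \<tau>[OF m f], unfolded add.commute[of n m]]
        vcirc_rotate_first[OF m n coord_vecs[OF f] coord_vecs[OF g]])
qed

lemma lin_on_coord:
  assumes h: "\<And>x. x \<in> Comp P n \<Longrightarrow> h x \<in> Comp P n"
    and coord_h: "\<And>x. x \<in> Comp P n \<Longrightarrow> c n (h x) = vact \<sigma> (c n x)"
  shows "lin_on (Comp P n) h"
  unfolding lin_on_def
  by (intro conjI ballI allI; rule coord_eqI[where n = n])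
    (simp_all add: h coord_h add_Comp scale_Comp coord_add coord_scale vact_def)

lemma anticyclic_rotation:
  assumes \<tau>: "\<And>n x. 1 \<le> n \<Longrightarrow> x \<in> Comp P n \<Longrightarrow> \<tau> n x \<in> Comp P n"
    and coord_\<tau>: "\<And>n x. 1 \<le> n \<Longrightarrow> x \<in> Comp P n \<Longrightarrow> c n (\<tau> n x) = vact (long_cycle n) (c n x)"
  shows "ns_anticyclic P \<tau>"
  unfolding ns_anticyclic_def
proof (intro conjI allI impI ballI)
  show "ns_operad P" by (rule is_ns_operad)
  show "tau_identities P \<tau>" using assms by (rule tau_identities_rotation)
  fix n :: nat assume n: "n \<ge> 1"
  show "lin_on (Comp P n) (\<tau> n)"
    by (rule lin_on_coord) (use \<tau> coord_\<tau> n in auto)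
  show "\<tau> n ` Comp P n \<subseteq> Comp P n" using \<tau> n by auto
  fix x assume x: "x \<in> Comp P n"
  have pow: "(\<tau> n ^^ k) x \<in> Comp P n \<and> c n ((\<tau> n ^^ k) x) = (vact (long_cycle n) ^^ k) (c n x)" for k
    by (induction k) (use x n in \<open>auto simp: \<tau> coord_\<tau>\<close>)
  have "c n ((\<tau> n ^^ (n + 1)) x) = c n x"
  proof (rule vecs_eqI)
    show "c n ((\<tau> n ^^ (n + 1)) x) \<in> vecs n" using pow coord_vecs by blast
    show "c n x \<in> vecs n" using x by (rule coord_vecs)
    fix i assume "i \<in> {1..n}"
    then have i: "i \<in> {1..n + 1}" "(i - 1 + (n + 1)) mod (n + 1) + 1 = i"
      by (auto simp only: mod_add_self2) (auto simp: mod_less)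
    show "c n ((\<tau> n ^^ (n + 1)) x) i = c n x i"
      using pow vact_long_cycle_power[OF i(1), of "n + 1"] i(2) by metis
  qed
  then show "(\<tau> n ^^ (n + 1)) x = x"
    using pow[of "n + 1"] x by (intro coord_eqI[of _ n]) (simp_all only:)
qed

text \<open>The trace is defined by an unspecified basis \<open>B\<close>. Expanding the elements of \<open>B\<close> in the basis \<open>e n i\<close>
  and exchanging the two summations shows that the result does not depend on \<open>B\<close>.\<close>

lemma trace_on_coord:
  assumes lin: "lin_on (Comp P n) h" and closed: "h ` Comp P n \<subseteq> Comp P n"
  shows "trace_on (Comp P n) h = (\<Sum>i\<in>{1..n}. c n (h (e n i)) i)"
proof -
  let ?V = "Comp P n"
  define B where "B = (SOME B. ratv.independent B \<and> ratv.span B = ?V)"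
  have "\<exists>B. ratv.independent B \<and> ratv.span B = ?V"
    using ratv.maximal_independent_subset[of ?V] ratv.span_minimal[OF _ subspace[of n]] by (metis antisym)
  then have B: "ratv.independent B" "ratv.span B = ?V"
    unfolding B_def by (metis (mono_tags, lifting) someI_ex)+
  have BV: "b \<in> ?V" if "b \<in> B" for b using that B(2) ratv.span_base by auto
  have fin: "finite B"
  proof -
    have "B \<subseteq> ratv.span (e n ` {1..n})"
    proof
      fix b assume "b \<in> B"
      then have "b = (\<Sum>i\<in>{1..n}. c n b i *\<^sub>Q e n i)" using BV expand by blast
      moreover have "(\<Sum>i\<in>{1..n}. c n b i *\<^sub>Q e n i) \<in> ratv.span (e n ` {1..n})"
        by (intro ratv.span_sum ratv.span_scale ratv.span_base) auto
      ultimately show "b \<in> ratv.span (e n ` {1..n})" by simp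
    qed
    then show ?thesis using ratv.independent_span_bound[OF _ B(1)] by blast
  qed
  have h_V: "h x \<in> ?V" if "x \<in> ?V" for x using closed that by auto
  have h_scale: "h (a *\<^sub>Q x) = a *\<^sub>Q h x" if "x \<in> ?V" for a x
    using lin that by (simp add: lin_on_def)
  have h_sum: "h (\<Sum>i\<in>A. x i) = (\<Sum>i\<in>A. h (x i))" if "\<And>i. i \<in> A \<Longrightarrow> x i \<in> ?V" for A :: "nat set" and x
    using that
  proof (induction A rule: infinite_finite_induct)
    case (insert a A)
    then show ?case using lin by (simp add: lin_on_def ratv.subspace_sum[OF subspace])
  qed (use h_scale[of 0 0] ratv.subspace_0[OF subspace] in simp_all)
  have rep: "ratv.representation B (h b) b = (\<Sum>i\<in>{1..n}. c n b i * ratv.representation B (h (e n i)) b)"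
    if "b \<in> B" for b
  proof -
    have "h b = h (\<Sum>i\<in>{1..n}. c n b i *\<^sub>Q e n i)" using expand[OF BV[OF that]] by simp
    also have "\<dots> = (\<Sum>i\<in>{1..n}. c n b i *\<^sub>Q h (e n i))"
      by (subst h_sum) (auto simp: scale_Comp basis_Comp h_scale)
    finally have hb: "h b = (\<Sum>i\<in>{1..n}. c n b i *\<^sub>Q h (e n i))" .
    show ?thesis
      unfolding hb
      by (subst ratv.representation_sum[OF B(1)])
        (auto simp: B(2) scale_Comp h_V basis_Comp ratv.representation_scale[OF B(1)])
  qed
  have "trace_on ?V h = (\<Sum>b\<in>B. \<Sum>i\<in>{1..n}. c n b i * ratv.representation B (h (e n i)) b)"
    unfolding trace_on_def B_def[symmetric] Let_def using rep by (intro sum.cong) auto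
  also have "\<dots> = (\<Sum>i\<in>{1..n}. \<Sum>b\<in>B. c n (ratv.representation B (h (e n i)) b *\<^sub>Q b) i)"
    by (subst sum.swap) (simp add: coord_scale BV mult.commute)
  also have "\<dots> = (\<Sum>i\<in>{1..n}. c n (\<Sum>b\<in>B. ratv.representation B (h (e n i)) b *\<^sub>Q b) i)"
    by (rule sum.cong[OF refl], subst coord_sum) (auto simp: scale_Comp BV)
  also have "\<dots> = (\<Sum>i\<in>{1..n}. c n (h (e n i)) i)"
    by (rule sum.cong[OF refl], subst ratv.sum_representation_eq[OF B(1) _ fin])
      (auto simp: B(2) h_V basis_Comp)
  finally show ?thesis .
qed

text \<open>The diagonal entry of \<open>\<sigma>\<close> at \<open>e n i\<close> is the \<open>i\<close>-th entry of \<open>v\<^bsub>\<sigma> i\<^esub> - v\<^bsub>\<sigma> (n+1)\<^esub>\<close>. This is also correct for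
  \<open>i = n + 1\<close>, where that vector is zero, so one may sum over all \<open>n + 1\<close> indices.\<close>

lemma trace_on_permutation:
  assumes \<sigma>: "\<sigma> permutes {1..n + 1}" and h: "\<And>x. x \<in> Comp P n \<Longrightarrow> h x \<in> Comp P n"
    and coord_h: "\<And>x. x \<in> Comp P n \<Longrightarrow> c n (h x) = vact \<sigma> (c n x)"
  shows "trace_on (Comp P n) h = of_nat (card {i\<in>{1..n + 1}. \<sigma> i = i}) - 1"
proof -
  have inv: "inv \<sigma> i = j \<longleftrightarrow> \<sigma> j = i" for i j using permutes_inv_eq[OF \<sigma>] .
  have "trace_on (Comp P n) h = (\<Sum>i\<in>{1..n}. c n (h (e n i)) i)"
    by (rule trace_on_coord[OF lin_on_coord]) (use h coord_h in auto)
  also have "\<dots> = (\<Sum>i\<in>{1..n}. vact \<sigma> (basis_vec n i) i)"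
    by (rule sum.cong) (auto simp: coord_h basis_Comp coord_basis)
  also have "\<dots> = (\<Sum>i\<in>{1..n + 1}. vact \<sigma> (basis_vec n i) i)"
    by (simp add: vact_def basis_vec_def)
  also have "\<dots> = (\<Sum>i\<in>{1..n + 1}. (if \<sigma> i = i then 1 else 0) - (if i = \<sigma> (n + 1) then 1 else 0))"
    by (rule sum.cong) (auto simp: vact_def basis_vec_def inv)
  also have "\<dots> = (\<Sum>i\<in>{1..n + 1}. if \<sigma> i = i then 1 else 0) - 1"
    using permutes_in_image[OF \<sigma>, of "n + 1"] by (simp add: sum_subtractf del: sum.cl_ivl_Suc)
  also have "(\<Sum>i\<in>{1..n + 1}. if \<sigma> i = i then 1 else 0) = rat_of_nat (card {i\<in>{1..n + 1}. \<sigma> i = i})"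
    by (simp add: sum.inter_filter[symmetric] del: sum.cl_ivl_Suc)
  finally show ?thesis .
qed

end

locale symmetric_vector_model = vector_model P c e
  for P :: "('a::rat_vector, 'z) sym_op_scheme" and c e +
  assumes act_Comp: "\<sigma> permutes {1..n + 1} \<Longrightarrow> x \<in> Comp P n \<Longrightarrow> Act P n \<sigma> x \<in> Comp P n"
    and coord_act: "\<sigma> permutes {1..n + 1} \<Longrightarrow> x \<in> Comp P n \<Longrightarrow> c n (Act P n \<sigma> x) = vact \<sigma> (c n x)"
begin

lemma group_action: 
  assumes "N \<le> n + 1"
  shows "group_action_on N (Comp P n) (Act P n)"
proof -
  have perm: "\<sigma> permutes {1..n + 1}" if "\<sigma> permutes {1..N}" for \<sigma>
    using permutes_subset[OF that] assms by auto
  show ?thesis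
    unfolding group_action_on_def
  proof (intro conjI allI impI ballI)
    fix \<sigma> assume "\<sigma> permutes {1..N}"
    then have \<sigma>: "\<sigma> permutes {1..n + 1}" by (rule perm)
    show "lin_on (Comp P n) (Act P n \<sigma>)"
      by (rule lin_on_coord) (use \<sigma> act_Comp coord_act in auto)
    show "Act P n \<sigma> ` Comp P n \<subseteq> Comp P n" using act_Comp[OF \<sigma>] by auto
    fix \<sigma>' x assume "\<sigma>' permutes {1..N}" and x: "x \<in> Comp P n"
    then have \<sigma>': "\<sigma>' permutes {1..n + 1}" using perm by blast
    note c = permutes_compose[OF \<sigma>' \<sigma>]
    show "Act P n (\<sigma> \<circ> \<sigma>') x = Act P n \<sigma> (Act P n \<sigma>' x)"
      using act_Comp[OF c x] act_Comp[OF \<sigma> act_Comp[OF \<sigma>' x]]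
      by (rule coord_eqI)
        (simp add: coord_act[OF c x] coord_act[OF \<sigma> act_Comp[OF \<sigma>' x]] coord_act[OF \<sigma>' x]
          vact_comp permutes_bij[OF \<sigma>] permutes_bij[OF \<sigma>'])
  next
    fix x assume x: "x \<in> Comp P n"
    show "Act P n id x = x"
      using act_Comp[OF permutes_id x] x
      by (rule coord_eqI) (simp add: coord_act[OF permutes_id x] vact_id)
  qed
qed

lemma is_anticyclic_operad: "anticyclic_operad P"
  unfolding anticyclic_operad_def symmetric_operad_def
proof (intro conjI allI impI ballI)
  show "ns_operad P" by (rule is_ns_operad)
  show "group_action_on n (Comp P n) (Act P n)" "group_action_on (n + 1) (Comp P n) (Act P n)" for n
    by (rule group_action; simp)+
  show "tau_identities P (\<lambda>n. Act P n (long_cycle n))"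
    by (rule tau_identities_rotation)
      (auto intro!: act_Comp coord_act long_cycle_permutes simp del: One_nat_def)
  fix m n k :: nat and \<sigma> \<rho> f g
  assume k: "1 \<le> k" "k \<le> m" and n: "1 \<le> n"
    and \<sigma>: "\<sigma> permutes {1..m}" and \<rho>: "\<rho> permutes {1..n}" and f: "f \<in> Comp P m" and g: "g \<in> Comp P n"
  have \<sigma>': "\<sigma> permutes {1..m + 1}" and \<rho>': "\<rho> permutes {1..n + 1}"
    using permutes_subset[OF \<sigma>] permutes_subset[OF \<rho>] by auto
  have b: "block_perm n k \<sigma> \<rho> permutes {1..m + n - 1 + 1}"
    using permutes_subset[OF block_perm_permutes[OF k n \<sigma> \<rho>]] by auto
  have \<sigma>k: "1 \<le> \<sigma> k" "\<sigma> k \<le> m" using permutes_in_image[OF \<sigma>, of k] k by auto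
  note fg = circ_Comp[OF k n f g]
  show "Circ P (\<sigma> k) (Act P m \<sigma> f) (Act P n \<rho> g) =
      Act P (m + n - 1) (block_perm n k \<sigma> \<rho>) (Circ P k f g)"
    using circ_Comp[OF \<sigma>k n act_Comp[OF \<sigma>' f] act_Comp[OF \<rho>' g]] act_Comp[OF b fg]
    by (rule coord_eqI)
      (simp only: coord_circ[OF \<sigma>k n act_Comp[OF \<sigma>' f] act_Comp[OF \<rho>' g]] coord_act[OF b fg]
        coord_act[OF \<sigma>' f] coord_act[OF \<rho>' g] coord_circ[OF k n f g] vcirc_equivariant[OF k n \<sigma> \<rho>])
qed

end

section \<open>Coordinates on Dias\<close>

lemma vcirc_basis_vec:
  assumes k: "1 \<le> k" "k \<le> m" and a: "a \<in> {1..m}" and b: "b \<in> {1..n}"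
  shows "vcirc n k (basis_vec m a) (basis_vec n b) =
    basis_vec (m + n - 1) (if a < k then a else if a = k then k - 1 + b else a + n - 1)"
proof (rule vecs_eqI)
  have n: "1 \<le> n" using b by auto
  show "vcirc n k (basis_vec m a) (basis_vec n b) \<in> vecs (m + n - 1)"
    by (rule vcirc_vecs[OF k n basis_vec_vecs[OF a] basis_vec_vecs[OF b]])
  show "basis_vec (m + n - 1) (if a < k then a else if a = k then k - 1 + b else a + n - 1) \<in> vecs (m + n - 1)"
    by (rule basis_vec_vecs) (use k a b in auto)
  fix p assume p: "p \<in> {1..m + n - 1}"
  have bv: "basis_vec N i j = (if j = i then 1 else 0)" if "j \<le> N" for N i j
    using that by (simp add: basis_vec_def)
  have last: "basis_vec n b (n + 1) = - 1" using b by (simp add: basis_vec_def)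
  have rhs: "basis_vec (m + n - 1) d p = (if p = d then 1 else 0)" for d
    by (rule bv) (use p in simp)
  consider "p < k" | "k \<le> p" "p < k + n" | "k + n \<le> p" by linarith
  then show "vcirc n k (basis_vec m a) (basis_vec n b) p =
      basis_vec (m + n - 1) (if a < k then a else if a = k then k - 1 + b else a + n - 1) p"
  proof cases
    case 1
    then have "vcirc n k (basis_vec m a) (basis_vec n b) p = (if p = a then 1 else 0)"
      using k by (simp add: vcirc_def last[simplified] bv)
    then show ?thesis unfolding rhs using 1 b by auto
  next
    case 2
    then have "vcirc n k (basis_vec m a) (basis_vec n b) p = (if a = k \<and> p + 1 - k = b then 1 else 0)"
      using k by (simp add: vcirc_def bv)
    then show ?thesis unfolding rhs using 2 k b by auto
  next
    case 3
    then have "vcirc n k (basis_vec m a) (basis_vec n b) p = (if p + 1 - n = a then 1 else 0)"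
      using k p by (simp add: vcirc_def last[simplified] bv)
    then show ?thesis unfolding rhs using 3 k b n by auto
  qed
qed

text \<open>The number of the leaf reached from the root by following the direction in which the operations point.\<close>

fun middle :: "tree \<Rightarrow> nat" where
  "middle Leaf = 1"
| "middle (LeftOp l r) = middle l"
| "middle (RightOp l r) = leaves l + middle r"

lemma middle_range: "middle t \<in> {1..leaves t}"
  by (induction t) auto

lemma middle_graft:
  assumes "1 \<le> k" "k \<le> leaves t"
  shows "middle (graft k t s) =
    (if middle t < k then middle t else if middle t = k then k - 1 + middle s
     else middle t + leaves s - 1)"
  using assms
proof (induction t arbitrary: k)
  case (LeftOp l r)
  then show ?case using middle_range[of l] by auto
next
  case (RightOp l r)
  show ?case
  proof (cases "k \<le> leaves l")
    case True
    then show ?thesis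
      using RightOp.prems middle_range[of r] leaves_pos[of s] leaves_pos[of l] by (auto simp: leaves_graft)
  next
    case False
    then have "1 \<le> k - leaves l" "k - leaves l \<le> leaves r" using RightOp.prems by auto
    then show ?thesis using False RightOp.IH(2)[of "k - leaves l"] leaves_pos[of s] by auto
  qed
qed simp

definition tree_coord :: "nat \<Rightarrow> (tree \<Rightarrow>\<^sub>0 rat) \<Rightarrow> nat \<Rightarrow> rat" where
  "tree_coord n x i =
     (\<Sum>t\<in>keys x. lookup x t * (if leaves t = n then basis_vec n (middle t) i else 0))"

lemma tree_coord_add: "tree_coord n (x + y) i = tree_coord n x i + tree_coord n y i"
  unfolding tree_coord_def by (rule sum_keys_add) (simp add: distrib_right)

lemma tree_coord_scale: "tree_coord n (a *\<^sub>Q x) i = a * tree_coord n x i"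
  unfolding tree_coord_def
  by (subst sum_keys_scale) (simp_all add: scaleQ_rat_def mult.assoc)

lemma tree_coord_diff: "tree_coord n (x - y) i = tree_coord n x i - tree_coord n y i"
  using tree_coord_add[of n "x - y" y i] by simp

lemma tree_coord_zero: "tree_coord n 0 i = 0"
  by (simp add: tree_coord_def)

lemma tree_coord_sum: "tree_coord n (\<Sum>a\<in>A. F a) i = (\<Sum>a\<in>A. tree_coord n (F a) i)"
  by (induction A rule: infinite_finite_induct) (auto simp: tree_coord_add tree_coord_zero)

lemma tree_coord_single:
  "tree_coord n (Poly_Mapping.single t a) i = a * (if leaves t = n then basis_vec n (middle t) i else 0)"
  by (simp add: tree_coord_def)

lemma tree_coord_Free:
  "x \<in> Comp Free n \<Longrightarrow> tree_coord n x i = (\<Sum>t\<in>keys x. lookup x t * basis_vec n (middle t) i)"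
  unfolding tree_coord_def by (rule sum.cong) (auto simp: Free_def)

lemma tree_coord_other: "x \<in> Comp Free m \<Longrightarrow> m \<noteq> n \<Longrightarrow> tree_coord n x i = 0"
  unfolding tree_coord_def by (rule sum.neutral) (auto simp: Free_def)

lemma tree_coord_circ:
  assumes k: "1 \<le> k" "k \<le> m" and f: "f \<in> Comp Free m" and g: "g \<in> Comp Free n"
  shows "tree_coord (m + n - 1) (tree_circ k f g) = vcirc n k (tree_coord m f) (tree_coord n g)"
proof
  fix p
  have "tree_coord (m + n - 1) (tree_circ k f g) p = (\<Sum>t\<in>keys f. \<Sum>s\<in>keys g.
      vcirc n k (\<lambda>i. lookup f t * basis_vec m (middle t) i) (\<lambda>i. lookup g s * basis_vec n (middle s) i) p)"
    unfolding tree_circ_def tree_coord_sum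
  proof (intro sum.cong refl)
    fix t s assume "t \<in> keys f" "s \<in> keys g"
    then have l: "leaves t = m" "leaves s = n" using f g by (auto simp: Free_def)
    then have "middle t \<in> {1..m}" "middle s \<in> {1..n}" using middle_range by blast+
    then show "tree_coord (m + n - 1) (if 1 \<le> k \<and> k \<le> leaves t
         then Poly_Mapping.single (graft k t s) (lookup f t * lookup g s) else 0) p =
      vcirc n k (\<lambda>i. lookup f t * basis_vec m (middle t) i) (\<lambda>i. lookup g s * basis_vec n (middle s) i) p"
      using k l by (simp add: tree_coord_single leaves_graft middle_graft vcirc_scale_left
          vcirc_scale_right vcirc_basis_vec del: One_nat_def)
  qed
  also have "\<dots> = vcirc n k (tree_coord m f) (tree_coord n g) p"
    unfolding vcirc_sum[symmetric] by (simp add: tree_coord_Free[OF f, abs_def] tree_coord_Free[OF g, abs_def])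
  finally show "tree_coord (m + n - 1) (tree_circ k f g) p = vcirc n k (tree_coord m f) (tree_coord n g) p" .
qed

lemma vcirc_zero: "vcirc n k (\<lambda>_. 0) g = (\<lambda>_. 0)" "vcirc n k f (\<lambda>_. 0) = (\<lambda>_. 0)"
  by (auto simp: vcirc_def)

lemma tree_coord_ideal:
  assumes "ns_ideal Free dias_relations n x"
  shows "tree_coord n x = (\<lambda>_. 0)"
  using assms
proof induction
  case (1 x n)
  then show ?case
    by (auto simp: dias_relations_def tree_coord_diff tree_coord_single fun_eq_iff)
next
  case (5 i m n x y)
  note x = ns_ideal_sub[OF Free.total_circ_axioms subspace_Free 5(4)]
  have "Circ Free = tree_circ" by (simp add: Free_def)
  then show ?case using tree_coord_circ[OF 5(1,2) x 5(5)] by (simp only: 5 vcirc_zero)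
next
  case (6 i m n x y)
  note y = ns_ideal_sub[OF Free.total_circ_axioms subspace_Free 6(5)]
  have "Circ Free = tree_circ" by (simp add: Free_def)
  then show ?case using tree_coord_circ[OF 6(1,2) 6(4) y] by (simp only: 6 vcirc_zero)
qed (auto simp: tree_coord_zero tree_coord_add tree_coord_scale fun_eq_iff)

lemma tree_coord_dias_ideal:
  assumes "x \<in> dias_ideal"
  shows "tree_coord n x i = 0"
  using assms unfolding dias_ideal_def ns_ideal_total_def
proof (induction rule: ratv.span_induct_alt)
  case (step c x y)
  then obtain m where x: "ns_ideal Free dias_relations m x" by auto
  have "tree_coord n x i = 0"
  proof (cases "m = n")
    case False
    then show ?thesis using tree_coord_other ns_ideal_sub[OF Free.total_circ_axioms subspace_Free x] by blast
  qed (use tree_coord_ideal[OF x] in simp)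
  then show ?case using step by (simp add: tree_coord_add tree_coord_scale)
qed (simp add: tree_coord_zero)

lift_definition dias_coord :: "nat \<Rightarrow> dias \<Rightarrow> nat \<Rightarrow> rat" is tree_coord
proof
  fix n x y i assume "dias_eq x y"
  then show "tree_coord n x i = tree_coord n y i"
    using tree_coord_dias_ideal[of "x - y"] by (simp add: dias_eq_def tree_coord_diff)
qed

lemma dias_coord_add: "dias_coord n (x + y) i = dias_coord n x i + dias_coord n y i"
  by transfer (rule tree_coord_add)

lemma dias_coord_scale: "dias_coord n (a *\<^sub>Q x) i = a * dias_coord n x i"
  by transfer (rule tree_coord_scale)

lemma dias_coord_zero: "dias_coord n 0 i = 0"
  by transfer (rule tree_coord_zero)

lemma dias_coord_diff: "dias_coord n (x - y) i = dias_coord n x i - dias_coord n y i"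
  by transfer (rule tree_coord_diff)

lemma dias_coord_other: "x \<in> Comp Dias m \<Longrightarrow> m \<noteq> n \<Longrightarrow> dias_coord n x i = 0"
  by (auto simp: Dias_def dias_coord.abs_eq tree_coord_other)

subsection \<open>Normal forms\<close>

definition tree_class :: "tree \<Rightarrow> dias" where
  "tree_class t = to_dias (tr t)"

lemma tree_class_graft:
  assumes "1 \<le> k" "k \<le> leaves t"
  shows "tree_class (graft k t s) = dias_circ k (tree_class t) (tree_class s)"
  using assms by (simp add: tree_class_def dias_circ.abs_eq tree_circ_def)

lemma tree_class_LeftOp:
  "tree_class (LeftOp l r) = dias_circ 1 (dias_circ 2 (tree_class (LeftOp Leaf Leaf)) (tree_class r)) (tree_class l)"
  using tree_class_graft[of 2 "LeftOp Leaf Leaf" r] tree_class_graft[of 1 "LeftOp Leaf r" l] by simp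

lemma tree_class_RightOp:
  "tree_class (RightOp l r) = dias_circ 1 (dias_circ 2 (tree_class (RightOp Leaf Leaf)) (tree_class r)) (tree_class l)"
  using tree_class_graft[of 2 "RightOp Leaf Leaf" r] tree_class_graft[of 1 "RightOp Leaf r" l] by simp

text \<open>The relations of \<open>Dias\<close> hold for arbitrary trees in place of the three leaves. Grafting from right to left
  leaves the numbers of the remaining leaves unchanged.\<close>

lemma tree_class_relation:
  assumes "tr t - tr s \<in> dias_relations" "leaves t = 3" "leaves s = 3"
  shows "tree_class (graft 1 (graft 2 (graft 3 t c) b) a) = tree_class (graft 1 (graft 2 (graft 3 s c) b) a)"
proof -
  have "tr t - tr s \<in> Comp Free 3"
    by (rule ratv.subspace_diff[OF subspace_Free]) (use assms in \<open>auto simp: Free_def\<close>)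
  then have "ns_ideal Free dias_relations 3 (tr t - tr s)"
    using assms(1) ns_ideal.intros(1) by blast
  then have "tr t - tr s \<in> dias_ideal"
    unfolding dias_ideal_def ns_ideal_total_def by (intro ratv.span_base) auto
  then have "tree_class t = tree_class s"
    by (simp add: tree_class_def dias.abs_eq_iff dias_eq_def)
  then show ?thesis
    using assms leaves_pos[of c] leaves_pos[of b] by (simp add: tree_class_graft leaves_graft)
qed

lemma tree_class_dialgebra:
  "tree_class (LeftOp a (RightOp b c)) = tree_class (LeftOp (LeftOp a b) c)"
  "tree_class (LeftOp a (LeftOp b c)) = tree_class (LeftOp (LeftOp a b) c)"
  "tree_class (RightOp a (LeftOp b c)) = tree_class (LeftOp (RightOp a b) c)"
  "tree_class (RightOp (LeftOp a b) c) = tree_class (RightOp a (RightOp b c))"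
  "tree_class (RightOp (RightOp a b) c) = tree_class (RightOp a (RightOp b c))"
proof -
  note rel = tree_class_relation[where a = a and b = b and c = c]
  show 2: "tree_class (LeftOp a (LeftOp b c)) = tree_class (LeftOp (LeftOp a b) c)"
    using rel[of "LeftOp Leaf (LeftOp Leaf Leaf)" "LeftOp (LeftOp Leaf Leaf) Leaf"]
    by (simp add: dias_relations_def eval_nat_numeral)
  show "tree_class (LeftOp a (RightOp b c)) = tree_class (LeftOp (LeftOp a b) c)"
    using rel[of "LeftOp Leaf (RightOp Leaf Leaf)" "LeftOp Leaf (LeftOp Leaf Leaf)"]
    by (simp add: dias_relations_def eval_nat_numeral 2)
  show "tree_class (RightOp a (LeftOp b c)) = tree_class (LeftOp (RightOp a b) c)"
    using rel[of "RightOp Leaf (LeftOp Leaf Leaf)" "LeftOp (RightOp Leaf Leaf) Leaf"]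
    by (simp add: dias_relations_def eval_nat_numeral)
  show 5: "tree_class (RightOp (RightOp a b) c) = tree_class (RightOp a (RightOp b c))"
    using rel[of "RightOp Leaf (RightOp Leaf Leaf)" "RightOp (RightOp Leaf Leaf) Leaf"]
    by (simp add: dias_relations_def eval_nat_numeral)
  show "tree_class (RightOp (LeftOp a b) c) = tree_class (RightOp a (RightOp b c))"
    using rel[of "RightOp (RightOp Leaf Leaf) Leaf" "RightOp (LeftOp Leaf Leaf) Leaf"]
    by (simp add: dias_relations_def eval_nat_numeral 5)
qed

text \<open>\<open>pad_right k t\<close> is \<open>((t \<stileturn> x) \<stileturn> x) \<dots> \<stileturn> x\<close>, and \<open>pad_left k t\<close> is
  \<open>x \<turnstile> (x \<turnstile> \<dots> (x \<turnstile> t))\<close>, with \<open>k\<close> new leaves.\<close>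

definition pad_right :: "nat \<Rightarrow> tree \<Rightarrow> tree" where
  "pad_right k t = ((\<lambda>t. LeftOp t Leaf) ^^ k) t"

definition pad_left :: "nat \<Rightarrow> tree \<Rightarrow> tree" where
  "pad_left k t = (RightOp Leaf ^^ k) t"

lemma pad_right_cong: "tree_class t = tree_class t' \<Longrightarrow> tree_class (pad_right k t) = tree_class (pad_right k t')"
  by (induction k) (simp_all add: pad_right_def, metis tree_class_LeftOp)

lemma pad_left_cong: "tree_class t = tree_class t' \<Longrightarrow> tree_class (pad_left k t) = tree_class (pad_left k t')"
  by (induction k) (simp_all add: pad_left_def, metis tree_class_RightOp)

lemma pad_add: "pad_right j (pad_right k t) = pad_right (k + j) t" "pad_left j (pad_left k t) = pad_left (j + k) t"
  by (simp_all add: pad_right_def pad_left_def funpow_add add.commute)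

text \<open>The argument to which \<open>\<stileturn>\<close> does not point only counts through its number of leaves.\<close>

lemma tree_class_LeftOp_pad: "tree_class (LeftOp t s) = tree_class (pad_right (leaves s) t)"
proof (induction s arbitrary: t)
  case (LeftOp b c)
  show ?case
    using LeftOp.IH(2)[of "LeftOp t b"] pad_right_cong[OF LeftOp.IH(1)[of t], of "leaves c"]
    by (simp add: tree_class_dialgebra pad_add)
next
  case (RightOp b c)
  show ?case
    using RightOp.IH(2)[of "LeftOp t b"] pad_right_cong[OF RightOp.IH(1)[of t], of "leaves c"]
    by (simp add: tree_class_dialgebra pad_add)
qed (simp add: pad_right_def)

lemma tree_class_RightOp_pad: "tree_class (RightOp s t) = tree_class (pad_left (leaves s) t)"
proof (induction s arbitrary: t)
  case (LeftOp b c)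
  show ?case
    using LeftOp.IH(1)[of "RightOp c t"] pad_left_cong[OF LeftOp.IH(2)[of t], of "leaves b"]
    by (simp add: tree_class_dialgebra pad_add)
next
  case (RightOp b c)
  show ?case
    using RightOp.IH(1)[of "RightOp c t"] pad_left_cong[OF RightOp.IH(2)[of t], of "leaves b"]
    by (simp add: tree_class_dialgebra pad_add)
qed (simp add: pad_left_def)

lemma pad_commute: "tree_class (pad_right j (pad_left k t)) = tree_class (pad_left k (pad_right j t))"
proof (induction k)
  case (Suc k)
  have step: "tree_class (pad_right j (RightOp Leaf s)) = tree_class (RightOp Leaf (pad_right j s))" for s
  proof (induction j)
    case (Suc j)
    have "tree_class (LeftOp (pad_right j (RightOp Leaf s)) Leaf) = tree_class (LeftOp (RightOp Leaf (pad_right j s)) Leaf)"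
      using Suc by (metis tree_class_LeftOp)
    then show ?case by (simp add: pad_right_def tree_class_dialgebra)
  qed (simp add: pad_right_def)
  have "tree_class (pad_right j (pad_left (Suc k) t)) = tree_class (RightOp Leaf (pad_right j (pad_left k t)))"
    using step[of "pad_left k t"] by (simp add: pad_left_def)
  also have "\<dots> = tree_class (RightOp Leaf (pad_left k (pad_right j t)))"
    using Suc by (metis tree_class_RightOp)
  finally show ?case by (simp add: pad_left_def)
qed (simp add: pad_left_def)

text \<open>The representative with middle leaf \<open>i\<close>: \<open>i - 1\<close> leaves are attached to its left and \<open>n - i\<close> to its
  right. Because the two kinds of attachment commute, every tree reduces to one of these.\<close>

definition normal_tree :: "nat \<Rightarrow> nat \<Rightarrow> tree" where
  "normal_tree n i = pad_left (i - 1) (pad_right (n - i) Leaf)"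

lemma tree_class_normal: "tree_class t = tree_class (normal_tree (leaves t) (middle t))"
proof (induction t)
  case Leaf
  then show ?case by (simp add: normal_tree_def pad_left_def pad_right_def)
next
  case (LeftOp l r)
  have "tree_class (LeftOp l r) = tree_class (pad_right (leaves r) (normal_tree (leaves l) (middle l)))"
    unfolding tree_class_LeftOp_pad by (rule pad_right_cong[OF LeftOp.IH(1)])
  also have "\<dots> = tree_class (normal_tree (leaves (LeftOp l r)) (middle (LeftOp l r)))"
    using middle_range[of l] by (simp add: normal_tree_def pad_commute pad_add)
  finally show ?case .
next
  case (RightOp l r)
  have "tree_class (RightOp l r) = tree_class (pad_left (leaves l) (normal_tree (leaves r) (middle r)))"
    unfolding tree_class_RightOp_pad by (rule pad_left_cong[OF RightOp.IH(2)])
  also have "\<dots> = tree_class (normal_tree (leaves (RightOp l r)) (middle (RightOp l r)))"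
    using middle_range[of r] by (simp add: normal_tree_def pad_add)
  finally show ?case .
qed

lemma leaves_normal_tree: "i \<in> {1..n} \<Longrightarrow> leaves (normal_tree n i) = n"
  and middle_normal_tree: "i \<in> {1..n} \<Longrightarrow> middle (normal_tree n i) = i"
proof -
  have r: "leaves (pad_right k t) = k + leaves t" "middle (pad_right k t) = middle t" for k t
    by (induction k) (auto simp: pad_right_def)
  have l: "leaves (pad_left k t) = k + leaves t" "middle (pad_left k t) = k + middle t" for k t
    by (induction k) (auto simp: pad_left_def)
  show "i \<in> {1..n} \<Longrightarrow> leaves (normal_tree n i) = n" "i \<in> {1..n} \<Longrightarrow> middle (normal_tree n i) = i"
    by (auto simp: normal_tree_def r l)
qed

definition dias_basis :: "nat \<Rightarrow> nat \<Rightarrow> dias" where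
  "dias_basis n i = tree_class (normal_tree n i)"

lemma to_dias_expand: "to_dias f = (\<Sum>t\<in>keys f. lookup f t *\<^sub>Q tree_class t)"
proof -
  have "to_dias (\<Sum>t\<in>A. lookup f t *\<^sub>Q tr t) = (\<Sum>t\<in>A. lookup f t *\<^sub>Q tree_class t)" for A
    by (induction A rule: infinite_finite_induct)
      (simp_all add: zero_dias.abs_eq plus_dias.abs_eq[symmetric] tree_class_def scaleQ_dias.abs_eq)
  moreover have "f = (\<Sum>t\<in>keys f. lookup f t *\<^sub>Q tr t)"
    by (subst sum_singles[of f, symmetric]) (simp add: single_scaleQ[symmetric] scaleQ_rat_def)
  ultimately show ?thesis by metis
qed

lemma tree_class_Comp: "tree_class t \<in> Comp Dias (leaves t)"
  by (auto simp: tree_class_def Dias_def Free_def)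

lemma dias_coord_tree_class: "dias_coord (leaves t) (tree_class t) = basis_vec (leaves t) (middle t)"
  by (simp add: tree_class_def dias_coord.abs_eq tree_coord_single fun_eq_iff)

lemma Circ_Dias: "Circ Dias = dias_circ"
  by (simp add: Dias_def)

interpretation Dias: vector_model Dias dias_coord dias_basis
proof
  fix n show "ratv.subspace (Comp Dias n)" by (rule subspace_Dias)
next
  fix x y n i show "dias_coord n (x + y) i = dias_coord n x i + dias_coord n y i" by (rule dias_coord_add)
next
  fix x n a i show "dias_coord n (a *\<^sub>Q x) i = a * dias_coord n x i" by (rule dias_coord_scale)
next
  fix x n assume "x \<in> Comp Dias n"
  then obtain f where f: "f \<in> Comp Free n" "x = to_dias f" by (auto simp: Dias_def)
  have "(\<lambda>i. \<Sum>t\<in>A. lookup f t * basis_vec n (middle t) i) \<in> vecs n" if "A \<subseteq> keys f" for A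
    using finite_subset[OF that finite_keys] that
  proof (induction A rule: finite_induct)
    case (insert t A)
    then have "middle t \<in> {1..n}" using middle_range[of t] f by (auto simp: Free_def)
    then show ?case using insert by (simp add: vecs_add vecs_scale basis_vec_vecs)
  qed (simp add: vecs_zero)
  then show "dias_coord n x \<in> vecs n"
    by (simp add: f(2) dias_coord.abs_eq tree_coord_Free[OF f(1), abs_def])
next
  fix x n assume "x \<in> Comp Dias n" and 0: "dias_coord n x = (\<lambda>_. 0)"
  then obtain f where f: "f \<in> Comp Free n" "x = to_dias f" by (auto simp: Dias_def)
  have t: "leaves t = n" "middle t \<in> {1..n}" if "t \<in> keys f" for t
    using that f(1) middle_range[of t] by (auto simp: Free_def)
  have "x = (\<Sum>t\<in>keys f. lookup f t *\<^sub>Q dias_basis n (middle t))"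
    unfolding f(2) to_dias_expand
  proof (rule sum.cong[OF refl])
    fix u assume "u \<in> keys f"
    then show "lookup f u *\<^sub>Q tree_class u = lookup f u *\<^sub>Q dias_basis n (middle u)"
      using tree_class_normal[of u] t(1) by (simp add: dias_basis_def)
  qed
  also have "\<dots> = (\<Sum>t\<in>keys f. \<Sum>i\<in>{1..n}. (lookup f t * basis_vec n (middle t) i) *\<^sub>Q dias_basis n i)"
  proof (rule sum.cong[OF refl])
    fix u assume u: "u \<in> keys f"
    have "(\<Sum>i\<in>{1..n}. (lookup f u * basis_vec n (middle u) i) *\<^sub>Q dias_basis n i) =
        (\<Sum>i\<in>{1..n}. if middle u = i then lookup f u *\<^sub>Q dias_basis n i else 0)"
      by (rule sum.cong) (auto simp: basis_vec_def)
    then show "lookup f u *\<^sub>Q dias_basis n (middle u) =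
        (\<Sum>i\<in>{1..n}. (lookup f u * basis_vec n (middle u) i) *\<^sub>Q dias_basis n i)"
      using t[OF u] by simp
  qed
  also have "\<dots> = (\<Sum>i\<in>{1..n}. dias_coord n x i *\<^sub>Q dias_basis n i)"
    by (subst sum.swap) (simp add: f dias_coord.abs_eq tree_coord_Free ratv.scale_sum_left)
  also have "\<dots> = 0" by (simp add: 0)
  finally show "x = 0" .
next
  fix i n :: nat assume i: "i \<in> {1..n}"
  show "dias_basis n i \<in> Comp Dias n"
    using tree_class_Comp[of "normal_tree n i"] by (simp only: dias_basis_def leaves_normal_tree[OF i])
  show "dias_coord n (dias_basis n i) = basis_vec n i"
    using dias_coord_tree_class[of "normal_tree n i"]
    by (simp only: dias_basis_def leaves_normal_tree[OF i] middle_normal_tree[OF i])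
next
  have unit: "Unit Dias = tree_class Leaf" by (simp add: Dias_def Free_def tree_class_def)
  show "Unit Dias \<in> Comp Dias 1" "dias_coord 1 (Unit Dias) = basis_vec 1 1"
    using tree_class_Comp[of Leaf] dias_coord_tree_class[of Leaf] by (simp_all add: unit)
next
  fix k m n :: nat and f g
  assume k: "1 \<le> k" "k \<le> m" "1 \<le> n" and fg: "f \<in> Comp Dias m" "g \<in> Comp Dias n"
  show "Circ Dias k f g \<in> Comp Dias (m + n - 1)"
    unfolding Circ_Dias using dias_circ_closed[OF k fg] .
  obtain f' g' where "f' \<in> Comp Free m" "f = to_dias f'" "g' \<in> Comp Free n" "g = to_dias g'"
    using fg by (auto simp: Dias_def)
  then show "dias_coord (m + n - 1) (Circ Dias k f g) = vcirc n k (dias_coord m f) (dias_coord n g)"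
    using tree_coord_circ[OF k(1,2)] by (simp add: Circ_Dias dias_circ.abs_eq dias_coord.abs_eq)
qed

subsection \<open>The anticyclic structure of Dias\<close>

lemma Dias_2:
  "left_product \<in> Comp Dias 2" "dias_coord 2 left_product = basis_vec 2 1"
  "right_product \<in> Comp Dias 2" "dias_coord 2 right_product = basis_vec 2 2"
  using tree_class_Comp[of "LeftOp Leaf Leaf"] tree_class_Comp[of "RightOp Leaf Leaf"]
    dias_coord_tree_class[of "LeftOp Leaf Leaf"] dias_coord_tree_class[of "RightOp Leaf Leaf"]
  by (simp_all add: left_product_def right_product_def tree_class_def numeral_2_eq_2)

lemma dias_products_basis: "left_product = dias_basis 2 1" "right_product = dias_basis 2 2"
proof -
  have i: "1 \<in> {1..2::nat}" "2 \<in> {1..2::nat}" by auto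
  show "left_product = dias_basis 2 1"
    by (rule Dias.coord_eqI[OF Dias_2(1) Dias.basis_Comp[OF i(1)]]) (simp only: Dias_2 Dias.coord_basis[OF i(1)])
  show "right_product = dias_basis 2 2"
    by (rule Dias.coord_eqI[OF Dias_2(3) Dias.basis_Comp[OF i(2)]]) (simp only: Dias_2 Dias.coord_basis[OF i(2)])
qed

lemma dias_circ_basis:
  assumes k: "1 \<le> k" "k \<le> m" and a: "a \<in> {1..m}" and b: "b \<in> {1..n}"
  shows "Circ Dias k (dias_basis m a) (dias_basis n b) =
    dias_basis (m + n - 1) (if a < k then a else if a = k then k - 1 + b else a + n - 1)"
    (is "_ = dias_basis _ ?d")
proof -
  have n: "1 \<le> n" using b by auto
  have d: "?d \<in> {1..m + n - 1}" using k a b by auto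
  note ab = Dias.basis_Comp[OF a] Dias.basis_Comp[OF b]
  show ?thesis
    by (rule Dias.coord_eqI[OF Dias.circ_Comp[OF k n ab] Dias.basis_Comp[OF d]])
      (simp only: Dias.coord_circ[OF k n ab] Dias.coord_basis[OF a] Dias.coord_basis[OF b]
        Dias.coord_basis[OF d] vcirc_basis_vec[OF k a b])
qed

lemma vact_long_cycle_1:
  assumes "v \<in> vecs 1"
  shows "vact (long_cycle 1) v i = - v i"
proof -
  have "v (Suc (Suc 0)) = - v (Suc 0)" using vecs_last[OF assms] by (simp add: numeral_2_eq_2)
  moreover have "v i = 0" if "i \<notin> {1, 2}" using vecs_0[OF assms, of i] that by auto
  ultimately show ?thesis by (auto simp: vact_long_cycle)
qed

text \<open>\<open>dias_tau\<close> is introduced by a choice. The rotation of coordinates is a witness, so the chosen function has the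
  properties required by its definition.\<close>

lemma dias_tau_spec:
  "ns_anticyclic Dias dias_tau" "x \<in> Comp Dias 1 \<Longrightarrow> dias_tau 1 x = - x"
  "dias_tau 2 left_product = - right_product"
  "dias_tau 2 right_product = left_product - right_product"
proof -
  define \<tau> where "\<tau> n x = Dias.of_vec n (vact (long_cycle n) (dias_coord n x))" for n x
  have \<tau>: "\<tau> n x \<in> Comp Dias n" for n x unfolding \<tau>_def by (rule Dias.of_vec_Comp)
  have c: "dias_coord n (\<tau> n x) = vact (long_cycle n) (dias_coord n x)" if "x \<in> Comp Dias n" for n x
    unfolding \<tau>_def by (rule Dias.coord_of_vec[OF vact_vecs[OF long_cycle_permutes Dias.coord_vecs[OF that]]])
  have 1: "ns_anticyclic Dias \<tau>" by (rule Dias.anticyclic_rotation) (use \<tau> c in auto)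
  have 2: "\<tau> 1 x = - x" if x: "x \<in> Comp Dias 1" for x
    using \<tau> Dias.neg_Comp[OF x]
    by (rule Dias.coord_eqI) (simp only: c[OF x] Dias.coord_neg[OF x] vact_long_cycle_1[OF Dias.coord_vecs[OF x]])
  have 3: "\<tau> 2 left_product = - right_product"
    using \<tau> Dias.neg_Comp[OF Dias_2(3)]
    by (rule Dias.coord_eqI)
      (auto simp: c[OF Dias_2(1)] Dias.coord_neg[OF Dias_2(3)] Dias_2 vact_long_cycle basis_vec_def)
  have "\<tau> 2 right_product = left_product - right_product"
    using \<tau> ratv.subspace_diff[OF subspace_Dias Dias_2(1,3)]
    by (rule Dias.coord_eqI)
      (auto simp: c[OF Dias_2(3)] dias_coord_diff Dias_2 vact_long_cycle basis_vec_def)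
  then have "\<exists>\<tau>. ns_anticyclic Dias \<tau> \<and> (\<forall>x\<in>Comp Dias 1. \<tau> 1 x = - x) \<and>
     \<tau> 2 left_product = - right_product \<and> \<tau> 2 right_product = left_product - right_product"
    using 1 2 3 by auto
  from someI_ex[OF this] show "ns_anticyclic Dias dias_tau"
    "x \<in> Comp Dias 1 \<Longrightarrow> dias_tau 1 x = - x" "dias_tau 2 left_product = - right_product"
    "dias_tau 2 right_product = left_product - right_product"
    unfolding dias_tau_def[symmetric] by blast+
qed

lemma dias_tau_Comp: "1 \<le> n \<Longrightarrow> x \<in> Comp Dias n \<Longrightarrow> dias_tau n x \<in> Comp Dias n"
  using dias_tau_spec(1) unfolding ns_anticyclic_def by blast

lemma dias_basis_decompose:
  assumes n: "2 \<le> n" and j: "j \<in> {1..Suc n}"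
  obtains i b where "i \<in> {1..n}" "b \<in> {1..2}" "dias_basis (Suc n) j = Circ Dias 2 (dias_basis n i) (dias_basis 2 b)"
proof -
  define i where "i = (if j \<le> 2 then j else j - 1)"
  define b :: nat where "b = (if j \<le> 2 then 1 else 2)"
  have i: "i \<in> {1..n}" and b: "b \<in> {1..2}" using n j by (auto simp: i_def b_def)
  have "(if i < 2 then i else if i = 2 then 2 - 1 + b else i + 2 - 1) = j"
    using j by (auto simp: i_def b_def)
  then have "dias_basis (Suc n) j = Circ Dias 2 (dias_basis n i) (dias_basis 2 b)"
    using dias_circ_basis[OF _ n i b] by simp
  then show thesis using that i b by blast
qed

text \<open>By induction on the arity, the chosen function can only be the rotation: above arity \<open>2\<close> each basis element
  is of the form \<open>f \<circ>\<^sub>2 g\<close>, and \<open>\<tau>(f \<circ>\<^sub>2 g) = \<tau>(f) \<circ>\<^sub>1 g\<close>.\<close>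

lemma dias_coord_tau:
  assumes "1 \<le> n" and x: "x \<in> Comp Dias n"
  shows "dias_coord n (dias_tau n x) = vact (long_cycle n) (dias_coord n x)"
proof -
  have lin: "lin_on (Comp Dias n) (dias_tau n)" if "1 \<le> n" for n
    using dias_tau_spec(1) that unfolding ns_anticyclic_def by blast
  have tau: "dias_tau (m + n - 1) (Circ Dias i f g) = Circ Dias (i - 1) (dias_tau m f) g"
    if "1 \<le> m" "1 \<le> n" "f \<in> Comp Dias m" "g \<in> Comp Dias n" "i \<in> {2..m}" for m n i f g
    using dias_tau_spec(1) that unfolding ns_anticyclic_def tau_identities_def by blast
  have extend: "dias_coord n (dias_tau n x) = vact (long_cycle n) (dias_coord n x)"
    if n: "1 \<le> n" and basis: "\<And>i. i \<in> {1..n} \<Longrightarrow>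
      dias_coord n (dias_tau n (dias_basis n i)) = vact (long_cycle n) (dias_coord n (dias_basis n i))"
      and x: "x \<in> Comp Dias n" for n x
  proof -
    have scale: "dias_tau n (a *\<^sub>Q y) = a *\<^sub>Q dias_tau n y" if "y \<in> Comp Dias n" for a y
      using lin[OF n] that by (simp add: lin_on_def)
    have "dias_tau n (\<Sum>i\<in>A. y i) = (\<Sum>i\<in>A. dias_tau n (y i))"
      if "\<And>i. i \<in> A \<Longrightarrow> y i \<in> Comp Dias n" for A :: "nat set" and y
      using that
    proof (induction A rule: infinite_finite_induct)
      case (insert a A)
      then show ?case using lin[OF n] by (simp add: lin_on_def ratv.subspace_sum[OF subspace_Dias])
    qed (use scale[of 0 0] ratv.subspace_0[OF subspace_Dias] in simp_all)
    note sum = this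
    have tx: "dias_tau n (\<Sum>i\<in>{1..n}. dias_coord n x i *\<^sub>Q dias_basis n i) =
        (\<Sum>i\<in>{1..n}. dias_coord n x i *\<^sub>Q dias_tau n (dias_basis n i))"
      by (subst sum) (simp_all add: Dias.scale_Comp Dias.basis_Comp scale)
    show ?thesis
    proof
      fix p
      have "dias_coord n (dias_tau n x) p =
          dias_coord n (\<Sum>i\<in>{1..n}. dias_coord n x i *\<^sub>Q dias_tau n (dias_basis n i)) p"
        using tx Dias.expand[OF x] by simp
      also have "\<dots> = (\<Sum>i\<in>{1..n}. dias_coord n x i * vact (long_cycle n) (dias_coord n (dias_basis n i)) p)"
        by (subst Dias.coord_sum)
          (auto simp: Dias.scale_Comp dias_tau_Comp[OF n] Dias.basis_Comp dias_coord_scale basis)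
      also have "\<dots> = dias_coord n (\<Sum>i\<in>{1..n}. dias_coord n x i *\<^sub>Q dias_basis n i) (inv (long_cycle n) p)"
        by (subst Dias.coord_sum) (auto simp: Dias.scale_Comp Dias.basis_Comp dias_coord_scale vact_def)
      also have "\<dots> = vact (long_cycle n) (dias_coord n x) p"
        using Dias.expand[OF x] by (simp add: vact_def)
      finally show "dias_coord n (dias_tau n x) p = vact (long_cycle n) (dias_coord n x) p" .
    qed
  qed
  have arity_1: "dias_coord 1 (dias_tau 1 x) = vact (long_cycle 1) (dias_coord 1 x)"
    if x: "x \<in> Comp Dias 1" for x
    using vact_long_cycle_1[OF Dias.coord_vecs[OF x]]
    by (intro ext) (simp only: dias_tau_spec(2)[OF x] Dias.coord_neg[OF x])
  have arity_2: "dias_coord 2 (dias_tau 2 x) = vact (long_cycle 2) (dias_coord 2 x)"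
    if x: "x \<in> Comp Dias 2" for x
  proof (rule extend[OF _ _ x])
    fix i :: nat assume i: "i \<in> {1..2}"
    then consider "i = 1" | "i = 2" by fastforce
    then show "dias_coord 2 (dias_tau 2 (dias_basis 2 i)) = vact (long_cycle 2) (dias_coord 2 (dias_basis 2 i))"
    proof cases
      case 1
      then have "dias_basis 2 i = left_product" by (simp only: dias_products_basis)
      then show ?thesis
        by (auto simp: dias_tau_spec Dias.coord_neg[OF Dias_2(3)] Dias_2 vact_long_cycle basis_vec_def fun_eq_iff)
    next
      case 2
      then have "dias_basis 2 i = right_product" by (simp only: dias_products_basis)
      then show ?thesis
        by (auto simp: dias_tau_spec dias_coord_diff Dias_2 vact_long_cycle basis_vec_def fun_eq_iff)
    qed
  qed simp
  have "\<forall>x\<in>Comp Dias (Suc (Suc k)). dias_coord (Suc (Suc k)) (dias_tau (Suc (Suc k)) x) =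
      vact (long_cycle (Suc (Suc k))) (dias_coord (Suc (Suc k)) x)" for k
  proof (induction k)
    case 0
    then show ?case using arity_2 by (simp add: numeral_2_eq_2)
  next
    case (Suc k)
    define n where "n = Suc (Suc k)"
    have n: "2 \<le> n" "1 \<le> n" by (simp_all add: n_def)
    have IH: "dias_coord n (dias_tau n x) = vact (long_cycle n) (dias_coord n x)" if "x \<in> Comp Dias n" for x
      using Suc that by (simp add: n_def)
    have "dias_coord (Suc n) (dias_tau (Suc n) x) = vact (long_cycle (Suc n)) (dias_coord (Suc n) x)"
      if x: "x \<in> Comp Dias (Suc n)" for x
    proof (rule extend[OF _ _ x])
      fix j assume j: "j \<in> {1..Suc n}"
      obtain i b where i: "i \<in> {1..n}" and b: "b \<in> {1..2}"
        and e: "dias_basis (Suc n) j = Circ Dias 2 (dias_basis n i) (dias_basis 2 b)"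
        using dias_basis_decompose[OF n(1) j] by blast
      let ?f = "dias_basis n i" and ?g = "dias_basis 2 b"
      have fg: "?f \<in> Comp Dias n" "?g \<in> Comp Dias 2" by (rule Dias.basis_Comp[OF i] Dias.basis_Comp[OF b])+
      have "dias_tau (n + 2 - 1) (Circ Dias 2 ?f ?g) = Circ Dias (2 - 1) (dias_tau n ?f) ?g"
        by (rule tau) (use n fg in auto)
      then have "dias_coord (n + 2 - 1) (dias_tau (n + 2 - 1) (Circ Dias 2 ?f ?g)) =
          vcirc 2 (2 - 1) (vact (long_cycle n) (dias_coord n ?f)) (dias_coord 2 ?g)"
        using Dias.coord_circ[of "2 - 1" n 2 "dias_tau n ?f" ?g] n dias_tau_Comp[OF n(2) fg(1)] fg
        by (simp add: IH)
      also have "\<dots> = vact (long_cycle (n + 2 - 1)) (dias_coord (n + 2 - 1) (Circ Dias 2 ?f ?g))"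
        using vcirc_rotate[of 2 n 2 "dias_coord n ?f" "dias_coord 2 ?g"] n
          Dias.coord_circ[of 2 n 2 ?f ?g] fg by simp
      finally show "dias_coord (Suc n) (dias_tau (Suc n) (dias_basis (Suc n) j)) =
          vact (long_cycle (Suc n)) (dias_coord (Suc n) (dias_basis (Suc n) j))"
        by (simp add: e)
    qed simp
    then show ?case by (simp add: n_def)
  qed
  moreover have "n = 1 \<or> (\<exists>k. n = Suc (Suc k))" using assms(1) by (cases n; cases "n - 1") auto
  ultimately show ?thesis using arity_1 x by auto
qed

section \<open>Words and the symmetrization of Dias\<close>

lemma position_notin: "a \<notin> set w \<Longrightarrow> position a w = length w + 1"
proof -
  assume "a \<notin> set w"
  then have "takeWhile (\<lambda>b. b \<noteq> a) w = w" by (auto simp: takeWhile_eq_all_conv)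
  then show ?thesis by (metis position_def Suc_eq_plus1)
qed

lemma position_append:
  "position a (xs @ ys) = (if a \<in> set xs then position a xs else length xs + position a ys)"
proof (cases "a \<in> set xs")
  case True
  then show ?thesis using takeWhile_append1[of a xs "\<lambda>b. b \<noteq> a" ys] by (simp add: position_def)
next
  case False
  then have "takeWhile (\<lambda>b. b \<noteq> a) (xs @ ys) = xs @ takeWhile (\<lambda>b. b \<noteq> a) ys"
    by (intro takeWhile_append2) auto
  then show ?thesis using False by (simp add: position_def)
qed

lemma position_Cons: "position a (b # ys) = (if a = b then 1 else position a ys + 1)"
  by (simp add: position_def)

lemma position_map:
  assumes "\<And>b. b \<in> set w \<Longrightarrow> h b = h a \<longleftrightarrow> b = a"
  shows "position (h a) (map h w) = position a w"
  using assms
proof (induction w)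
  case (Cons b w)
  have "h a = h b \<longleftrightarrow> a = b" using Cons.prems[of b] by auto
  moreover have "position (h a) (map h w) = position a w" by (rule Cons.IH) (use Cons.prems in simp)
  ultimately show ?case by (simp only: list.map position_Cons)
qed (simp add: position_def)

lemma position_range: "position a w \<in> {1..length w + 1}"
  using length_takeWhile_le[of "\<lambda>b. b \<noteq> a" w] by (simp add: position_def)

lemma position_nth: "distinct w \<Longrightarrow> j < length w \<Longrightarrow> position (w ! j) w = j + 1"
proof (induction w arbitrary: j)
  case (Cons b w)
  then show ?case by (cases j) (auto simp: position_Cons)
qed simp

lemma nth_position: "a \<in> set w \<Longrightarrow> w ! (position a w - 1) = a"
  by (induction w) (auto simp: position_Cons, simp add: position_def)

lemma position_in: "a \<in> set w \<Longrightarrow> position a w \<in> {1..length w}"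
  using position_le by (auto simp: position_def)

lemma permutation_word:
  assumes "w \<in> permutations_of_set {1..n}"
  shows "set w = {1..n}" "distinct w" "length w = n"
  using assms permutations_of_setD length_finite_permutations_of_set by fastforce+

lemma bij_betw_position:
  assumes w: "w \<in> permutations_of_set {1..n}"
  shows "bij_betw (\<lambda>a. position a w) {1..n} {1..n}" "bij_betw (\<lambda>j. w ! (j - 1)) {1..n} {1..n}"
proof -
  note w = permutation_word[OF w]
  have inverse: "\<forall>a\<in>{1..n}. w ! (position a w - 1) = a" "\<forall>j\<in>{1..n}. position (w ! (j - 1)) w = j"
    using nth_position[of _ w] position_nth[of w] w by auto
  have range: "(\<lambda>a. position a w) ` {1..n} \<subseteq> {1..n}" using position_in[of _ w] w by auto
  have range': "(\<lambda>j. w ! (j - 1)) ` {1..n} \<subseteq> {1..n}"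
  proof clarify
    fix j :: nat assume "j \<in> {1..n}"
    then have "j - 1 < length w" using w by auto
    then show "w ! (j - 1) \<in> {1..n}" using nth_mem w(1) by blast
  qed
  show "bij_betw (\<lambda>a. position a w) {1..n} {1..n}"
    by (rule bij_betw_byWitness[OF inverse range range'])
  show "bij_betw (\<lambda>j. w ! (j - 1)) {1..n} {1..n}"
    by (rule bij_betw_byWitness[OF inverse(2,1) range' range])
qed

text \<open>If \<open>v\<close> are the coordinates of \<open>E\<close>, these are the coordinates of \<open>E(x\<^bsub>w\<^sub>1\<^esub>, \<dots>, x\<^bsub>w\<^sub>n\<^esub>)\<close>: the entry
  at a letter is the entry of \<open>v\<close> at its position. The letter \<open>n + 1\<close>, which does not occur in \<open>w\<close>, has
  position \<open>n + 1\<close>, so the last entry is kept.\<close>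

definition word_vec :: "nat \<Rightarrow> nat list \<Rightarrow> (nat \<Rightarrow> rat) \<Rightarrow> nat \<Rightarrow> rat" where
  "word_vec n w v a = (if a \<in> {1..n + 1} then v (position a w) else 0)"

lemma word_vec_vecs:
  assumes w: "w \<in> permutations_of_set {1..n}" and v: "v \<in> vecs n"
  shows "word_vec n w v \<in> vecs n"
proof -
  have last: "position (n + 1) w = n + 1"
    using position_notin[of "n + 1" w] permutation_word[OF w] by simp
  have "(\<Sum>a\<in>{1..n}. v (position a w)) = (\<Sum>j\<in>{1..n}. v j)"
    by (rule sum.reindex_bij_betw[OF bij_betw_position(1)[OF w]])
  then show ?thesis using v last by (simp add: vecs_def word_vec_def)
qed

lemma word_vec_apply: "a \<in> {1..n + 1} \<Longrightarrow> word_vec n w v a = v (position a w)"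
  and word_vec_out: "a \<notin> {1..n + 1} \<Longrightarrow> word_vec n w v a = 0"
  unfolding word_vec_def by (simp_all only: if_True if_False)

text \<open>Replacing the letter \<open>k\<close> by the word \<open>v\<close> while composing at its position is composition at \<open>k\<close> in the
  letter coordinates: the letters other than \<open>k\<close> are renumbered by \<open>s\<close>, and both their position and the
  renumbering skip the same number of places.\<close>

lemma word_vec_circ:
  assumes w: "w \<in> permutations_of_set {1..m}" and v: "v \<in> permutations_of_set {1..n}"
    and k: "1 \<le> k" "k \<le> m" and n: "1 \<le> n" and x: "x \<in> vecs m" and y: "y \<in> vecs n"
  shows "word_vec (m + n - 1) (subst_word k w v) (vcirc n (position k w) x y) =
    vcirc n k (word_vec m w x) (word_vec n v y)"
proof
  fix p
  note W = permutation_word[OF w] and V = permutation_word[OF v]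
  have "k \<in> set w" using W k by simp
  then obtain w1 w2 where w12: "w = w1 @ k # w2" by (meson split_list)
  have kn: "k \<notin> set w1" "k \<notin> set w2" using W(2) w12 by auto
  define s where "s a = (if a < k then a else a + n - 1)" for a
  have s_inj: "s a = s b \<longleftrightarrow> a = b" if "a \<noteq> k" "b \<noteq> k" for a b
    using that n by (auto simp: s_def)
  have s_out: "s a \<notin> {k..<k + n}" if "a \<noteq> k" for a using that n by (auto simp: s_def)
  let ?b = "map (\<lambda>b. k - 1 + b) v" and ?u = "subst_word k w v"
  have "concat (map (\<lambda>a. if a < k then [a] else if a = k then ?b else [a + length v - 1]) ws) = map s ws"
    if "k \<notin> set ws" for ws
    using that V(3) by (induction ws) (auto simp: s_def)
  then have u: "?u = map s w1 @ ?b @ map s w2"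
    using kn by (simp add: subst_word_def w12)
  have bset: "set ?b = {k..<k + n}"
  proof -
    have "set ?b = (\<lambda>b. k - 1 + b) ` {1..n}" using V(1) by simp
    also have "\<dots> = {k - 1 + 1..k - 1 + n}" by (simp add: image_add_atLeastAtMost add.commute)
    also have "\<dots> = {k..<k + n}" using k by auto
    finally show ?thesis .
  qed
  have q: "position k w = length w1 + 1" using kn by (simp add: w12 position_append position_Cons)
  have pos_s: "position (s a) (map s ws) = position a ws" if "a \<noteq> k" "k \<notin> set ws" for a ws
    by (rule position_map) (use s_inj that in metis)
  have s_mem: "s a \<in> set (map s ws) \<longleftrightarrow> a \<in> set ws" if "a \<noteq> k" "k \<notin> set ws" for a ws
    using s_inj that by (metis (no_types, lifting) imageE image_eqI set_map)
  have pos_u: "position (s a) ?u =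
      (if a \<in> set w1 then position a w1 else length w1 + n + position a w2)" if "a \<noteq> k" for a
  proof -
    have "s a \<notin> set ?b" using s_out[OF that] by (simp only: bset not_False_eq_True)
    then show ?thesis using that kn by (simp add: u position_append pos_s s_mem V(3) del: set_map)
  qed
  have pos_w: "position a w =
      (if a \<in> set w1 then position a w1 else length w1 + 1 + position a w2)" if "a \<noteq> k" for a
    using that by (simp add: w12 position_append position_Cons)
  have last: "word_vec n v y (n + 1) = y (n + 1)"
    using position_notin[of "n + 1" v] V by (simp add: word_vec_def)
  have at_k: "word_vec m w x k = x (position k w)" using k by (simp add: word_vec_def)
  have outer: "vcirc n (position k w) x y (position (s a) ?u) = - y (n + 1) * x (position a w)" if a: "a \<noteq> k" for a
  proof (cases "a \<in> set w1")
    case True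
    then have "position a w1 < position k w" using position_in[OF True] by (simp add: q)
    then show ?thesis using True by (simp add: pos_u[OF a] pos_w[OF a] vcirc_def)
  next
    case False
    have "position a w2 \<ge> 1" using position_range[of a w2] by simp
    then have "\<not> length w1 + n + position a w2 < position k w" "\<not> length w1 + n + position a w2 < position k w + n"
      "length w1 + n + position a w2 + 1 - n = length w1 + 1 + position a w2" by (auto simp: q)
    then show ?thesis using False by (simp add: pos_u[OF a] pos_w[OF a] vcirc_def)
  qed
  have wx: "word_vec m w x a = 0" if "a \<notin> {1..m + 1}" for a using that by (rule word_vec_out)
  consider "p = 0" | "1 \<le> p" "p < k" | "k \<le> p" "p < k + n" | "k + n \<le> p" "p \<le> m + n" | "m + n < p" by linarith
  then show "word_vec (m + n - 1) ?u (vcirc n (position k w) x y) p = vcirc n k (word_vec m w x) (word_vec n v y) p"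
  proof cases
    case 1
    then show ?thesis using k by (simp add: word_vec_def vcirc_def)
  next
    case 2
    then have "s p = p" "p \<noteq> k" "p \<in> {1..m + n - 1 + 1}" "p \<in> {1..m + 1}" using k by (auto simp: s_def)
    then show ?thesis using 2 outer[of p]
      by (simp only: word_vec_apply vcirc_def[of n k] last if_True not_False_eq_True simp_thms)
  next
    case 3
    define b where "b = p + 1 - k"
    have b: "b \<in> {1..n}" "p = k - 1 + b" using 3 k by (auto simp: b_def)
    have "p \<notin> set (map s w1)" using s_out kn 3 by fastforce
    moreover have "p \<in> set ?b" using 3 by (simp only: bset) simp
    moreover have "position p ?b = position b v" unfolding b(2) by (rule position_map) simp
    ultimately have "position p ?u = length w1 + position b v"
      by (simp only: u position_append if_True if_False length_map)
    moreover have "position b v \<in> {1..n}" using position_in[of b v] V b by simp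
    ultimately have "vcirc n (position k w) x y (position p ?u) = x (position k w) * y (position b v)"
      by (auto simp: vcirc_def q)
    moreover have "p \<in> {1..m + n - 1 + 1}" "b \<in> {1..n + 1}" using 3 k b by auto
    moreover have "\<not> p < k" using 3 by simp
    ultimately show ?thesis using 3
      by (simp only: word_vec_apply vcirc_def[of n k] at_k if_True if_False b_def[symmetric])
  next
    case 4
    define a where "a = p + 1 - n"
    have a: "s a = p" "a \<noteq> k" "a \<in> {1..m + 1}" using 4 k n by (auto simp: s_def a_def)
    moreover have "p \<in> {1..m + n - 1 + 1}" "\<not> p < k" "\<not> p < k + n" using 4 n k by auto
    ultimately show ?thesis using outer[of a]
      by (simp only: word_vec_apply vcirc_def[of n k] last if_False a_def[symmetric] simp_thms)
  next
    case 5
    then have "p \<notin> {1..m + n - 1 + 1}" "\<not> p < k" "\<not> p < k + n" "p + 1 - n \<notin> {1..m + 1}"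
      using n k by auto
    then show ?thesis
      using word_vec_out[of p "m + n - 1"] wx[of "p + 1 - n"] by (simp only: vcirc_def[of n k] if_False) simp
  qed
qed

lemma word_vec_map:
  assumes \<sigma>: "\<sigma> permutes {1..n}"
  shows "word_vec n (map \<sigma> w) v = vact \<sigma> (word_vec n w v)"
proof (rule vact_eqI[OF permutes_bij[OF \<sigma>], symmetric])
  fix a
  have "position (\<sigma> a) (map \<sigma> w) = position a w"
    by (rule position_map) (use permutes_inj[OF \<sigma>] in \<open>auto dest: injD\<close>)
  moreover have "\<sigma> permutes {1..n + 1}" using permutes_subset[OF \<sigma>] by auto
  ultimately show "word_vec n (map \<sigma> w) v (\<sigma> a) = word_vec n w v a"
    using permutes_in_image[of \<sigma> "{1..n + 1}" a] by (simp only: word_vec_def)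
qed

text \<open>These coordinates only see which letter is marked. They will become coordinates on \<open>Perm\<close>.\<close>

definition word_coord :: "nat \<Rightarrow> (nat list \<Rightarrow>\<^sub>0 dias) \<Rightarrow> nat \<Rightarrow> rat" where
  "word_coord n f a = (\<Sum>w\<in>keys f. word_vec n w (dias_coord n (lookup f w)) a)"

lemma word_coord_add: "word_coord n (f + g) a = word_coord n f a + word_coord n g a"
  unfolding word_coord_def by (rule sum_keys_add) (simp add: word_vec_def dias_coord_add)

lemma word_coord_scale: "word_coord n (c *\<^sub>Q f) a = c * word_coord n f a"
  unfolding word_coord_def
  by (subst sum_keys_scale) (simp_all add: word_vec_def dias_coord_scale dias_coord_zero scaleQ_rat_def)

lemma word_coord_diff: "word_coord n (f - g) a = word_coord n f a - word_coord n g a"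
  using word_coord_add[of n "f - g" g a] by simp

lemma word_coord_zero: "word_coord n 0 a = 0"
  by (simp add: word_coord_def)

lemma word_coord_sum: "word_coord n (\<Sum>x\<in>A. F x) a = (\<Sum>x\<in>A. word_coord n (F x) a)"
  by (induction A rule: infinite_finite_induct) (auto simp: word_coord_add word_coord_zero)

lemma word_coord_single:
  "word_coord n (Poly_Mapping.single w x) a = word_vec n w (dias_coord n x) a"
  by (simp add: word_coord_def word_vec_def dias_coord_zero)

lemma SymDias_keys:
  assumes "f \<in> Comp SymDias n"
  shows "w \<in> keys f \<Longrightarrow> w \<in> permutations_of_set {1..n}" "lookup f w \<in> Comp Dias n"
  using assms by (auto simp: SymDias_simps)

lemma word_coord_vecs:
  assumes f: "f \<in> Comp SymDias n"
  shows "word_coord n f \<in> vecs n"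
proof -
  have "(\<lambda>a. \<Sum>w\<in>A. word_vec n w (dias_coord n (lookup f w)) a) \<in> vecs n" if "A \<subseteq> keys f" for A
    using finite_subset[OF that finite_keys] that
  proof (induction A rule: finite_induct)
    case (insert w A)
    then have "word_vec n w (dias_coord n (lookup f w)) \<in> vecs n"
      by (intro word_vec_vecs Dias.coord_vecs) (use SymDias_keys[OF f] in auto)
    then show ?case using insert by (simp add: vecs_add)
  qed (simp add: vecs_zero)
  then show ?thesis unfolding word_coord_def by blast
qed

lemma word_coord_other: "f \<in> Comp SymDias m \<Longrightarrow> m \<noteq> n \<Longrightarrow> word_coord n f a = 0"
  unfolding word_coord_def
  by (rule sum.neutral) (auto simp: word_vec_def dias_coord_other[OF SymDias_keys(2)])

lemma word_coord_circ:
  assumes k: "1 \<le> k" "k \<le> m" and n: "1 \<le> n" and f: "f \<in> Comp SymDias m" and g: "g \<in> Comp SymDias n"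
  shows "word_coord (m + n - 1) (symc_circ Dias k f g) = vcirc n k (word_coord m f) (word_coord n g)"
proof
  fix p
  have "word_coord (m + n - 1) (symc_circ Dias k f g) p = (\<Sum>w\<in>keys f. \<Sum>v\<in>keys g.
      vcirc n k (word_vec m w (dias_coord m (lookup f w))) (word_vec n v (dias_coord n (lookup g v))) p)"
    unfolding symc_circ_def word_coord_sum
  proof (intro sum.cong refl)
    fix w v assume "w \<in> keys f" "v \<in> keys g"
    then have w: "w \<in> permutations_of_set {1..m}" and v: "v \<in> permutations_of_set {1..n}"
      using SymDias_keys f g by blast+
    note E = SymDias_keys(2)[OF f, of w] and F = SymDias_keys(2)[OF g, of v]
    have kw: "k \<in> set w" using permutation_word(1)[OF w] k by simp
    have pos: "1 \<le> position k w" "position k w \<le> m"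
      using position_in[OF kw] permutation_word(3)[OF w] by auto
    show "word_coord (m + n - 1) (if k \<in> set w then Poly_Mapping.single (subst_word k w v)
        (Circ Dias (position k w) (lookup f w) (lookup g v)) else 0) p =
      vcirc n k (word_vec m w (dias_coord m (lookup f w))) (word_vec n v (dias_coord n (lookup g v))) p"
      using kw by (simp only: if_True word_coord_single Dias.coord_circ[OF pos n E F]
          word_vec_circ[OF w v k n Dias.coord_vecs[OF E] Dias.coord_vecs[OF F]])
  qed
  also have "\<dots> = vcirc n k (word_coord m f) (word_coord n g) p"
    unfolding vcirc_sum[symmetric] by (simp add: word_coord_def[abs_def])
  finally show "word_coord (m + n - 1) (symc_circ Dias k f g) p = vcirc n k (word_coord m f) (word_coord n g) p" .
qed

lemma word_coord_act:
  assumes "\<sigma> permutes {1..n}"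
  shows "word_coord n (symc_act \<sigma> f) = vact \<sigma> (word_coord n f)"
  unfolding symc_act_def word_coord_sum[abs_def] word_coord_single word_vec_map[OF assms]
  by (simp add: vact_def word_coord_def fun_eq_iff)

lemma word_coord_relation: "word_coord n perm_relation a = 0"
proof (cases "n = 2")
  case True
  then show ?thesis
    by (auto simp: perm_relation_def word_coord_diff word_coord_single word_vec_def Dias_2 basis_vec_def position_Cons)
      (auto simp: position_def)
next
  case False
  then have "dias_coord n left_product = (\<lambda>_. 0)" "dias_coord n right_product = (\<lambda>_. 0)"
    using dias_coord_other[OF Dias_2(1)] dias_coord_other[OF Dias_2(3)] by (auto intro!: ext)
  then show ?thesis by (simp add: perm_relation_def word_coord_diff word_coord_single word_vec_def)
qed

lemma SymDias_act: "Act SymDias n = symc_act"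
  by (simp add: SymDias_def symmetrization_def)

lemma sym_ideal_SymDias_Comp: "sym_ideal SymDias R n x \<Longrightarrow> x \<in> Comp SymDias n"
  by (rule sym_ideal_sub[OF SymDias.total_circ_axioms subspace_SymDias])
    (auto simp: SymDias_act intro: symc_act_closed)

text \<open>The coordinates are compatible with all the operations that generate the ideal, and they vanish on its
  generator because \<open>x\<^sub>1 \<stileturn> x\<^sub>2\<close> and \<open>x\<^sub>2 \<turnstile> x\<^sub>1\<close> both point to \<open>x\<^sub>1\<close>.\<close>

lemma word_coord_sym_ideal:
  assumes "sym_ideal SymDias {perm_relation} n x"
  shows "word_coord n x = (\<lambda>_. 0)"
  using assms
proof induction
  case (5 i m n x y)
  then show ?case
    using word_coord_circ[OF 5(1-3) sym_ideal_SymDias_Comp[OF 5(4)] 5(5)]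
    by (simp only: SymDias_simps vcirc_zero)
next
  case (6 i m n x y)
  then show ?case
    using word_coord_circ[OF 6(1-4) sym_ideal_SymDias_Comp[OF 6(5)]]
    by (simp only: SymDias_simps vcirc_zero)
next
  case (7 n \<sigma> x)
  then show ?case by (simp add: SymDias_act word_coord_act vact_def comp_def)
qed (auto simp: word_coord_relation word_coord_zero word_coord_add word_coord_scale)

lemma word_coord_perm_ideal:
  assumes "x \<in> perm_ideal"
  shows "word_coord n x a = 0"
  using assms unfolding perm_ideal_def sym_ideal_total_def
proof (induction rule: ratv.span_induct_alt)
  case (step c x y)
  then obtain m where x: "sym_ideal SymDias {perm_relation} m x" by auto
  have "word_coord n x a = 0"
  proof (cases "m = n")
    case False
    then show ?thesis using word_coord_other sym_ideal_SymDias_Comp[OF x] by blast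
  qed (use word_coord_sym_ideal[OF x] in simp)
  then show ?case using step by (simp add: word_coord_add word_coord_scale)
qed (simp add: word_coord_zero)

section \<open>The ideal defining Perm\<close>

text \<open>Insertion sort only exchanges neighbours.\<close>

lemma sort_by_adjacent_swaps:
  fixes R :: "'b::linorder list \<Rightarrow> 'b list \<Rightarrow> bool"
  assumes refl: "\<And>w. R w w" and trans: "\<And>u v w. R u v \<Longrightarrow> R v w \<Longrightarrow> R u w"
    and swap: "\<And>xs a b ys. mset (xs @ a # b # ys) = M \<Longrightarrow> R (xs @ a # b # ys) (xs @ b # a # ys)"
    and "mset w = M"
  shows "R w (sort w)"
proof -
  have insort: "R (xs @ a # w) (xs @ insort a w)" if "mset (xs @ a # w) = M" for xs a w
    using that
  proof (induction w arbitrary: xs)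
    case (Cons b w)
    have "mset ((xs @ [b]) @ a # w) = M" using Cons.prems by (simp add: add_mset_commute)
    from Cons.IH[OF this] have "R (xs @ b # a # w) (xs @ b # insort a w)" by simp
    then show ?case using swap[OF Cons.prems] refl trans by (auto intro: trans)
  qed (simp add: refl)
  have "R (xs @ w) (xs @ sort w)" if "mset (xs @ w) = M" for xs
    using that
  proof (induction w arbitrary: xs)
    case (Cons a w)
    have "R ((xs @ [a]) @ w) ((xs @ [a]) @ sort w)" by (rule Cons.IH) (use Cons.prems in simp)
    then have "R (xs @ a # w) (xs @ a # sort w)" by simp
    moreover have "R (xs @ a # sort w) (xs @ insort a (sort w))"
      by (rule insort) (use Cons.prems in simp)
    ultimately show ?case by (auto intro: trans)
  qed (simp add: refl)
  from this[of "[]"] show ?thesis using assms(4) by simp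
qed

lemma sym_ideal_perm_ideal: "sym_ideal SymDias {perm_relation} n x \<Longrightarrow> x \<in> perm_ideal"
  unfolding perm_ideal_def sym_ideal_total_def by (rule ratv.span_base) auto

lemma perm_relation_ideal: "sym_ideal SymDias {perm_relation} 2 perm_relation"
proof (rule sym_ideal.intros(1))
  have "[1, 2] \<in> permutations_of_set {1..2::nat}" "[2, 1] \<in> permutations_of_set {1..2::nat}"
    by (auto simp: permutations_of_set_def)
  then show "perm_relation \<in> Comp SymDias 2"
    unfolding perm_relation_def
    by (intro ratv.subspace_diff[OF subspace_SymDias] single_in_SymDias Dias_2)
qed simp

text \<open>The word \<open>w\<close> in which the letter \<open>c\<close> is the middle argument.\<close>

definition marked_word :: "nat \<Rightarrow> nat \<Rightarrow> nat list \<Rightarrow> (nat list \<Rightarrow>\<^sub>0 dias)" where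
  "marked_word n c w = Poly_Mapping.single w (dias_basis n (position c w))"

lemma symc_circ_single:
  assumes "k \<in> set w"
  shows "symc_circ Dias k (Poly_Mapping.single w x) (Poly_Mapping.single v y) =
    Poly_Mapping.single (subst_word k w v) (Circ Dias (position k w) x y)"
proof -
  have z: "Circ Dias j 0 y = 0" "Circ Dias j x 0 = 0" for j and x y :: dias
    using dias_circ_bilinear(3)[of j 0 0 y] dias_circ_bilinear(4)[of j x 0 0] by (simp_all add: Circ_Dias)
  show ?thesis using assms by (auto simp: symc_circ_def z)
qed

lemma subst_identity_word:
  assumes "1 \<le> p" "p < n"
  shows "subst_word p [1..<n] [b, c] = [1..<p] @ [p - 1 + b, p - 1 + c] @ [p + 2..<n + 1]"
proof -
  have split: "[1..<n] = [1..<p] @ p # [p + 1..<n]"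
    using assms upt_add_eq_append[of 1 p "n - p"] by (simp add: upt_conv_Cons)
  define B where "B a = (if a < p then [a] else if a = p then map (\<lambda>b. p - 1 + b) [b, c] else [a + length [b, c] - 1])" for a
  have "concat (map B ws) = ws" if "\<forall>a\<in>set ws. a < p" for ws
    using that by (induction ws) (auto simp: B_def)
  then have lower: "concat (map B [1..<p]) = [1..<p]" by simp
  have "concat (map B ws) = map Suc ws" if "\<forall>a\<in>set ws. a > p" for ws
    using that by (induction ws) (auto simp: B_def)
  then have upper: "concat (map B [p + 1..<n]) = map Suc [p + 1..<n]" by simp
  have "B p = [p - 1 + b, p - 1 + c]" by (simp add: B_def)
  then have "concat (map B [1..<n]) = [1..<p] @ [p - 1 + b, p - 1 + c] @ map Suc [p + 1..<n]"
    by (simp only: split map_append list.map concat_append concat.simps lower upper)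
  also have "concat (map B [1..<n]) = subst_word p [1..<n] [b, c]"
    unfolding subst_word_def B_def ..
  finally show ?thesis by (simp add: map_Suc_upt)
qed

text \<open>Both words arise from composing the generator of the ideal into a word of length \<open>n - 1\<close> at place \<open>p\<close> and
  renaming the letters; \<open>i\<close> is the position of the mark before the composition. If the mark is at \<open>p\<close>, then
  \<open>\<stileturn>\<close> puts it on the left and \<open>\<turnstile>\<close> on the right of the two new letters, in both cases on \<open>a\<close>.\<close>

lemma marked_word_swap_aux:
  assumes w: "xs @ a # b # ys \<in> permutations_of_set {1..n}" and c: "c \<in> {1..n}" "c \<noteq> b"
  shows "marked_word n c (xs @ a # b # ys) - marked_word n c (xs @ b # a # ys) \<in> perm_ideal"
proof -
  let ?w = "xs @ a # b # ys" and ?w' = "xs @ b # a # ys"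
  note W = permutation_word[OF w]
  define p where "p = length xs + 1"
  have p: "1 \<le> p" "p < n" using W(3) by (auto simp: p_def)
  have n: "n = p + 1 + length ys" using W(3) by (simp add: p_def)
  define j where "j = position c ?w"
  define i where "i = (if j \<le> p then j else j - 1)"
  have "c \<in> set ?w" using c(1) by (simp only: W(1))
  then have cw: "c = a \<or> c \<in> set xs \<or> c \<in> set ys" using c(2) by auto
  have j_cases: "c = a \<and> j = p \<or> c \<noteq> a \<and> j < p \<and> j \<ge> 1 \<or> c \<noteq> a \<and> p + 1 < j \<and> j \<le> n"
  proof -
    have "c \<in> set xs \<Longrightarrow> position c xs \<in> {1..length xs}" "c \<in> set ys \<Longrightarrow> position c ys \<in> {1..length ys}"
      by (rule position_in; assumption)+
    then show ?thesis
      using cw c(2) W(2) by (elim disjE) (auto simp: j_def n p_def position_append position_Cons)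
  qed
  have j': "position c ?w' = (if c = a then p + 1 else j)"
    using cw c(2) W(2) by (elim disjE) (auto simp: j_def p_def position_append position_Cons)
  have i: "i \<in> {1..n - 1}" using j_cases p by (auto simp: i_def)
  let ?I = "[1..<n]"
  have I: "?I \<in> permutations_of_set {1..n - 1}"
    using p by (auto simp: permutations_of_set_def)
  have pI: "p \<in> set ?I" and posI: "position p ?I = p"
    using p position_nth[of ?I "p - 1"] by auto
  \<comment> \<open>The composition replaces the letter \<open>p\<close> of the identity word by \<open>p, p + 1\<close> or by \<open>p + 1, p\<close>.\<close>
  define x where "x = symc_circ Dias p (Poly_Mapping.single ?I (dias_basis (n - 1) i)) perm_relation"
  have x_ideal: "sym_ideal SymDias {perm_relation} n x"
  proof -
    have "sym_ideal SymDias {perm_relation} (n - 1 + 2 - 1)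
        (Circ SymDias p (Poly_Mapping.single ?I (dias_basis (n - 1) i)) perm_relation)"
      by (rule sym_ideal.intros(6)[OF _ _ _ single_in_SymDias[OF I Dias.basis_Comp[OF i]] perm_relation_ideal])
        (use p in auto)
    then show ?thesis using p by (simp add: x_def SymDias_simps)
  qed
  have circ: "Circ Dias p (dias_basis (n - 1) i) (dias_basis 2 b) =
      dias_basis n (if i < p then i else if i = p then p - 1 + b else i + 1)" if "b \<in> {1..2}" for b
    using dias_circ_basis[OF p(1) _ i that] p by simp
  have diff: "symc_circ Dias p y (u - v) = symc_circ Dias p y u - symc_circ Dias p y v" for y u v
    using SymDias.circ_add_right[of p y "u - v" v] by (simp add: SymDias_simps)
  have left: "(if i < p then i else if i = p then p - 1 + 1 else i + 1) = position c ?w"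
    using j_cases p by (auto simp: i_def j_def[symmetric])
  have right: "(if i < p then i else if i = p then p - 1 + 2 else i + 1) = position c ?w'"
    using j_cases p unfolding j' by (auto simp: i_def)
  have 12: "1 \<in> {1..2::nat}" "2 \<in> {1..2::nat}" by auto
  have words: "[p - 1 + 1, p - 1 + 2] = [p, p + 1]" "[p - 1 + 2, p - 1 + 1] = [p + 1, p]" using p by auto
  have x: "x = Poly_Mapping.single ([1..<p] @ [p, p + 1] @ [p + 2..<n + 1]) (dias_basis n (position c ?w))
      - Poly_Mapping.single ([1..<p] @ [p + 1, p] @ [p + 2..<n + 1]) (dias_basis n (position c ?w'))"
    unfolding x_def perm_relation_def dias_products_basis diff symc_circ_single[OF pI] posI
      circ[OF 12(1)] circ[OF 12(2)] subst_identity_word[OF p] left right words ..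
  \<comment> \<open>This renaming turns the identity word into \<open>?w\<close>.\<close>
  define \<sigma> where "\<sigma> a = (if a \<in> {1..n} then ?w ! (a - 1) else a)" for a
  have \<sigma>: "\<sigma> permutes {1..n}"
  proof (rule bij_imp_permutes)
    have "bij_betw (\<lambda>j. ?w ! (j - 1)) {1..n} {1..n}" by (rule bij_betw_position(2)[OF w])
    then show "bij_betw \<sigma> {1..n} {1..n}" by (rule iffD1[OF bij_betw_cong, rotated]) (simp add: \<sigma>_def)
  qed (auto simp: \<sigma>_def)
  have \<sigma>_xs: "map \<sigma> [1..<p] = xs"
  proof (rule nth_equalityI)
    show len: "length (map \<sigma> [1..<p]) = length xs" by (simp add: p_def del: upt_Suc)
    fix i assume "i < length (map \<sigma> [1..<p])"
    then have "i < length xs" "i < length [1..<p]" "1 + i < p" using len by (simp_all add: p_def)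
    then show "map \<sigma> [1..<p] ! i = xs ! i" using p by (simp add: \<sigma>_def nth_append del: upt_Suc)
  qed
  have \<sigma>_ys: "map \<sigma> [p + 2..<n + 1] = ys"
  proof (rule nth_equalityI)
    show len: "length (map \<sigma> [p + 2..<n + 1]) = length ys" by (simp add: n del: upt_Suc)
    fix i assume "i < length (map \<sigma> [p + 2..<n + 1])"
    then have "i < length ys" "i < length [p + 2..<n + 1]" "p + 2 + i < n + 1" "p + 2 + i \<in> {1..n}"
      using len by (simp_all add: n del: upt_Suc)
    then show "map \<sigma> [p + 2..<n + 1] ! i = ys ! i"
      by (simp add: \<sigma>_def nth_append p_def del: upt_Suc)
  qed
  have \<sigma>_p: "\<sigma> p = a" "\<sigma> (p + 1) = b" using p n by (auto simp: \<sigma>_def p_def nth_append)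
  have "symc_act \<sigma> (u - v) = symc_act \<sigma> u - symc_act \<sigma> v" for u v :: "nat list \<Rightarrow>\<^sub>0 dias"
  proof -
    have "symc_act \<sigma> (u - v + v) = symc_act \<sigma> (u - v) + symc_act \<sigma> v"
      unfolding symc_act_def by (rule sum_keys_add) (simp add: single_add)
    then show ?thesis by simp
  qed
  moreover have "symc_act \<sigma> (Poly_Mapping.single u y) = Poly_Mapping.single (map \<sigma> u) y" for u and y :: dias
    by (auto simp: symc_act_def)
  ultimately have "symc_act \<sigma> x = marked_word n c ?w - marked_word n c ?w'"
    by (simp add: x \<sigma>_xs \<sigma>_ys \<sigma>_p marked_word_def del: upt_Suc One_nat_def add_2_eq_Suc')
  moreover have "sym_ideal SymDias {perm_relation} n (symc_act \<sigma> x)"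
    using sym_ideal.intros(7)[OF _ \<sigma> x_ideal] p by (simp add: SymDias_act)
  ultimately show ?thesis using sym_ideal_perm_ideal by metis
qed

text \<open>The missing case, a mark on \<open>b\<close>, is the previous one with the two words exchanged.\<close>

lemma marked_word_swap:
  assumes w: "xs @ a # b # ys \<in> permutations_of_set {1..n}" and c: "c \<in> {1..n}"
  shows "marked_word n c (xs @ a # b # ys) - marked_word n c (xs @ b # a # ys) \<in> perm_ideal"
proof (cases "c = b")
  case True
  have "xs @ b # a # ys \<in> permutations_of_set {1..n}" using w by (auto simp: permutations_of_set_def)
  moreover have "c \<noteq> a" using True permutation_word(2)[OF w] by auto
  ultimately have "marked_word n c (xs @ b # a # ys) - marked_word n c (xs @ a # b # ys) \<in> perm_ideal"
    using marked_word_swap_aux c by blast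
  then show ?thesis using ratv.subspace_neg[OF perm_ideal_subspace] by (metis minus_diff_eq)
qed (use marked_word_swap_aux assms in blast)

lemma marked_word_sorted:
  assumes w: "w \<in> permutations_of_set {1..n}" and c: "c \<in> {1..n}"
  shows "marked_word n c w - marked_word n c [1..<n + 1] \<in> perm_ideal"
proof -
  define R where "R u v \<longleftrightarrow> marked_word n c u - marked_word n c v \<in> perm_ideal" for u v
  have mset: "mset u = mset_set {1..n} \<longleftrightarrow> u \<in> permutations_of_set {1..n}" for u
  proof
    assume u: "mset u = mset_set {1..n}"
    then have "set u = {1..n}" by (metis finite_atLeastAtMost finite_set_mset_mset_set set_mset_mset)
    moreover have "distinct u" by (rule mset_eq_mset_set_imp_distinct[OF _ u[symmetric]]) simp
    ultimately show "u \<in> permutations_of_set {1..n}" by (rule permutations_of_setI)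
  next
    assume "u \<in> permutations_of_set {1..n}"
    then show "mset u = mset_set {1..n}" using mset_set_set[of u] permutation_word by simp
  qed
  have "R w (sort w)"
  proof (rule sort_by_adjacent_swaps[where M = "mset_set {1..n}"])
    show "R u u" for u by (simp add: R_def ratv.subspace_0[OF perm_ideal_subspace])
    show "R u v \<Longrightarrow> R v x \<Longrightarrow> R u x" for u v x
      unfolding R_def
      using ratv.subspace_add[OF perm_ideal_subspace, of "marked_word n c u - marked_word n c v"
          "marked_word n c v - marked_word n c x"] by simp
    show "R (xs @ a # b # ys) (xs @ b # a # ys)" if "mset (xs @ a # b # ys) = mset_set {1..n}" for xs a b ys
      unfolding R_def using that marked_word_swap[OF _ c] by (simp only: mset)
    show "mset w = mset_set {1..n}" using w by (simp only: mset)
  qed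
  moreover have "sort w = [1..<n + 1]"
  proof (rule sorted_distinct_set_unique)
    show "set (sort w) = set [1..<n + 1]"
      by (simp only: set_sort permutation_word(1)[OF w] set_upt) auto
    show "distinct (sort w)" using permutation_word(2)[OF w] by simp
  qed (simp_all del: upt_Suc)
  ultimately show ?thesis by (simp add: R_def)
qed

text \<open>Modulo the ideal each marked word can be sorted, and the sorted word with marked letter \<open>a\<close> appears with
  coefficient \<open>word_coord n f a\<close>.\<close>

lemma word_coord_kernel:
  assumes f: "f \<in> Comp SymDias n" and 0: "word_coord n f = (\<lambda>_. 0)"
  shows "f \<in> perm_ideal"
proof -
  let ?I = "[1..<n + 1]"
  let ?x = "\<lambda>w a. dias_coord n (lookup f w) (position a w)"
  have expand: "Poly_Mapping.single w (lookup f w) = (\<Sum>a\<in>{1..n}. ?x w a *\<^sub>Q marked_word n a w)"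
    if w: "w \<in> keys f" for w
  proof -
    have "lookup f w = (\<Sum>i\<in>{1..n}. dias_coord n (lookup f w) i *\<^sub>Q dias_basis n i)"
      by (rule Dias.expand[OF SymDias_keys(2)[OF f]])
    also have "\<dots> = (\<Sum>a\<in>{1..n}. ?x w a *\<^sub>Q dias_basis n (position a w))"
      by (rule sum.reindex_bij_betw[OF bij_betw_position(1)[OF SymDias_keys(1)[OF f w]], symmetric])
    finally have "Poly_Mapping.single w (lookup f w) =
        Poly_Mapping.single w (\<Sum>a\<in>{1..n}. ?x w a *\<^sub>Q dias_basis n (position a w))" by simp
    also have "\<dots> = (\<Sum>a\<in>{1..n}. ?x w a *\<^sub>Q marked_word n a w)"
      by (rule poly_mapping_eqI)
        (simp add: lookup_sum lookup_scaleQ marked_word_def lookup_single when_def)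
    finally show ?thesis .
  qed
  have "f = (\<Sum>w\<in>keys f. \<Sum>a\<in>{1..n}. ?x w a *\<^sub>Q marked_word n a w)"
    by (subst sum_singles[of f, symmetric]) (rule sum.cong[OF refl expand])
  also have "\<dots> = (\<Sum>w\<in>keys f. \<Sum>a\<in>{1..n}. ?x w a *\<^sub>Q (marked_word n a w - marked_word n a ?I))
      + (\<Sum>w\<in>keys f. \<Sum>a\<in>{1..n}. ?x w a *\<^sub>Q marked_word n a ?I)"
    by (simp add: sum.distrib[symmetric] ratv.scale_right_diff_distrib)
  also have "(\<Sum>w\<in>keys f. \<Sum>a\<in>{1..n}. ?x w a *\<^sub>Q marked_word n a ?I) =
      (\<Sum>a\<in>{1..n}. word_coord n f a *\<^sub>Q marked_word n a ?I)"
    by (subst sum.swap) (simp add: word_coord_def word_vec_def ratv.scale_sum_left)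
  also have "\<dots> = 0" by (simp add: 0)
  finally have eq: "f = (\<Sum>w\<in>keys f. \<Sum>a\<in>{1..n}. ?x w a *\<^sub>Q (marked_word n a w - marked_word n a ?I))"
    by simp
  have "(\<Sum>w\<in>keys f. \<Sum>a\<in>{1..n}. ?x w a *\<^sub>Q (marked_word n a w - marked_word n a ?I)) \<in> perm_ideal"
    by (intro ratv.subspace_sum[OF perm_ideal_subspace] ratv.subspace_scale[OF perm_ideal_subspace]
        marked_word_sorted SymDias_keys(1)[OF f])
  then show ?thesis using eq by simp
qed

section \<open>The action of \<open>\<SS>\<^bsub>n+1\<^esub>\<close> on the symmetrization\<close>

text \<open>Rotating the word \<open>u\<close> by \<open>k\<close> places and the coordinates of the operation by the same amount leaves the
  entry attached to each letter unchanged. The chosen \<open>k\<close> moves the letter \<open>n + 1\<close> to the end, where it belongs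
  to the last entry.\<close>

lemma word_rotation:
  assumes w: "w \<in> permutations_of_set {1..n}" and \<pi>: "\<pi> permutes {1..n + 1}"
  defines "u \<equiv> map \<pi> (w @ [n + 1])"
  defines "k \<equiv> position (n + 1) u mod (n + 1)"
  shows "butlast (rotate k u) \<in> permutations_of_set {1..n}"
    and "word_vec n (butlast (rotate k u)) ((vact (long_cycle n) ^^ k) v) = vact \<pi> (word_vec n w v)"
proof -
  note W = permutation_word[OF w]
  have w': "set (w @ [n + 1]) = {1..n + 1}" "distinct (w @ [n + 1])" using W by auto
  have "set u = \<pi> ` set (w @ [n + 1])" unfolding u_def by (rule set_map)
  then have set_u: "set u = {1..n + 1}" using permutes_image[OF \<pi>] by (simp only: w')
  have dist_u: "distinct u"
    unfolding u_def distinct_map using w'(2) permutes_inj_on[OF \<pi>] by blast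
  have len_u: "length u = n + 1" using W by (simp add: u_def)
  define r where "r = rotate k u"
  have r: "set r = {1..n + 1}" "distinct r" "length r = n + 1"
    by (simp_all only: r_def set_rotate distinct_rotate length_rotate set_u dist_u len_u)
  have r_nth: "r ! j = u ! ((k + j) mod (n + 1))" if "j < n + 1" for j
    using nth_rotate[of j u k] that len_u by (simp only: r_def)
  define P where "P = position (n + 1) u"
  have "n + 1 \<in> set u" by (simp only: set_u) simp
  then have P: "P \<in> {1..n + 1}" "u ! (P - 1) = n + 1"
    using position_in[of "n + 1" u] nth_position[of "n + 1" u] len_u by (simp_all only: P_def)
  have "(k + n) mod (n + 1) = (P - 1 + (n + 1)) mod (n + 1)"
    using P(1) unfolding k_def P_def[symmetric] by (simp add: mod_add_left_eq)
  also have "\<dots> = P - 1" using P(1) by (simp only: mod_add_self2) auto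
  finally have "r ! n = n + 1" using r_nth[of n] P(2) by simp
  moreover have ne: "r \<noteq> []" using r(3) by auto
  ultimately have "last r = n + 1" by (simp add: last_conv_nth r(3))
  define b where "b = butlast r"
  have r_eq: "r = b @ [n + 1]"
    using append_butlast_last_id[OF ne] \<open>last r = n + 1\<close> by (simp only: b_def)
  have dist_b: "distinct b" "n + 1 \<notin> set b" using r(2) unfolding r_eq by simp_all
  have "set r = set b \<union> {n + 1}" by (simp add: r_eq)
  then have "set b = {1..n + 1} - {n + 1}" using dist_b(2) unfolding r(1) by blast
  also have "\<dots> = {1..n}" by auto
  finally have set_b: "set b = {1..n}" .
  then show "butlast (rotate k u) \<in> permutations_of_set {1..n}"
    using dist_b(1) unfolding b_def r_def by (rule permutations_of_setI)
  have pos_b: "position c b = position c r" if "c \<in> {1..n + 1}" for c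
  proof (cases "c = n + 1")
    case True
    then show ?thesis using dist_b(2) by (simp add: r_eq position_append position_notin position_Cons)
  next
    case False
    then have "c \<in> set b" using that by (simp only: set_b) auto
    then show ?thesis by (simp only: r_eq position_append if_True)
  qed
  have pos_u: "position (\<pi> a) u = position a w" if "a \<in> {1..n + 1}" for a
  proof -
    have "position (\<pi> a) u = position a (w @ [n + 1])"
      unfolding u_def by (rule position_map) (use permutes_inj[OF \<pi>] in \<open>auto dest: injD\<close>)
    also have "\<dots> = position a w"
    proof (cases "a \<in> set w")
      case False
      then have "a = n + 1" using that W(1) by auto
      then show ?thesis using False by (simp add: position_append position_Cons position_notin)
    qed (simp add: position_append)
    finally show ?thesis .
  qed
  have "vact \<pi> (word_vec n w v) = word_vec n b ((vact (long_cycle n) ^^ k) v)"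
  proof (rule vact_eqI[OF permutes_bij[OF \<pi>]])
    fix a
    show "word_vec n b ((vact (long_cycle n) ^^ k) v) (\<pi> a) = word_vec n w v a"
    proof (cases "a \<in> {1..n + 1}")
      case False
      then have "\<pi> a \<notin> {1..n + 1}" using permutes_in_image[OF \<pi>, of a] by simp
      then show ?thesis using False by (simp only: word_vec_out not_False_eq_True)
    next
      case True
      then have \<pi>a: "\<pi> a \<in> {1..n + 1}" using permutes_in_image[OF \<pi>, of a] by simp
      define j where "j = position (\<pi> a) r"
      have "\<pi> a \<in> set r" using \<pi>a by (simp only: r)
      then have j: "j \<in> {1..n + 1}" "r ! (j - 1) = \<pi> a"
        using position_in[of "\<pi> a" r] nth_position[of "\<pi> a" r] by (simp_all only: r j_def)
      have "u ! ((k + (j - 1)) mod (n + 1)) = \<pi> a" using j r_nth[of "j - 1"] by auto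
      then have "position (\<pi> a) u = (k + (j - 1)) mod (n + 1) + 1"
        using position_nth[OF dist_u, of "(k + (j - 1)) mod (n + 1)"] len_u by simp
      then have "(j - 1 + k) mod (n + 1) + 1 = position a w"
        using pos_u[OF True] by (simp only: add.commute)
      then show ?thesis
        by (simp only: word_vec_apply[OF \<pi>a] word_vec_apply[OF True] pos_b[OF \<pi>a] j_def[symmetric]
            vact_long_cycle_power[OF j(1)])
    qed
  qed
  then show "word_vec n (butlast (rotate k u)) ((vact (long_cycle n) ^^ k) v) = vact \<pi> (word_vec n w v)"
    by (simp only: b_def r_def)
qed

lemma dias_tau_power:
  assumes "1 \<le> n" "x \<in> Comp Dias n"
  shows "(dias_tau n ^^ k) x \<in> Comp Dias n \<and>
    dias_coord n ((dias_tau n ^^ k) x) = (vact (long_cycle n) ^^ k) (dias_coord n x)"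
  by (induction k) (use assms in \<open>auto simp: dias_tau_Comp dias_coord_tau\<close>)

lemma symc_act_ext_word:
  assumes n: "1 \<le> n" and \<pi>: "\<pi> permutes {1..n + 1}" and f: "f \<in> Comp SymDias n"
  shows "symc_act_ext dias_tau n \<pi> f \<in> Comp SymDias n"
    and "word_coord n (symc_act_ext dias_tau n \<pi> f) = vact \<pi> (word_coord n f)"
proof -
  note tau = dias_tau_power[OF n SymDias_keys(2)[OF f]]
  show "symc_act_ext dias_tau n \<pi> f \<in> Comp SymDias n"
    unfolding symc_act_ext_def Let_def
    by (intro ratv.subspace_sum[OF subspace_SymDias] single_in_SymDias)
      (use tau word_rotation(1)[OF SymDias_keys(1)[OF f] \<pi>] in auto)
  have "word_coord n (symc_act_ext dias_tau n \<pi> f) a =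
      (\<Sum>w\<in>keys f. vact \<pi> (word_vec n w (dias_coord n (lookup f w))) a)" for a
    unfolding symc_act_ext_def Let_def word_coord_sum word_coord_single
    by (rule sum.cong[OF refl])
      (simp only: tau word_rotation(2)[OF SymDias_keys(1)[OF f] \<pi>])
  then show "word_coord n (symc_act_ext dias_tau n \<pi> f) = vact \<pi> (word_coord n f)"
    by (simp add: fun_eq_iff vact_def word_coord_def)
qed

section \<open>Perm as the standard representation\<close>

lift_definition perm_coord :: "nat \<Rightarrow> perm_space \<Rightarrow> nat \<Rightarrow> rat" is word_coord
proof
  fix n x y a assume "perm_eq x y"
  then show "word_coord n x a = word_coord n y a"
    using word_coord_perm_ideal[of "x - y" n a] by (simp add: perm_eq_def word_coord_diff)
qed

lemma SymDias_perm_eq: "f \<in> Comp SymDias n \<Longrightarrow> perm_eq f f"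
  unfolding perm_eq_refl total_space_def by (rule ratv.span_base) auto

lemma perm_coord_to_perm: "f \<in> Comp SymDias n \<Longrightarrow> perm_coord m (to_perm f) = word_coord m f"
  by (rule perm_coord.abs_eq[OF SymDias_perm_eq])

lemma to_perm_add: "f \<in> Comp SymDias n \<Longrightarrow> g \<in> Comp SymDias n \<Longrightarrow> to_perm f + to_perm g = to_perm (f + g)"
  by (rule plus_perm_space.abs_eq[OF SymDias_perm_eq SymDias_perm_eq])

lemma to_perm_scale: "f \<in> Comp SymDias n \<Longrightarrow> a *\<^sub>Q to_perm f = to_perm (a *\<^sub>Q f)"
  by (rule scaleQ_perm_space.abs_eq[OF SymDias_perm_eq])

lemma to_perm_circ: "f \<in> Comp SymDias m \<Longrightarrow> g \<in> Comp SymDias n \<Longrightarrow>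
    perm_circ k (to_perm f) (to_perm g) = to_perm (symc_circ Dias k f g)"
  by (rule perm_circ.abs_eq[OF SymDias_perm_eq SymDias_perm_eq])

definition perm_basis :: "nat \<Rightarrow> nat \<Rightarrow> perm_space" where
  "perm_basis n i = to_perm (Poly_Mapping.single [1..<n + 1] (dias_basis n i))"

lemma PermWith_simps:
  "Comp (PermWith \<rho>) n = to_perm ` Comp SymDias n" "Circ (PermWith \<rho>) = perm_circ"
  "Unit (PermWith \<rho>) = to_perm (Unit SymDias)" "Act (PermWith \<rho>) = \<rho>"
  by (simp_all add: PermWith_def)

lemma identity_word: "[1..<n + 1] \<in> permutations_of_set {1..n}"
  by (rule permutations_of_setI) auto

lemma word_vec_identity:
  assumes "v \<in> vecs n"
  shows "word_vec n [1..<n + 1] v = v"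
proof (rule vecs_eqI[OF word_vec_vecs[OF identity_word assms] assms])
  fix a assume a: "a \<in> {1..n}"
  then have "position ([1..<n + 1] ! (a - 1)) [1..<n + 1] = a - 1 + 1"
    by (intro position_nth) (auto simp del: upt_Suc)
  moreover have "[1..<n + 1] ! (a - 1) = 1 + (a - 1)" by (rule nth_upt) (use a in auto)
  ultimately have "position a [1..<n + 1] = a" using a by (simp del: upt_Suc)
  then show "word_vec n [1..<n + 1] v a = v a" using a by (simp add: word_vec_def del: upt_Suc)
qed

text \<open>The non-symmetric structure of the quotient does not involve the action \<open>\<rho>\<close>.\<close>

interpretation PermWith: vector_model "PermWith \<rho>" perm_coord perm_basis for \<rho>
proof
  fix n
  show "ratv.subspace (Comp (PermWith \<rho>) n)"
  proof (rule ratv.subspaceI)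
    show "0 \<in> Comp (PermWith \<rho>) n"
      unfolding PermWith_simps zero_perm_space.abs_eq by (intro imageI ratv.subspace_0[OF subspace_SymDias])
  next
    fix x y assume "x \<in> Comp (PermWith \<rho>) n" "y \<in> Comp (PermWith \<rho>) n"
    then show "x + y \<in> Comp (PermWith \<rho>) n"
      unfolding PermWith_simps by (auto simp: to_perm_add intro!: imageI ratv.subspace_add[OF subspace_SymDias])
  next
    fix a x assume "x \<in> Comp (PermWith \<rho>) n"
    then show "a *\<^sub>Q x \<in> Comp (PermWith \<rho>) n"
      unfolding PermWith_simps by (auto simp: to_perm_scale intro!: imageI ratv.subspace_scale[OF subspace_SymDias])
  qed
next
  fix x y n i assume "x \<in> Comp (PermWith \<rho>) n" "y \<in> Comp (PermWith \<rho>) n"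
  then obtain f g where fg: "f \<in> Comp SymDias n" "g \<in> Comp SymDias n" "x = to_perm f" "y = to_perm g"
    by (auto simp: PermWith_simps)
  then show "perm_coord n (x + y) i = perm_coord n x i + perm_coord n y i"
    by (simp add: to_perm_add perm_coord_to_perm[OF ratv.subspace_add[OF subspace_SymDias fg(1,2)]]
        perm_coord_to_perm[OF fg(1)] perm_coord_to_perm[OF fg(2)] word_coord_add)
next
  fix x n a i assume "x \<in> Comp (PermWith \<rho>) n"
  then obtain f where f: "f \<in> Comp SymDias n" "x = to_perm f" by (auto simp: PermWith_simps)
  then show "perm_coord n (a *\<^sub>Q x) i = a * perm_coord n x i"
    by (simp add: to_perm_scale perm_coord_to_perm[OF ratv.subspace_scale[OF subspace_SymDias f(1)]]
        perm_coord_to_perm[OF f(1)] word_coord_scale)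
next
  fix x n assume "x \<in> Comp (PermWith \<rho>) n"
  then obtain f where f: "f \<in> Comp SymDias n" "x = to_perm f" by (auto simp: PermWith_simps)
  then show "perm_coord n x \<in> vecs n" by (simp add: perm_coord_to_perm word_coord_vecs)
  assume "perm_coord n x = (\<lambda>_. 0)"
  then have "f \<in> perm_ideal" using word_coord_kernel f perm_coord_to_perm[OF f(1)] by simp
  then have "perm_eq f 0"
    using SymDias_perm_eq[OF f(1)] ratv.subspace_0[OF total_SymDias_subspace]
    unfolding perm_eq_refl by (simp add: perm_eq_def)
  then have "to_perm f = to_perm 0" by (rule Quotient3_rel_abs[OF Quotient3_perm_space])
  then show "x = 0" by (simp add: f(2) zero_perm_space.abs_eq)
next
  fix i n :: nat assume i: "i \<in> {1..n}"
  note single = single_in_SymDias[OF identity_word Dias.basis_Comp[OF i]]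
  show "perm_basis n i \<in> Comp (PermWith \<rho>) n"
    unfolding perm_basis_def PermWith_simps by (rule imageI[OF single])
  show "perm_coord n (perm_basis n i) = basis_vec n i"
    unfolding perm_basis_def perm_coord_to_perm[OF single]
    by (rule ext) (simp only: word_coord_single Dias.coord_basis[OF i] word_vec_identity[OF basis_vec_vecs[OF i]])
next
  have unit: "Unit SymDias = Poly_Mapping.single [1..<1 + 1] (Unit Dias)"
    by (simp add: SymDias_def symmetrization_def)
  note single = single_in_SymDias[OF identity_word Dias.unit_Comp]
  show "Unit (PermWith \<rho>) \<in> Comp (PermWith \<rho>) 1"
    unfolding PermWith_simps unit by (rule imageI[OF single])
  have 1: "1 \<in> {1..1::nat}" by simp
  show "perm_coord 1 (Unit (PermWith \<rho>)) = basis_vec 1 1"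
    unfolding PermWith_simps unit perm_coord_to_perm[OF single]
    by (rule ext) (simp only: word_coord_single Dias.coord_unit word_vec_identity[OF basis_vec_vecs[OF 1]])
next
  fix k m n :: nat and x y
  assume k: "1 \<le> k" "k \<le> m" "1 \<le> n" and xy: "x \<in> Comp (PermWith \<rho>) m" "y \<in> Comp (PermWith \<rho>) n"
  then obtain f g where fg: "f \<in> Comp SymDias m" "g \<in> Comp SymDias n" "x = to_perm f" "y = to_perm g"
    by (auto simp: PermWith_simps)
  have c: "Circ (PermWith \<rho>) k x y = to_perm (symc_circ Dias k f g)"
    by (simp only: PermWith_simps fg(3,4) to_perm_circ[OF fg(1,2)])
  have closed: "symc_circ Dias k f g \<in> Comp SymDias (m + n - 1)"
    using SymDias.circ_closed[OF k fg(1,2)] by (simp only: SymDias_simps(2))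
  then show "Circ (PermWith \<rho>) k x y \<in> Comp (PermWith \<rho>) (m + n - 1)"
    unfolding c PermWith_simps(1) by (rule imageI)
  show "perm_coord (m + n - 1) (Circ (PermWith \<rho>) k x y) = vcirc n k (perm_coord m x) (perm_coord n y)"
    unfolding c unfolding fg(3,4) perm_coord_to_perm[OF closed] perm_coord_to_perm[OF fg(1)] perm_coord_to_perm[OF fg(2)]
    by (rule word_coord_circ[OF k fg(1,2)])
qed

lemma AnticyclicDias_simps:
  "Comp AnticyclicDias = Comp SymDias" "Circ AnticyclicDias = symc_circ Dias"
  "Unit AnticyclicDias = Unit SymDias" "Act AnticyclicDias = symc_act_ext dias_tau"
  by (simp_all add: AnticyclicDias_def anticyclic_symmetrization_def SymDias_def symmetrization_def)

text \<open>The permutation of the entries is an anticyclic structure for which the quotient map is a morphism, so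
  the choice in the definition of \<open>Perm\<close> yields a structure with this property.\<close>

lemma Perm_anticyclic_quotient:
  "\<exists>\<rho>. Perm = PermWith \<rho> \<and> anticyclic_morphism AnticyclicDias Perm to_perm"
proof -
  define \<rho> where "\<rho> n \<sigma> x = PermWith.of_vec n (vact \<sigma> (perm_coord n x))" for n \<sigma> x
  let ?P = "PermWith \<rho>"
  interpret symmetric_vector_model ?P perm_coord perm_basis
  proof
    fix \<sigma> n x assume \<sigma>: "\<sigma> permutes {1..n + 1}" and x: "x \<in> Comp ?P n"
    show "Act ?P n \<sigma> x \<in> Comp ?P n" unfolding PermWith_simps(4) \<rho>_def by (rule PermWith.of_vec_Comp)
    show "perm_coord n (Act ?P n \<sigma> x) = vact \<sigma> (perm_coord n x)"
      unfolding PermWith_simps(4) \<rho>_def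
      by (rule PermWith.coord_of_vec[OF vact_vecs[OF \<sigma> PermWith.coord_vecs[OF x]]])
  qed
  have "anticyclic_morphism AnticyclicDias ?P to_perm"
    unfolding anticyclic_morphism_def AnticyclicDias_simps
  proof (intro conjI allI impI ballI)
    fix n :: nat
    show "lin_on (Comp SymDias n) to_perm" by (auto simp: lin_on_def to_perm_add to_perm_scale)
    show "to_perm ` Comp SymDias n \<subseteq> Comp ?P n" by (simp add: PermWith_simps)
  next
    show "to_perm (Unit SymDias) = Unit ?P" by (simp add: PermWith_simps)
  next
    fix m n k :: nat and f g assume "f \<in> Comp SymDias m" "g \<in> Comp SymDias n"
    then show "to_perm (symc_circ Dias k f g) = Circ ?P k (to_perm f) (to_perm g)"
      by (simp add: PermWith_simps to_perm_circ)
  next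
    fix n :: nat and \<sigma> f assume n: "1 \<le> n" and \<sigma>: "\<sigma> permutes {1..n + 1}" and f: "f \<in> Comp SymDias n"
    note act = symc_act_ext_word[OF n \<sigma> f]
    have in_P: "to_perm g \<in> Comp ?P n" if "g \<in> Comp SymDias n" for g using that by (simp add: PermWith_simps)
    show "to_perm (symc_act_ext dias_tau n \<sigma> f) = Act ?P n \<sigma> (to_perm f)"
    proof (rule PermWith.coord_eqI[OF in_P[OF act(1)] act_Comp[OF \<sigma> in_P[OF f]]])
      fix i
      show "perm_coord n (to_perm (symc_act_ext dias_tau n \<sigma> f)) i = perm_coord n (Act ?P n \<sigma> (to_perm f)) i"
        by (simp only: perm_coord_to_perm[OF act(1)] act(2) coord_act[OF \<sigma> in_P[OF f]] perm_coord_to_perm[OF f])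
    qed
  qed
  then have "\<exists>\<rho>. anticyclic_operad (PermWith \<rho>) \<and> anticyclic_morphism AnticyclicDias (PermWith \<rho>) to_perm"
    using is_anticyclic_operad by blast
  from someI_ex[OF this] show ?thesis unfolding Perm_def by blast
qed

text \<open>The quotient map is surjective, so being a morphism determines the chosen action on \<open>Perm\<close>.\<close>

lemma trace_Perm:
  assumes n: "n \<ge> 1" and \<sigma>: "\<sigma> permutes {1..n + 1}"
  shows "trace_on (Comp Perm n) (Act Perm n \<sigma>) = of_nat (card {i\<in>{1..n + 1}. \<sigma> i = i}) - 1"
proof -
  obtain \<rho> where \<rho>: "Perm = PermWith \<rho>" and mor: "anticyclic_morphism AnticyclicDias Perm to_perm"
    using Perm_anticyclic_quotient by blast
  have act: "Act Perm n \<sigma> (to_perm f) = to_perm (symc_act_ext dias_tau n \<sigma> f)" if "f \<in> Comp SymDias n" for f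
    using mor n \<sigma> that unfolding anticyclic_morphism_def AnticyclicDias_simps by metis
  show ?thesis
    unfolding \<rho>
  proof (rule PermWith.trace_on_permutation[OF \<sigma>])
    fix x assume "x \<in> Comp (PermWith \<rho>) n"
    then obtain f where f: "f \<in> Comp SymDias n" "x = to_perm f" by (auto simp: PermWith_simps)
    note ext = symc_act_ext_word[OF n \<sigma> f(1)]
    have x: "Act (PermWith \<rho>) n \<sigma> x = to_perm (symc_act_ext dias_tau n \<sigma> f)"
      using act[OF f(1)] by (simp only: \<rho> f(2))
    show "Act (PermWith \<rho>) n \<sigma> x \<in> Comp (PermWith \<rho>) n"
      unfolding x PermWith_simps(1) by (rule imageI[OF ext(1)])
    show "perm_coord n (Act (PermWith \<rho>) n \<sigma> x) = vact \<sigma> (perm_coord n x)"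
      unfolding x unfolding f(2) by (simp only: perm_coord_to_perm[OF ext(1)] perm_coord_to_perm[OF f(1)] ext(2))
  qed
qed

theorem corollary5p3:
  shows "Ch Perm =
    (power_sum 1 - 1) * series_exp (series_sum {1..} (\<lambda>k. (1 / of_nat k) *\<^sub>Q power_sum k)) + 1"
  unfolding series_exp_power_sums by (rule Ch_standard[OF trace_Perm])

end
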